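(* For every Toeplitz subshift $(X,S)$ of finite topological rank there is a finite cyclic group $C$ such that the automorphism group of $(X,S)$ is isomorphic to $\mathbb{Z}\oplus C$. Conversely, for every finite cyclic group $C$ there is a strong Toeplitz subshift of finite rank whose automorphism group is isomorphic to $\mathbb{Z}\oplus C$.
   Context: **Subshifts.** For a finite alphabet $\mathsf{A}$, $S$ is the shift on $\mathsf{A}^{\mathbb{Z}}$, $S(x)(i)=x(i+1)$. A subshift is a closed set $X\subseteq\mathsf{A}^{\mathbb{Z}}$ with $S(X)=X$. Systems $(X,T)$, $(Y,T')$ are conjugate if there is a homeomorphism $\varphi\colon X\to Y$ with $\varphi\circ T=T'\circ\varphi$. The automorphism group of $(X,S)$ is the group of all homeomorphisms of $X$ commuting with $S$. A sequence $x\in\mathsf{A}^{\mathbb{Z}}$ is a Toeplitz sequence if for every $i\in\mathbb{Z}$ there is $p\geq1$ with $x(i)=x(i+kp)$ for all $k\in\mathbb{Z}$. A Toeplitz subshift is the closure of the $S$-orbit of a Toeplitz sequence. **Topological rank** (defined for minimal Cantor systems, i.e. minimal homeomorphisms of a Cantor space; in particular a subshift of finite topological rank is infinite). A Bratteli diagram is an infinite graph $(V,E)$ with $V=\bigsqcup_{n\ge0}V_n$, $E=\bigsqcup_{n\geq1}E_n$, all $V_n,E_n$ finite nonempty, $V_0$ a singleton, with maps $\mathsf{s}\colon E_n\to V_{n-1}$, $\mathsf{r}\colon E_n\to V_n$ such that $\mathsf{s}^{-1}(v)\ne\varnothing$ for all $v\in V$ and $\mathsf{r}^{-1}(v)\neq\varnothing$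 for all $v\in V\setminus V_0$. It is simple if for every $n\geq1$ there is $m>n$ such that every vertex of $V_n$ is joined to every vertex of $V_m$ by a path. Its rank is $\liminf_n|V_n|$ (if finite). An ordered Bratteli diagram has in addition a partial order $\preceq$ on $E$ in which two edges $e,e'$ are comparable iff $\mathsf{r}(e)=\mathsf{r}(e')$. Let $X_B$ be the space of infinite paths $(e_n)_{n\ge1}$, $e_n\in E_n$, $\mathsf{r}(e_n)=\mathsf{s}(e_{n+1})$, with the subspace topology from $\prod_n E_n$. The diagram is properly ordered if there is a unique path $x_{\max}$ consisting of maximal edges and a unique path $x_{\min}$ consisting of minimal edges. For a simple properly ordered diagram $B$, the Vershik map $\lambda_B\colon X_B\to X_B$ sends $x_{\max}$ to $x_{\min}$, and otherwise sends $(e_n)_n$ to $(f_1,\dots,f_k,e_{k+1},\dots)$, where $k$ is least with $e_k$ not maximal, $f_k$ is the $\preceq$-successor of $e_k$, and $(f_1,\dots,f_{k-1})$ is the unique path of minimal edges from $V_0$ to $\mathsf{s}(f_k)$. A minimal Cantor system has finite topological rank if it is conjugate to $(X_B,\lambda_B)$ for some simple properly ordered Bratteli diagram $B$ of finite rank. **Strong Toeplitz subshifts.** A morphism $\tau\colon A^*\to B^*$ between sets of finite words over finite alphabets satisfies $\tau(uv)=\tau(u)\tau(v)$; all morphisms are non-erasing ($\tau(a)$ is nonempty for all $a\in A$). For $y\in A^{\mathbb{Z}}$, $\tau(y)=\cdots\tau(y(-1)).\tau(y(0))\tau(y(1))\cdots$, where the dot marks that position $0$ is the start of $\tau(y(0))$.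 A directive sequence is a sequence of morphisms $\boldsymbol{\tau}=(\tau_n\colon A_{n+1}^*\to A_n^* )_{n\geq0}$; put $\tau_{[n,N)}=\tau_n\circ\cdots\circ\tau_{N-1}$. $X^{(n)}_{\boldsymbol{\tau}}$ is the set of $x\in A_n^{\mathbb{Z}}$ such that every finite subword of $x$ occurs in $\tau_{[n,N)}(a)$ for some $N>n$, $a\in A_N$; $X_{\boldsymbol{\tau}}=X^{(0)}_{\boldsymbol{\tau}}$ is the $\mathcal{S}$-adic subshift generated by $\boldsymbol{\tau}$. The alphabet rank of $\boldsymbol{\tau}$ is $\liminf_n|A_n|$. $\boldsymbol{\tau}$ is: constant-length if for each $n$, $|\tau_n(a)|$ does not depend on $a\in A_{n+1}$; primitive if for every $n$ there is $N>n$ such that all letters of $A_n$ occur in $\tau_{[n,N)}(a)$ for all $a\in A_N$; proper if for each $n$ all words $\tau_n(a)$, $a\in A_{n+1}$, start with the same letter and end with the same letter; recognizable if for each $n$ every $x\in A_n^{\mathbb{Z}}$ admits at most one pair $(y,k)$ with $y\in X^{(n+1)}_{\boldsymbol{\tau}}$, $0\leq k<|\tau_n(y(0))|$ and $x=S^k\tau_n(y)$. For $K\geq2$, a strong Toeplitz subshift of rank $K$ is a subshift conjugate to an $\mathcal{S}$-adic subshift generated by a constant-length, primitive, proper and recognizable directive sequence of alphabet rank $k\leq K$; a strong Toeplitz subshift of finite rank is one that is a strong Toeplitz subshift of rank $K$ for some $K$. *)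

theory Defs
  imports
    "HOL-Analysis.Analysis"
    "HOL-Algebra.Elementary_Groups"
    "HOL-Algebra.Bij"
    "HOL-Library.Sublist"
    "HOL-Library.Extended_Nat"
    "HOL-Library.Liminf_Limsup"
    "HOL-Library.Disjoint_Sets"
begin

section \<open>Topological dynamical systems\<close>

text \<open>A system is a topology \<open>T\<close> together with a map \<open>f\<close>, of which only the values on
  \<open>topspace T\<close> matter.\<close>

definition conjugate_systems ::
  "'a topology \<Rightarrow> ('a \<Rightarrow> 'a) \<Rightarrow> 'b topology \<Rightarrow> ('b \<Rightarrow> 'b) \<Rightarrow> bool" where
  "conjugate_systems T f U g \<longleftrightarrow>
     (\<exists>\<phi>. homeomorphic_map T U \<phi> \<and> (\<forall>x\<in>topspace T. \<phi> (f x) = g (\<phi> x)))"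

text \<open>As in \<^theory>\<open>HOL-Algebra.Bij\<close>, automorphisms are represented by functions that are
  \<open>undefined\<close> outside the space, so that each homeomorphism has exactly one representative.\<close>

definition automorphism_group :: "'a topology \<Rightarrow> ('a \<Rightarrow> 'a) \<Rightarrow> ('a \<Rightarrow> 'a) monoid" where
  "automorphism_group T f =
     BijGroup (topspace T)
       \<lparr>carrier := {h \<in> Bij (topspace T).
                     homeomorphic_map T T h \<and> (\<forall>x\<in>topspace T. h (f x) = f (h x))}\<rparr>"

definition cantor_space :: "'a topology \<Rightarrow> bool" where
  "cantor_space T \<longleftrightarrow>
     T homeomorphic_space product_topology (\<lambda>_::nat. discrete_topology (UNIV :: bool set)) UNIV"

definition minimal_cantor_system :: "'a topology \<Rightarrow> ('a \<Rightarrow> 'a) \<Rightarrow> bool" where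
  "minimal_cantor_system T f \<longleftrightarrow>
     cantor_space T \<and> homeomorphic_map T T f \<and>
     (\<forall>C. closedin T C \<and> f ` C = C \<longrightarrow> C = {} \<or> C = topspace T)"


section \<open>Subshifts\<close>

definition shift :: "(int \<Rightarrow> 'a) \<Rightarrow> int \<Rightarrow> 'a" where
  "shift x = (\<lambda>i. x (i + 1))"

definition full_shift :: "'a set \<Rightarrow> (int \<Rightarrow> 'a) topology" where
  "full_shift A = product_topology (\<lambda>_. discrete_topology A) UNIV"

definition shift_top :: "'a set \<Rightarrow> (int \<Rightarrow> 'a) set \<Rightarrow> (int \<Rightarrow> 'a) topology" where
  "shift_top A X = subtopology (full_shift A) X"

definition subshift :: "'a set \<Rightarrow> (int \<Rightarrow> 'a) set \<Rightarrow> bool" where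
  "subshift A X \<longleftrightarrow> finite A \<and> closedin (full_shift A) X \<and> shift ` X = X"

definition toeplitz_sequence :: "(int \<Rightarrow> 'a) \<Rightarrow> bool" where
  "toeplitz_sequence x \<longleftrightarrow> (\<forall>i. \<exists>p\<ge>1. \<forall>k. x i = x (i + k * p))"

definition toeplitz_subshift :: "'a set \<Rightarrow> (int \<Rightarrow> 'a) set \<Rightarrow> bool" where
  "toeplitz_subshift A X \<longleftrightarrow>
     finite A \<and>
     (\<exists>x. (\<forall>i. x i \<in> A) \<and> toeplitz_sequence x \<and>
          X = full_shift A closure_of (range (\<lambda>n i. x (i + n))))"


section \<open>Bratteli diagrams and topological rank\<close>

text \<open>\<open>edges n\<close> is the set of edges from \<open>verts n\<close> to \<open>verts (n + 1)\<close>, usually written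
  \<open>E\<close> with index \<open>n + 1\<close>. Accordingly an infinite path \<open>p\<close> has \<open>p n \<in> edges n\<close>, starting from
  \<open>n = 0\<close>.\<close>

record ('v, 'e) ordered_bratteli =
  verts :: "nat \<Rightarrow> 'v set"
  edges :: "nat \<Rightarrow> 'e set"
  src :: "'e \<Rightarrow> 'v"
  rng :: "'e \<Rightarrow> 'v"
  edge_order :: "'e rel"

definition all_edges :: "('v, 'e, 'm) ordered_bratteli_scheme \<Rightarrow> 'e set" where
  "all_edges B = (\<Union>n. edges B n)"

definition bratteli_diagram :: "('v, 'e, 'm) ordered_bratteli_scheme \<Rightarrow> bool" where
  "bratteli_diagram B \<longleftrightarrow>
     disjoint_family (verts B) \<and> disjoint_family (edges B) \<and>
     (\<forall>n. finite (verts B n) \<and> verts B n \<noteq> {}) \<and>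
     (\<forall>n. finite (edges B n) \<and> edges B n \<noteq> {}) \<and>
     (\<exists>v. verts B 0 = {v}) \<and>
     (\<forall>n. \<forall>e\<in>edges B n. src B e \<in> verts B n \<and> rng B e \<in> verts B (Suc n)) \<and>
     (\<forall>n. \<forall>v\<in>verts B n. \<exists>e\<in>all_edges B. src B e = v) \<and>
     (\<forall>n\<ge>1. \<forall>v\<in>verts B n. \<exists>e\<in>all_edges B. rng B e = v)"

definition ordered_bratteli_diagram :: "('v, 'e, 'm) ordered_bratteli_scheme \<Rightarrow> bool" where
  "ordered_bratteli_diagram B \<longleftrightarrow>
     bratteli_diagram B \<and> partial_order_on (all_edges B) (edge_order B) \<and>
     (\<forall>e\<in>all_edges B. \<forall>e'\<in>all_edges B.
        (e, e') \<in> edge_order B \<or> (e', e) \<in> edge_order B \<longleftrightarrow> rng B e = rng B e')"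

definition joined :: "('v, 'e, 'm) ordered_bratteli_scheme \<Rightarrow> 'v \<Rightarrow> 'v \<Rightarrow> bool" where
  "joined B v w \<longleftrightarrow> (v, w) \<in> ((\<lambda>e. (src B e, rng B e)) ` all_edges B)\<^sup>+"

definition simple_bratteli :: "('v, 'e, 'm) ordered_bratteli_scheme \<Rightarrow> bool" where
  "simple_bratteli B \<longleftrightarrow>
     (\<forall>n\<ge>1. \<exists>m>n. \<forall>v\<in>verts B n. \<forall>w\<in>verts B m. joined B v w)"

definition bratteli_rank :: "('v, 'e, 'm) ordered_bratteli_scheme \<Rightarrow> enat" where
  "bratteli_rank B = liminf (\<lambda>n. enat (card (verts B n)))"

definition paths :: "('v, 'e, 'm) ordered_bratteli_scheme \<Rightarrow> (nat \<Rightarrow> 'e) set" where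
  "paths B = {p. \<forall>n. p n \<in> edges B n \<and> rng B (p n) = src B (p (Suc n))}"

definition path_space :: "('v, 'e, 'm) ordered_bratteli_scheme \<Rightarrow> (nat \<Rightarrow> 'e) topology" where
  "path_space B =
     subtopology (product_topology (\<lambda>n. discrete_topology (edges B n)) UNIV) (paths B)"

definition max_edge :: "('v, 'e, 'm) ordered_bratteli_scheme \<Rightarrow> 'e \<Rightarrow> bool" where
  "max_edge B e \<longleftrightarrow> e \<in> all_edges B \<and> (\<forall>e'\<in>all_edges B. (e, e') \<in> edge_order B \<longrightarrow> e' = e)"

definition min_edge :: "('v, 'e, 'm) ordered_bratteli_scheme \<Rightarrow> 'e \<Rightarrow> bool" where
  "min_edge B e \<longleftrightarrow> e \<in> all_edges B \<and> (\<forall>e'\<in>all_edges B. (e', e) \<in> edge_order B \<longrightarrow> e' = e)"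

definition edge_succ :: "('v, 'e, 'm) ordered_bratteli_scheme \<Rightarrow> 'e \<Rightarrow> 'e" where
  "edge_succ B e =
     (THE f. f \<in> all_edges B \<and> f \<noteq> e \<and> (e, f) \<in> edge_order B \<and>
        (\<forall>g\<in>all_edges B. g \<noteq> e \<and> (e, g) \<in> edge_order B \<longrightarrow> (f, g) \<in> edge_order B))"

definition properly_ordered :: "('v, 'e, 'm) ordered_bratteli_scheme \<Rightarrow> bool" where
  "properly_ordered B \<longleftrightarrow>
     ordered_bratteli_diagram B \<and>
     (\<exists>!p. p \<in> paths B \<and> (\<forall>n. max_edge B (p n))) \<and>
     (\<exists>!p. p \<in> paths B \<and> (\<forall>n. min_edge B (p n)))"

definition vershik_map :: "('v, 'e, 'm) ordered_bratteli_scheme \<Rightarrow> (nat \<Rightarrow> 'e) \<Rightarrow> nat \<Rightarrow> 'e" where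
  "vershik_map B p =
     (if \<forall>n. max_edge B (p n)
      then THE q. q \<in> paths B \<and> (\<forall>n. min_edge B (q n))
      else let k = LEAST n. \<not> max_edge B (p n)
           in THE q. q \<in> paths B \<and> (\<forall>n<k. min_edge B (q n)) \<and>
                     q k = edge_succ B (p k) \<and> (\<forall>n>k. q n = p n))"

text \<open>A Bratteli diagram has countably many vertices and edges, so labelling them by natural
  numbers is no restriction.\<close>

definition finite_topological_rank :: "'a topology \<Rightarrow> ('a \<Rightarrow> 'a) \<Rightarrow> bool" where
  "finite_topological_rank T f \<longleftrightarrow>
     minimal_cantor_system T f \<and>
     (\<exists>B :: (nat, nat) ordered_bratteli.
        properly_ordered B \<and> simple_bratteli B \<and> bratteli_rank B < \<infinity> \<and>
        conjugate_systems T f (path_space B) (vershik_map B))"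


section \<open>S-adic subshifts and strong Toeplitz subshifts\<close>

definition word_morphism :: "'a set \<Rightarrow> 'b set \<Rightarrow> ('a list \<Rightarrow> 'b list) \<Rightarrow> bool" where
  "word_morphism A B \<tau> \<longleftrightarrow>
     (\<forall>u\<in>lists A. \<tau> u \<in> lists B) \<and>
     (\<forall>u\<in>lists A. \<forall>v\<in>lists A. \<tau> (u @ v) = \<tau> u @ \<tau> v) \<and>
     (\<forall>a\<in>A. \<tau> [a] \<noteq> [])"

text \<open>\<open>cut \<tau> y k\<close> is the position in \<open>\<tau> (y)\<close> at which the block \<open>\<tau> (y (k))\<close> starts.\<close>

definition cut :: "('a list \<Rightarrow> 'b list) \<Rightarrow> (int \<Rightarrow> 'a) \<Rightarrow> int \<Rightarrow> int" where
  "cut \<tau> y k =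
     (if 0 \<le> k then (\<Sum>i\<in>{0..<k}. int (length (\<tau> [y i])))
      else - (\<Sum>i\<in>{k..<0}. int (length (\<tau> [y i]))))"

definition morph_seq :: "('a list \<Rightarrow> 'b list) \<Rightarrow> (int \<Rightarrow> 'a) \<Rightarrow> int \<Rightarrow> 'b" where
  "morph_seq \<tau> y =
     (\<lambda>i. let k = THE k. cut \<tau> y k \<le> i \<and> i < cut \<tau> y (k + 1)
          in \<tau> [y k] ! nat (i - cut \<tau> y k))"

text \<open>Alphabets are finite sets of natural numbers without loss of generality. They are required
  to be nonempty: otherwise all conditions below hold vacuously from some level on.\<close>

definition directive_sequence ::
  "(nat \<Rightarrow> nat set) \<Rightarrow> (nat \<Rightarrow> nat list \<Rightarrow> nat list) \<Rightarrow> bool" where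
  "directive_sequence A \<tau> \<longleftrightarrow>
     (\<forall>n. finite (A n) \<and> A n \<noteq> {} \<and> word_morphism (A (Suc n)) (A n) (\<tau> n))"

definition seg :: "(nat \<Rightarrow> nat list \<Rightarrow> nat list) \<Rightarrow> nat \<Rightarrow> nat \<Rightarrow> nat list \<Rightarrow> nat list" where
  "seg \<tau> n N = foldr (\<circ>) (map \<tau> [n..<N]) id"

definition level_shift ::
  "(nat \<Rightarrow> nat set) \<Rightarrow> (nat \<Rightarrow> nat list \<Rightarrow> nat list) \<Rightarrow> nat \<Rightarrow> (int \<Rightarrow> nat) set" where
  "level_shift A \<tau> n =
     {x. (\<forall>i. x i \<in> A n) \<and>
         (\<forall>i j. \<exists>N>n. \<exists>a\<in>A N. sublist (map x [i..j]) (seg \<tau> n N [a]))}"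

definition alphabet_rank :: "(nat \<Rightarrow> nat set) \<Rightarrow> enat" where
  "alphabet_rank A = liminf (\<lambda>n. enat (card (A n)))"

definition constant_length ::
  "(nat \<Rightarrow> nat set) \<Rightarrow> (nat \<Rightarrow> nat list \<Rightarrow> nat list) \<Rightarrow> bool" where
  "constant_length A \<tau> \<longleftrightarrow>
     (\<forall>n. \<forall>a\<in>A (Suc n). \<forall>b\<in>A (Suc n). length (\<tau> n [a]) = length (\<tau> n [b]))"

definition primitive ::
  "(nat \<Rightarrow> nat set) \<Rightarrow> (nat \<Rightarrow> nat list \<Rightarrow> nat list) \<Rightarrow> bool" where
  "primitive A \<tau> \<longleftrightarrow> (\<forall>n. \<exists>N>n. \<forall>a\<in>A N. A n \<subseteq> set (seg \<tau> n N [a]))"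

definition proper ::
  "(nat \<Rightarrow> nat set) \<Rightarrow> (nat \<Rightarrow> nat list \<Rightarrow> nat list) \<Rightarrow> bool" where
  "proper A \<tau> \<longleftrightarrow>
     (\<forall>n. \<forall>a\<in>A (Suc n). \<forall>b\<in>A (Suc n).
        hd (\<tau> n [a]) = hd (\<tau> n [b]) \<and> last (\<tau> n [a]) = last (\<tau> n [b]))"

definition recognizable ::
  "(nat \<Rightarrow> nat set) \<Rightarrow> (nat \<Rightarrow> nat list \<Rightarrow> nat list) \<Rightarrow> bool" where
  "recognizable A \<tau> \<longleftrightarrow>
     (\<forall>n. \<forall>x. (\<forall>i. x i \<in> A n) \<longrightarrow>
        (\<exists>\<^sub>\<le>\<^sub>1 (y, k). y \<in> level_shift A \<tau> (Suc n) \<and> k < length (\<tau> n [y 0]) \<and>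
                     x = (shift ^^ k) (morph_seq (\<tau> n) y)))"

definition strong_toeplitz_of_rank :: "nat \<Rightarrow> 'a set \<Rightarrow> (int \<Rightarrow> 'a) set \<Rightarrow> bool" where
  "strong_toeplitz_of_rank K A X \<longleftrightarrow>
     subshift A X \<and>
     (\<exists>D \<tau>. directive_sequence D \<tau> \<and> constant_length D \<tau> \<and> primitive D \<tau> \<and> proper D \<tau> \<and>
        recognizable D \<tau> \<and> alphabet_rank D \<le> enat K \<and>
        conjugate_systems (shift_top A X) shift (shift_top (D 0) (level_shift D \<tau> 0)) shift)"

definition strong_toeplitz_of_finite_rank :: "'a set \<Rightarrow> (int \<Rightarrow> 'a) set \<Rightarrow> bool" where
  "strong_toeplitz_of_finite_rank A X \<longleftrightarrow> (\<exists>K\<ge>2. strong_toeplitz_of_rank K A X)"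

end

theory Submission
  imports Defs
begin

text \<open>
  An automorphism of a minimal subshift is a block code, and it is determined by its value at a single point,
  indeed by the right tail of that value (\<open>aut_eq_if_asymptotic\<close>). Both halves of the theorem exploit this rigidity.

  \<^bold>\<open>Toeplitz subshifts of finite topological rank.\<close> Let \<open>x0\<close> be a Toeplitz sequence. The closures \<open>Y q\<close> of the
  orbits of \<open>x0\<close> under the \<open>q\<close>-th power of the shift shrink to \<open>x0\<close>, and an automorphism \<open>f\<close> maps \<open>Y q\<close> to a
  translate of \<open>Y q\<close> by some \<open>residue q f\<close>. Residues are additive, and an automorphism with vanishing
  residues is trivial (\<open>residue_mult\<close>, \<open>separated\<close>). Consequently the automorphism group is
  commutative and its finite subgroups are cyclic. It remains to show that the powers of the shift have finite
  index, for then the group is the product of an infinite cyclic group with its finite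
  torsion subgroup (\<open>virtually_cyclic_iso\<close>).

  Finite index is a consequence of finite topological rank alone, once the group is known to be commutative. A deep
  level of the Bratteli diagram cuts every point into arbitrarily long words from a list of at most \<open>K\<close> words
  (\<open>towers_at_level\<close>). Let \<open>F\<close> be a finite set of automorphisms that are pairwise different modulo the shift, and fix a point
  \<open>x\<close>. The points \<open>f x\<close> with \<open>f \<in> F\<close> are parsed into these words. Whenever the same word occurs in \<open>f x\<close> and in \<open>g x\<close>,
  with offset \<open>j\<close>, the point \<open>x\<close> coincides on a long interval with its image under the \<open>j\<close>-th power of the
  shift composed with the quotient of \<open>f\<close> and \<open>g\<close>. Such intervals behave like the runs of a word with a
  period: they are finite, and two of them that overlap sufficiently propagate along each other as in the
  theorem of Fine and Wilf (\<open>extend_match_left\<close>, \<open>extend_match_right\<close>). If \<open>F\<close> is large compared with \<open>K\<close>,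
  the parsings are too crowded for this: a count at the end of a run with the least possible
  offset leads to a contradiction (\<open>few_rivals\<close>, \<open>few_automorphisms_mod_shift\<close>).

  \<^bold>\<open>Prescribed torsion.\<close> Given \<open>m \<ge> 1\<close> let \<open>P = 2 m + 1\<close> and consider the sequence of pairs whose first component at
  \<open>i\<close> is the parity of the exponent of \<open>P\<close> in \<open>2 i + 1\<close> and whose second component is \<open>i mod m\<close>. It generates
  a Toeplitz subshift \<open>Z\<close> over the product of the \<open>P\<close>-adic odometer and the integers modulo \<open>m\<close>. Rotation of the
  second component is an automorphism of order \<open>m\<close>. An asymptotic pair of points of \<open>Z\<close> is unique up to the
  shift and this rotation, and automorphisms permute asymptotic pairs; so there are
  no further automorphisms (\<open>asymptotic_pair\<close>, \<open>aut_form\<close>). Reading the first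
  component in windows of length \<open>m\<close> exhibits \<open>Z\<close> as the S-adic subshift of a constant-length
  directive sequence with \<open>m + 1\<close> letters on all levels but the first (\<open>Z_eq\<close>, \<open>strong_toeplitz_Z\<close>).
\<close>

section \<open>Several parsings of one sequence by few words\<close>

text \<open>Among the six elements with \<open>s\<close> to \<open>s + 5\<close> predecessors the five gaps add up to at most \<open>H\<close>, so one
  of them is at most \<open>H / 5\<close>. The combinatorial argument below needs a small gap that still has most of \<open>A\<close> to its
  left.\<close>

lemma exists_small_gap:
  fixes A :: "int set" and H :: int
  assumes fin: "finite A" and card: "s + 6 \<le> card A"
    and width: "\<And>u v. u \<in> A \<Longrightarrow> v \<in> A \<Longrightarrow> v - u \<le> H"
  obtains p q where "p \<in> A" "q \<in> A" "p < q" "5 * (q - p) \<le> H" "s \<le> card {u \<in> A. u < p}"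
proof -
  define xs where "xs = sorted_list_of_set A"
  have xs: "sorted xs" "distinct xs" "set xs = A" "length xs = card A"
    using fin by (auto simp: xs_def)
  have inA: "xs ! i \<in> A" if "i < card A" for i using that xs by (metis nth_mem)
  have mono: "xs ! i < xs ! j" if "i < j" "j < card A" for i j
    using that xs by (metis sorted_wrt_nth_less strict_sorted_iff)
  have cnt: "s \<le> card {u \<in> A. u < xs ! i}" if "s \<le> i" "i < card A" for i
  proof -
    have inj: "inj_on ((!) xs) {..<i}"
      using xs that by (auto simp: inj_on_def nth_eq_iff_index_eq)
    have sub: "(!) xs ` {..<i} \<subseteq> {u \<in> A. u < xs ! i}"
      using that inA mono by auto
    have "card ((!) xs ` {..<i}) \<le> card {u \<in> A. u < xs ! i}"
      using sub fin by (intro card_mono) auto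
    then show ?thesis using inj that by (simp add: card_image)
  qed
  have "\<exists>i\<in>{s..<s+5}. 5 * (xs ! Suc i - xs ! i) \<le> H"
  proof (rule ccontr)
    assume "\<not> ?thesis"
    then have big: "5 * (xs ! Suc i - xs ! i) > H" if "s \<le> i" "i < s + 5" for i
      using that by (auto simp: not_le)
    have "5 * (xs ! (s+5) - xs ! s) > 5 * H"
      using big[of s] big[of "s+1"] big[of "s+2"] big[of "s+3"] big[of "s+4"]
      by (simp add: eval_nat_numeral)
    moreover have "xs ! (s+5) - xs ! s \<le> H"
      using card by (intro width inA) auto
    ultimately show False by simp
  qed
  then obtain i where i: "s \<le> i" "i < s + 5" "5 * (xs ! Suc i - xs ! i) \<le> H" by auto
  show ?thesis
    by (rule that[of "xs ! i" "xs ! Suc i"]) (use i card inA mono cnt in auto)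
qed

text \<open>The recursion is dictated by the count in \<open>few_rivals\<close>: a crowd of \<open>crowd_bound K (Suc q)\<close> parsings
  loses fewer than \<open>crowd_bound K q\<close> members when one type is singled out, six more to
  \<open>exists_small_gap\<close>, and the others fall into three classes with fewer than \<open>crowd_bound K q\<close>, at most
  \<open>K\<close> and at most \<open>2 K\<close> elements.\<close>

fun crowd_bound :: "nat \<Rightarrow> nat \<Rightarrow> nat" where
  "crowd_bound K 0 = 1"
| "crowd_bound K (Suc q) = 2 * crowd_bound K q + 3 * K + 6"

lemma crowd_bound_mono: "q \<le> r \<Longrightarrow> crowd_bound K q \<le> crowd_bound K r"
  by (rule lift_Suc_mono_le[of "crowd_bound K"]) auto

lemma card_le_via_inj:
  assumes "finite B" "inj_on f A" "f ` A \<subseteq> B" shows "card A \<le> card B"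
  using assms by (metis card_image card_mono)

text \<open>The index set \<open>I\<close> numbers several ways to cut one and the same bi-infinite sequence into blocks.
  In parsing \<open>k\<close> the block that covers position \<open>t\<close> has type \<open>ty k t\<close>, left end \<open>lft k t\<close> and a height that
  depends on the type only. Think of \<open>match k l j u\<close> as the assertion that a map \<open>\<psi>\<close> attached to \<open>(k, l)\<close>
  satisfies \<open>(\<psi> x) (u + j) = x u\<close>; if \<open>\<psi>\<close> were the identity, a stretch of positions \<open>u\<close> with this
  property would be a stretch on which \<open>x\<close> has period \<open>j\<close>. Such maps have a finite radius \<open>R\<close>, which
  accounts for the margins.

  Two equal types in different parsings produce a long match (\<open>same_type\<close>). No match of length \<open>B\<close> has a
  small shift and no match is infinite to the left (\<open>big_shift\<close>, \<open>bounded_match\<close>). The rules \<open>extend_left\<close>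
  and \<open>extend_right\<close> replace the theorem of Fine and Wilf: a match is continued along a second match
  that overlaps it sufficiently.\<close>

locale rival_parsings =
  fixes I :: "'i set" and V :: "'v set"
    and match :: "'i \<Rightarrow> 'i \<Rightarrow> int \<Rightarrow> int \<Rightarrow> bool"
    and ty :: "'i \<Rightarrow> int \<Rightarrow> 'v" and lft :: "'i \<Rightarrow> int \<Rightarrow> int" and H :: "'v \<Rightarrow> int"
    and R B :: int
  assumes finI: "finite I" and finV: "finite V" and R: "0 \<le> R"
    and ty: "k \<in> I \<Longrightarrow> ty k t \<in> V"
    and lft: "k \<in> I \<Longrightarrow> lft k t \<le> t" and rgt: "k \<in> I \<Longrightarrow> t < lft k t + H (ty k t)"
    and block: "\<lbrakk>k \<in> I; lft k t \<le> s; s < lft k t + H (ty k t)\<rbrakk> \<Longrightarrow> lft k s = lft k t \<and> ty k s = ty k t"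
    and tall: "v \<in> V \<Longrightarrow> B + 2 * R \<le> H v"
    and same_type: "\<lbrakk>k \<in> I; l \<in> I; ty k t = ty l s; lft k t + R \<le> u; u < lft k t + H (ty k t) - R\<rbrakk>
        \<Longrightarrow> match k l (lft l s - lft k t) u"
    and big_shift: "\<lbrakk>k \<in> I; l \<in> I; k \<noteq> l; a + B \<le> b; \<And>u. a \<le> u \<Longrightarrow> u < b \<Longrightarrow> match k l j u\<rbrakk>
        \<Longrightarrow> 6 * R + 10 \<le> \<bar>j\<bar>"
    and bounded_match: "\<lbrakk>k \<in> I; l \<in> I; k \<noteq> l\<rbrakk> \<Longrightarrow> \<exists>u<b. \<not> match k l j u"
    and extend_left: "\<lbrakk>k \<in> I; l \<in> I; k' \<in> I; l' \<in> I;
        \<forall>u\<in>{a..<b}. match k l j u; \<forall>u\<in>{c..<d}. match k' l' i u;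
        a \<le> c; R < j; R \<le> i; c + i + R \<le> b; c + j + R \<le> d; a \<le> u; u < d\<rbrakk> \<Longrightarrow> match k' l' i u"
    and extend_right: "\<lbrakk>k \<in> I; l \<in> I; k' \<in> I; l' \<in> I;
        \<forall>u\<in>{a..<b}. match k l j u; \<forall>u\<in>{c..<d}. match k' l' i u;
        d \<le> b; R < j; i + 2 * R \<le> j; R \<le> i; a + j + 2 * R \<le> d; c + j + R \<le> d; c \<le> u; u < b\<rbrakk>
        \<Longrightarrow> match k' l' i u"
begin

lemma lft_differ:
  assumes "k \<in> I" "l \<in> I" "k \<noteq> l" "ty k t = ty l s"
  shows "6 * R + 10 \<le> \<bar>lft l s - lft k t\<bar>"
proof (rule big_shift[OF assms(1-3)])
  show "lft k t + R + B \<le> lft k t + H (ty k t) - R" using tall[OF ty[OF assms(1), of t]] by simp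
qed (rule same_type[OF assms(1,2,4)])

abbreviation crowd :: "'v set \<Rightarrow> int \<Rightarrow> nat" where
  "crowd Q t \<equiv> card {k \<in> I. ty k t \<in> Q}"

text \<open>Among the sets of types that are closed under passing to smaller heights and that at some position
  hold many parsings relative to their size, take one that has the fewest types, and let \<open>v\<close> be a type of
  maximal height in it. Without \<open>v\<close> the set is never crowded again; so few parsings are ever in blocks
  of smaller height, while at one position many of them are in blocks of type \<open>v\<close>.\<close>

lemma crowded_type:
  assumes "crowd_bound (card V) (card V) \<le> card I"
  obtains v Q t1 \<tau> where
    "v \<in> V" "\<And>t. crowd Q t < \<tau>" "\<And>w. w \<in> V - Q \<Longrightarrow> H v \<le> H w"
    "\<tau> + 3 * card V + 7 \<le> card {k \<in> I. ty k t1 = v}"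
proof -
  define down where "down Q \<longleftrightarrow> Q \<subseteq> V \<and> (\<forall>v\<in>Q. \<forall>w\<in>V. H w < H v \<longrightarrow> w \<in> Q)" for Q
  define T where "T = crowd_bound (card V)"
  define good where "good Q \<longleftrightarrow> down Q \<and> (\<exists>t. T (card Q) \<le> crowd Q t)" for Q
  have "good V"
  proof -
    have "{k \<in> I. ty k 0 \<in> V} = I" using ty by auto
    then have "T (card V) \<le> crowd V 0" using assms by (simp add: T_def)
    then show ?thesis by (auto simp: good_def down_def)
  qed
  then obtain Q where Q: "good Q" and min: "\<And>Q'. good Q' \<Longrightarrow> card Q \<le> card Q'"
    using ex_has_least_nat[of good V card] by auto
  obtain t1 where dQ: "down Q" and t1: "T (card Q) \<le> crowd Q t1" using Q by (auto simp: good_def)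
  have finQ: "finite Q" using dQ finV by (auto simp: down_def intro: finite_subset)
  have "Q \<noteq> {}" using t1 by (auto simp: T_def)
  then have "Max (H ` Q) \<in> H ` Q" using finQ by (intro Max_in) auto
  then obtain v where v: "v \<in> Q" and "Max (H ` Q) = H v" by blast
  then have vmax: "H w \<le> H v" if "w \<in> Q" for w using Max_ge[of "H ` Q" "H w"] finQ that by simp
  obtain q where q: "card Q = Suc q" using v finQ by (metis card_Suc_Diff1)
  define Q' where "Q' = Q - {v}"
  have cQ': "card Q' = q" using v finQ q by (simp add: Q'_def)
  have dQ': "down Q'" using dQ vmax unfolding down_def Q'_def by fastforce
  have few: "crowd Q' t < T q" for t
  proof (rule ccontr)
    assume "\<not> ?thesis"
    then have "good Q'" using dQ' cQ' unfolding good_def by (metis not_less)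
    then show False using min[of Q'] cQ' q by simp
  qed
  have "{k \<in> I. ty k t1 \<in> Q} = {k \<in> I. ty k t1 \<in> Q'} \<union> {k \<in> I. ty k t1 = v}"
    using v by (auto simp: Q'_def)
  then have "crowd Q t1 \<le> crowd Q' t1 + card {k \<in> I. ty k t1 = v}" 
    using card_Un_le[of "{k \<in> I. ty k t1 \<in> Q'}" "{k \<in> I. ty k t1 = v}"] by simp
  then have "T q + 3 * card V + 7 \<le> card {k \<in> I. ty k t1 = v}"
    using few[of t1] t1 q by (simp add: T_def)
  moreover have "H v \<le> H w" if "w \<in> V - Q'" for w
    using that dQ v unfolding down_def Q'_def by (cases "w = v") (use not_less in fastforce)+
  moreover have "v \<in> V" using v dQ by (auto simp: down_def)
  ultimately show ?thesis using that[of v Q' "T q" t1] few by simp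
qed

text \<open>Take a position \<open>t1\<close> with a crowd \<open>C\<close> of parsings in blocks of type \<open>v\<close>. Two of these blocks have left
  ends \<open>p < q\<close> at distance at most \<open>\<eta> / 5\<close>, and together they produce a match on a core interval. Let
  \<open>j1\<close> be the least positive shift of any match on the core, and extend that match to the left as far as
  possible, up to a position \<open>e\<close>. The parsings in \<open>M\<close> all have a cut between \<open>e\<close> and the right end of the core;
  look at the first such cut. If it is far from \<open>e\<close> for two parsings with blocks of equal type at \<open>e\<close>, then
  the match of these blocks crosses \<open>e\<close> and overlaps the extended match so much that the latter
  could be continued beyond \<open>e\<close>. If it is near \<open>e\<close>, then a block of height at least \<open>\<eta>\<close> begins close to
  \<open>e\<close>, unless the block is one of the few short ones; two such blocks of equal type that begin
  at almost the same place produce a match that spreads over the whole core and has a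
  shift smaller than \<open>j1\<close>. Hence \<open>M\<close> is small, which contradicts the size of the crowd.\<close>

theorem few_rivals: "card I < crowd_bound (card V) (card V)"
proof (rule ccontr)
  assume "\<not> ?thesis"
  then have "crowd_bound (card V) (card V) \<le> card I" by simp
  then obtain v Q \<tau> t1 where v: "v \<in> V" and few: "\<And>t. crowd Q t < \<tau>"
    and high: "\<And>w. w \<in> V - Q \<Longrightarrow> H v \<le> H w"
    and crowd: "\<tau> + 3 * card V + 7 \<le> card {k \<in> I. ty k t1 = v}"
    by (rule crowded_type) blast
  define \<eta> where "\<eta> = H v"
  define C where "C = {k \<in> I. ty k t1 = v}"
  define a where "a k = lft k t1" for k
  have finC: "finite C" using finI by (simp add: C_def)
  have CI: "k \<in> I" "ty k t1 = v" if "k \<in> C" for k using that by (auto simp: C_def)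
  have sep: "6 * R + 10 \<le> \<bar>a l - a k\<bar>" if "k \<in> C" "l \<in> C" "k \<noteq> l" for k l
    using lft_differ[of k l t1 t1] CI[of k] CI[of l] that by (simp add: a_def)
  have inj: "inj_on a C"
  proof (rule inj_onI)
    fix k l assume "k \<in> C" "l \<in> C" "a k = a l"
    then show "k = l" using sep[of k l] R by fastforce
  qed
  have a_le: "a k \<le> t1" "t1 < a k + \<eta>" if "k \<in> C" for k
    using lft[of k t1] rgt[of k t1] CI[OF that] by (auto simp: a_def \<eta>_def)
  have "\<tau> + 3 * card V + 1 + 6 \<le> card (a ` C)" using crowd inj by (simp add: card_image C_def)
  moreover have "v - u \<le> \<eta>" if "u \<in> a ` C" "v \<in> a ` C" for u v using that a_le by fastforce
  ultimately obtain p q where pq: "p \<in> a ` C" "q \<in> a ` C" "p < q" "5 * (q - p) \<le> \<eta>"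
    and s: "\<tau> + 3 * card V + 1 \<le> card {u \<in> a ` C. u < p}"
    by (rule exists_small_gap[OF finite_imageI[OF finC]]) blast
  define M where "M = {k \<in> C. a k < p}"
  have "a ` M = {u \<in> a ` C. u < p}" by (auto simp: M_def)
  then have cardM: "\<tau> + 3 * card V + 1 \<le> card M"
    using s inj by (metis (no_types, lifting) M_def card_image inj_on_subset mem_Collect_eq subsetI)
  obtain k0 l0 where kl0: "k0 \<in> C" "l0 \<in> C" "p = a k0" "q = a l0" using pq by auto
  \<comment> \<open>The core is the interval from \<open>p + R\<close> to \<open>b0\<close>.\<close>
  define b0 where "b0 = p + \<eta> - R"
  have eta: "B + 2 * R \<le> \<eta>" using tall[OF v] by (simp add: \<eta>_def)
  define ok where "ok j \<longleftrightarrow> 0 < j \<and> (\<exists>k\<in>I. \<exists>l\<in>I. k \<noteq> l \<and>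
    (\<forall>u. p + R \<le> u \<longrightarrow> u < b0 \<longrightarrow> match k l j u))" for j
  have ok_big: "6 * R + 10 \<le> j" if "ok j" for j
    using that big_shift[of _ _ "p + R" b0 j] eta unfolding ok_def b0_def by fastforce
  have ok0: "ok (q - p)"
  proof -
    have "match k0 l0 (q - p) u" if "p + R \<le> u" "u < b0" for u
      using same_type[of k0 l0 t1 t1 u] CI[OF kl0(1)] CI[OF kl0(2)] that kl0(3,4)
      by (simp add: a_def b0_def \<eta>_def)
    then show ?thesis using kl0 pq CI unfolding ok_def by (metis diff_gt_0_iff_gt less_irrefl)
  qed
  define j1 where "j1 = int (LEAST n. ok (int n))"
  have ok_nat: "ok (int (nat j))" if "ok j" for j using that by (simp add: ok_def)
  have ok1: "ok j1" unfolding j1_def by (rule LeastI[of "\<lambda>n. ok (int n)", OF ok_nat[OF ok0]])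
  have j1_min: "j1 \<le> j" if "ok j" for j
  proof -
    have "0 < j" using that by (simp add: ok_def)
    then show ?thesis
      using Least_le[of "\<lambda>n. ok (int n)", OF ok_nat[OF that]] unfolding j1_def by linarith
  qed
  obtain k1 l1 where kl1: "k1 \<in> I" "l1 \<in> I" "k1 \<noteq> l1"
    and m1: "\<And>u. p + R \<le> u \<Longrightarrow> u < b0 \<Longrightarrow> match k1 l1 j1 u"
    using ok1 by (auto simp: ok_def)
  have j1: "6 * R + 10 \<le> j1" "5 * j1 \<le> \<eta>" using ok_big[OF ok1] j1_min[OF ok0] pq by auto
  \<comment> \<open>Leftmost extension of the match with the least shift; it exists because matches are bounded.\<close>
  obtain e where e_le: "e \<le> p + R" and me: "\<And>u. e \<le> u \<Longrightarrow> u < b0 \<Longrightarrow> match k1 l1 j1 u"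
    and e_max: "\<not> match k1 l1 j1 (e - 1)"
  proof -
    define S where "S = {n. \<not> match k1 l1 j1 (p + R - 1 - int n)}"
    obtain u where u: "u < p + R" "\<not> match k1 l1 j1 u" using bounded_match[OF kl1] by blast
    then have "nat (p + R - 1 - u) \<in> S" by (simp add: S_def)
    define n where "n = (LEAST n. n \<in> S)"
    have n: "n \<in> S" unfolding n_def using \<open>_ \<in> S\<close> by (rule LeastI)
    have "match k1 l1 j1 u" if "p + R - int n \<le> u" "u < b0" for u
    proof (cases "p + R \<le> u")
      case False
      then have "nat (p + R - 1 - u) < n" using that by auto
      then have "nat (p + R - 1 - u) \<notin> S" using not_less_Least n_def by blast
      then show ?thesis using False by (simp add: S_def)
    qed (use m1 that in auto)
    with n show ?thesis by (intro that[of "p + R - int n"]) (auto simp: S_def algebra_simps)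
  qed
  have e_t1: "e \<le> t1" using e_le kl0 a_le(1)[of l0] ok_big[OF ok0] R by auto
  define r where "r m = lft m e + H (ty m e)" for m
  have MI: "m \<in> I" "m \<in> C" "a m < p" if "m \<in> M" for m using that CI by (auto simp: M_def)
  \<comment> \<open>At \<open>t1\<close> the block of \<open>m\<close> ends to the left of the block that defines the core.\<close>
  have r_le: "r m \<le> b0" if m: "m \<in> M" for m
  proof -
    have gap: "a m + 6 * R + 10 \<le> p" using sep[of m k0] MI[OF m] kl0 by fastforce
    have "r m \<le> a m + \<eta>"
    proof (rule ccontr)
      assume *: "\<not> ?thesis"
      have "lft m t1 = lft m e \<and> ty m t1 = ty m e"
        using block[of m e t1] lft[of m e] MI[OF m] e_t1 * a_le(2)[of m] by (auto simp: r_def)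
      then show False using * CI(2)[OF MI(2)[OF m]] by (simp add: r_def a_def \<eta>_def)
    qed
    then show ?thesis using gap R by (simp add: b0_def)
  qed
  have r_gt: "e < r m" "lft m e \<le> e" if "m \<in> M" for m
    using rgt[of m e] lft[of m e] MI[OF that] by (auto simp: r_def)
  define e1 where "e1 = e + j1 + 2 * R"
  \<comment> \<open>The first cut after \<open>e\<close> is far away, or near and followed by a short block, or near and followed by a tall one.\<close>
  define M2 where "M2 = {m \<in> M. e1 \<le> r m}"
  define M3 where "M3 = {m \<in> M. r m < e1 \<and> ty m e1 \<in> Q}"
  define M4 where "M4 = {m \<in> M. r m < e1 \<and> ty m e1 \<notin> Q}"
  have finM: "finite M" using finC by (simp add: M_def)
  have "card M2 \<le> card V"
  proof (rule card_le_via_inj[OF finV])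
    show "(\<lambda>m. ty m e) ` M2 \<subseteq> V" using ty MI by (auto simp: M2_def)
    have no: False if m: "m \<in> M2" "n \<in> M2" "m \<noteq> n" "ty m e = ty n e" "r m \<le> r n" for m n
    proof -
      have mn: "m \<in> M" "n \<in> M" "e1 \<le> r m" using m by (auto simp: M2_def)
      have d: "lft n e - lft m e = r n - r m" using m by (simp add: r_def)
      have d2: "6 * R + 10 \<le> r n - r m"
        using lft_differ[OF MI(1)[OF mn(1)] MI(1)[OF mn(2)] m(3,4)] d m(5) by linarith
      have A: "match m n (r n - r m) u" if "lft m e + R \<le> u" "u < r m - R" for u
        using same_type[OF MI(1)[OF mn(1)] MI(1)[OF mn(2)] m(4) that(1)] that(2)
        unfolding d[symmetric] by (simp add: r_def)
      have left: "lft m e + R \<le> e - 1" using d d2 r_gt[OF mn(2)] R by linarith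
      have "match k1 l1 j1 (e - 1)"
        by (rule extend_left[OF MI(1)[OF mn(1)] MI(1)[OF mn(2)] kl1(1,2),
              of "lft m e + R" "r m - R" "r n - r m" e b0 j1])
          (use A me left d2 R j1 mn(3) r_le[OF mn(2)] r_gt[OF mn(1)] in \<open>auto simp: e1_def\<close>)
      then show False using e_max by blast
    qed
    show "inj_on (\<lambda>m. ty m e) M2"
      by (rule inj_onI) (metis no nle_le)
  qed
  moreover have "card M3 < \<tau>"
  proof -
    have "card M3 \<le> crowd Q e1" using finI MI by (intro card_mono) (auto simp: M3_def)
    then show ?thesis using few[of e1] by simp
  qed
  moreover have "card M4 \<le> card (V \<times> (UNIV :: bool set))"
  proof (rule card_le_via_inj)
    show "finite (V \<times> (UNIV :: bool set))" using finV by simp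
    \<comment> \<open>Halving the window makes any two shifts in one half small compared with \<open>j1\<close>.\<close>
    define h where "h m = (ty m e1, 2 * (lft m e1 - e) \<le> j1 + 2 * R)" for m
    show "h ` M4 \<subseteq> V \<times> UNIV" using ty MI by (auto simp: M4_def h_def)
    have M4: "m \<in> M" "e < lft m e1" "lft m e1 \<le> e1" "\<eta> \<le> H (ty m e1)" if "m \<in> M4" for m
    proof -
      show m: "m \<in> M" using that by (simp add: M4_def)
      show "lft m e1 \<le> e1" using lft MI(1)[OF m] by simp
      show "\<eta> \<le> H (ty m e1)" using that high ty[OF MI(1)[OF m]] by (auto simp: M4_def \<eta>_def)
      show "e < lft m e1"
      proof (rule ccontr)
        assume "\<not> ?thesis"
        then have "lft m e = lft m e1 \<and> ty m e = ty m e1"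
          using block[of m e1 e] rgt[of m e1] MI(1)[OF m] j1 R by (auto simp: e1_def)
        then show False using that rgt[of m e1] MI(1)[OF m] by (auto simp: M4_def r_def)
      qed
    qed
    have no: False if m: "m \<in> M4" "n \<in> M4" "m \<noteq> n" "h m = h n" "lft m e1 \<le> lft n e1" for m n
    proof -
      define i where "i = lft n e1 - lft m e1"
      define f where "f = lft m e1 + H (ty m e1) - R"
      have mI: "m \<in> I" "n \<in> I" using M4(1) m MI by auto
      have tmn: "ty m e1 = ty n e1" using m by (simp add: h_def)
      have i: "6 * R + 10 \<le> i" using lft_differ[OF mI m(3) tmn] m(5) by (simp add: i_def)
      have i2: "2 * i \<le> j1 + 2 * R"
        using m(4) M4(2,3)[OF m(1)] M4(2,3)[OF m(2)] by (auto simp: h_def i_def e1_def)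
      have A: "match m n i u" if "lft m e1 + R \<le> u" "u < f" for u
        using same_type[OF mI tmn] that by (simp add: i_def f_def)
      note bd = M4(2,3,4)[OF m(1)]
      \<comment> \<open>The blocks may end before the core does; the match with shift \<open>j1\<close> carries theirs on.\<close>
      have A2: "match m n i u" if "lft m e1 + R \<le> u" "u < b0" for u
      proof (cases "f \<le> b0")
        case True
        show ?thesis
          by (rule extend_right[OF kl1(1,2) mI, of e b0 j1 "lft m e1 + R" f i])
            (use A me that i i2 j1 R bd True in \<open>auto simp: e1_def f_def\<close>)
      next
        case False
        then show ?thesis using A that by auto
      qed
      have A3: "match m n i u" if "e \<le> u" "u < b0" for u
        by (rule extend_left[OF kl1(1,2) mI, of e b0 j1 "lft m e1 + R" b0 i])
          (use A2 me that i i2 j1 R bd e_le in \<open>auto simp: e1_def b0_def\<close>)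
      have "ok i" using A3 mI m(3) i R e_le unfolding ok_def by force
      then show False using j1_min[of i] i i2 j1 R by auto
    qed
    show "inj_on h M4"
      by (rule inj_onI) (metis no nle_le)
  qed
  moreover have "card M \<le> card M2 + card M3 + card M4"
  proof -
    have "M = M2 \<union> M3 \<union> M4" by (auto simp: M2_def M3_def M4_def)
    then show ?thesis
      using card_Un_le[of "M2 \<union> M3" M4] card_Un_le[of M2 M3] by simp
  qed
  ultimately show False using cardM by (simp add: card_cartesian_product)
qed

end

section \<open>Subshifts and block codes\<close>

text \<open>The form in which compactness enters all later arguments.\<close>

lemma compact_uniform:
  fixes Q :: "nat \<Rightarrow> 'x \<Rightarrow> bool"
  assumes comp: "compact_space T"
    and loc: "\<And>x. x \<in> topspace T \<Longrightarrow> \<exists>U n. openin T U \<and> x \<in> U \<and> (\<forall>z\<in>U. Q n z)"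
    and mono: "\<And>n m z. Q n z \<Longrightarrow> n \<le> m \<Longrightarrow> Q m z"
  shows "\<exists>n. \<forall>z\<in>topspace T. Q n z"
proof -
  obtain U n where U: "\<And>x. x \<in> topspace T \<Longrightarrow> openin T (U x) \<and> x \<in> U x \<and> (\<forall>z\<in>U x. Q (n x) z)"
    using loc by metis
  have "\<exists>\<F>. finite \<F> \<and> \<F> \<subseteq> U ` topspace T \<and> topspace T \<subseteq> \<Union>\<F>"
  proof -
    have "\<forall>V\<in>U ` topspace T. openin T V" "topspace T \<subseteq> \<Union>(U ` topspace T)" using U by auto
    then show ?thesis using comp unfolding compact_space_alt by presburger
  qed
  then obtain F where F: "finite F" "F \<subseteq> topspace T" "topspace T \<subseteq> (\<Union>x\<in>F. U x)"
    by (metis finite_subset_image)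
  have "Q (Max (n ` F)) z" if z: "z \<in> topspace T" for z
  proof -
    obtain x where x: "x \<in> F" "z \<in> U x" using F(3) z by blast
    have "Q (n x) z" using U[of x] F(2) x by blast
    moreover have "n x \<le> Max (n ` F)" using F(1) x(1) by simp
    ultimately show ?thesis by (rule mono)
  qed
  then show ?thesis by blast
qed

subsection \<open>Windows\<close>

definition sh :: "int \<Rightarrow> (int \<Rightarrow> 'a) \<Rightarrow> int \<Rightarrow> 'a" where
  "sh t x = (\<lambda>i. x (i + t))"

definition agree :: "nat \<Rightarrow> (int \<Rightarrow> 'a) \<Rightarrow> (int \<Rightarrow> 'a) \<Rightarrow> bool" where
  "agree w x y \<longleftrightarrow> (\<forall>i. \<bar>i\<bar> \<le> int w \<longrightarrow> x i = y i)"

lemma sh_apply [simp]: "sh t x i = x (i + t)" by (simp add: sh_def)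
lemma sh_sh [simp]: "sh s (sh t x) = sh (s + t) x" by (auto simp: sh_def algebra_simps)
lemma sh_0 [simp]: "sh 0 x = x" by (auto simp: sh_def)
lemma shift_eq_sh: "shift = sh 1" by (auto simp: sh_def shift_def fun_eq_iff)

lemma shift_image_eq:
  assumes "\<And>s x. x \<in> C \<Longrightarrow> sh s x \<in> C" shows "shift ` C = C"
proof
  show "shift ` C \<subseteq> C" using assms by (auto simp: shift_eq_sh)
  show "C \<subseteq> shift ` C"
  proof
    fix z assume "z \<in> C"
    then have "sh (-1) z \<in> C" by (rule assms)
    moreover have "z = shift (sh (-1) z)" by (simp add: shift_eq_sh)
    ultimately show "z \<in> shift ` C" by blast
  qed
qed

lemma agree_refl [simp]: "agree w x x" by (simp add: agree_def)
lemma agree_sym: "agree w x y \<Longrightarrow> agree w y x" by (simp add: agree_def)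
lemma agree_trans: "agree w x y \<Longrightarrow> agree w y z \<Longrightarrow> agree w x z" by (simp add: agree_def)
lemma agree_mono: "agree w x y \<Longrightarrow> v \<le> w \<Longrightarrow> agree v x y" by (auto simp: agree_def)
lemma agree_sh: "agree w x y \<Longrightarrow> v + nat \<bar>t\<bar> \<le> w \<Longrightarrow> agree v (sh t x) (sh t y)"
  by (auto simp: agree_def)
lemma eq_if_agree: "(\<And>w. agree w x y) \<Longrightarrow> x = y"
  by (rule ext) (metis agree_def int_nat_eq order.refl abs_ge_zero)

lemma topspace_full_shift: "topspace (full_shift A) = {x. \<forall>i. x i \<in> A}"
  by (auto simp: full_shift_def PiE_def Pi_def)

lemma compact_full_shift: "finite A \<Longrightarrow> compact_space (full_shift A)"
  unfolding full_shift_def by (simp add: compact_space_product_topology compact_space_discrete_topology)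

lemma openin_full_shift_window:
  assumes "\<forall>i. x i \<in> A" shows "openin (full_shift A) {y. (\<forall>i. y i \<in> A) \<and> agree w x y}"
proof -
  define U where "U i = (if \<bar>i\<bar> \<le> int w then {x i} else A)" for i
  have "openin (full_shift A) (PiE UNIV U)"
    unfolding full_shift_def
  proof (rule product_topology_basis)
    show "finite {i. U i \<noteq> topspace (discrete_topology A)}"
      by (rule finite_subset[of _ "{-int w..int w}"]) (auto simp: U_def)
  qed (use assms in \<open>auto simp: U_def\<close>)
  moreover have "PiE UNIV U = {y. (\<forall>i. y i \<in> A) \<and> agree w x y}"
    using assms by (auto simp: U_def PiE_def Pi_def agree_def split: if_splits)
  ultimately show ?thesis by simp
qed

lemma openin_full_shift_iff:
  "openin (full_shift A) U \<longleftrightarrow>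
    U \<subseteq> {x. \<forall>i. x i \<in> A} \<and> (\<forall>x\<in>U. \<exists>w. \<forall>y. (\<forall>i. y i \<in> A) \<longrightarrow> agree w x y \<longrightarrow> y \<in> U)"
    (is "?L \<longleftrightarrow> ?R")
proof
  assume L: ?L
  have "\<exists>w. \<forall>y. (\<forall>i. y i \<in> A) \<longrightarrow> agree w x y \<longrightarrow> y \<in> U" if x: "x \<in> U" for x
  proof -
    obtain V where V: "finite {i. V i \<noteq> A}" "x \<in> PiE UNIV V" "PiE UNIV V \<subseteq> U"
      using product_topology_open_contains_basis[OF L[unfolded full_shift_def] x] by auto
    obtain w where w: "\<And>i. V i \<noteq> A \<Longrightarrow> \<bar>i\<bar> \<le> int w"
    proof
      fix i assume "V i \<noteq> A"
      then have "nat \<bar>i\<bar> \<le> Max ((\<lambda>i. nat \<bar>i\<bar>) ` {i. V i \<noteq> A})" using V(1) by (intro Max_ge) auto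
      then show "\<bar>i\<bar> \<le> int (Max ((\<lambda>i. nat \<bar>i\<bar>) ` {i. V i \<noteq> A}))" by simp
    qed
    have "y \<in> U" if "\<forall>i. y i \<in> A" "agree w x y" for y
    proof -
      have "y i \<in> V i" for i
      proof (cases "V i = A")
        case False
        then have "x i = y i" using w[of i] that(2) by (simp add: agree_def)
        then show ?thesis using V(2) by (metis PiE_mem UNIV_I)
      qed (use that(1) in simp)
      then show ?thesis using V(3) by (auto simp: PiE_def Pi_def)
    qed
    then show ?thesis by blast
  qed
  then show ?R using openin_subset[OF L] by (auto simp: topspace_full_shift)
next
  assume R: ?R
  have "\<exists>V. openin (full_shift A) V \<and> x \<in> V \<and> V \<subseteq> U" if x: "x \<in> U" for x
  proof -
    obtain w where w: "\<And>y. \<forall>i. y i \<in> A \<Longrightarrow> agree w x y \<Longrightarrow> y \<in> U" using R x by blast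
    show ?thesis
      using openin_full_shift_window[of x A w] R x w by (intro exI[of _ "{y. (\<forall>i. y i \<in> A) \<and> agree w x y}"]) auto
  qed
  then show ?L using openin_subopen by blast
qed

lemma openin_full_shiftD:
  assumes "openin (full_shift A) U" "x \<in> U"
  obtains w where "\<And>y. \<forall>i. y i \<in> A \<Longrightarrow> agree w x y \<Longrightarrow> y \<in> U"
  using bspec[OF conjunct2[OF iffD1[OF openin_full_shift_iff assms(1)]] assms(2)] by auto

lemma closedin_full_shift_iff:
  "closedin (full_shift A) X \<longleftrightarrow>
    X \<subseteq> {x. \<forall>i. x i \<in> A} \<and> (\<forall>x. (\<forall>i. x i \<in> A) \<longrightarrow> (\<forall>w. \<exists>y\<in>X. agree w x y) \<longrightarrow> x \<in> X)"
proof -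
  let ?F = "{x. \<forall>i. x i \<in> A}"
  have "(\<forall>x\<in>?F - X. \<exists>w. \<forall>y. (\<forall>i. y i \<in> A) \<longrightarrow> agree w x y \<longrightarrow> y \<in> ?F - X) \<longleftrightarrow>
    (\<forall>x. (\<forall>i. x i \<in> A) \<longrightarrow> (\<forall>w. \<exists>y\<in>X. agree w x y) \<longrightarrow> x \<in> X)" (is "?L \<longleftrightarrow> ?R") if X: "X \<subseteq> ?F"
  proof
    assume L: ?L
    show ?R
    proof (intro allI impI, rule ccontr)
      fix x assume x: "\<forall>i. x i \<in> A" "\<forall>w. \<exists>y\<in>X. agree w x y" "x \<notin> X"
      then obtain w where w: "\<And>y. (\<forall>i. y i \<in> A) \<Longrightarrow> agree w x y \<Longrightarrow> y \<notin> X" using L by blast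
      then show False using x(2) X by blast
    qed
  next
    assume R: ?R
    show ?L
    proof
      fix x assume "x \<in> ?F - X"
      then obtain w where "\<And>y. y \<in> X \<Longrightarrow> \<not> agree w x y" using R by blast
      then show "\<exists>w. \<forall>y. (\<forall>i. y i \<in> A) \<longrightarrow> agree w x y \<longrightarrow> y \<in> ?F - X" by blast
    qed
  qed
  then show ?thesis unfolding closedin_def openin_full_shift_iff topspace_full_shift by blast
qed

lemma in_closure_full_shift_iff:
  assumes "S \<subseteq> {x. \<forall>i. x i \<in> A}"
  shows "x \<in> full_shift A closure_of S \<longleftrightarrow> (\<forall>i. x i \<in> A) \<and> (\<forall>w. \<exists>y\<in>S. agree w x y)"
proof
  assume L: "x \<in> full_shift A closure_of S"
  then have x: "\<forall>i. x i \<in> A" by (auto simp: in_closure_of topspace_full_shift)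
  have "\<exists>y\<in>S. agree w x y" for w
  proof -
    let ?V = "{y. (\<forall>i. y i \<in> A) \<and> agree w x y}"
    have "x \<in> ?V" using x by simp
    moreover have "x \<in> ?V \<and> openin (full_shift A) ?V \<longrightarrow> (\<exists>y. y \<in> S \<and> y \<in> ?V)"
      using L unfolding in_closure_of by (elim conjE, elim allE)
    ultimately have "\<exists>y. y \<in> S \<and> y \<in> ?V"
      using openin_full_shift_window[OF x, of w] by (elim mp, intro conjI)
    then show ?thesis by blast
  qed
  then show "(\<forall>i. x i \<in> A) \<and> (\<forall>w. \<exists>y\<in>S. agree w x y)" using x by blast
next
  assume R: "(\<forall>i. x i \<in> A) \<and> (\<forall>w. \<exists>y\<in>S. agree w x y)"
  show "x \<in> full_shift A closure_of S"
    unfolding in_closure_of topspace_full_shift openin_full_shift_iff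
  proof (intro conjI allI impI)
    fix U assume U: "x \<in> U \<and> U \<subseteq> {x. \<forall>i. x i \<in> A} \<and>
      (\<forall>x\<in>U. \<exists>w. \<forall>y. (\<forall>i. y i \<in> A) \<longrightarrow> agree w x y \<longrightarrow> y \<in> U)"
    then obtain w where w: "\<And>y. (\<forall>i. y i \<in> A) \<Longrightarrow> agree w x y \<Longrightarrow> y \<in> U" by blast
    obtain y where "y \<in> S" "agree w x y" using R by blast
    then show "\<exists>y. y \<in> S \<and> y \<in> U" using w assms by blast
  qed (use R in simp)
qed

locale subshift_space =
  fixes A :: "'a set" and X :: "(int \<Rightarrow> 'a) set"
  assumes subshift: "subshift A X"
begin

lemma finA: "finite A" and closedX: "closedin (full_shift A) X" and shiftX: "shift ` X = X"
  using subshift by (auto simp: subshift_def)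

lemma XA: "x \<in> X \<Longrightarrow> x i \<in> A"
  using closedX by (auto simp: closedin_full_shift_iff)

lemma closed_window: "(\<And>w. \<exists>y\<in>X. agree w x y) \<Longrightarrow> x \<in> X"
proof -
  assume *: "\<And>w. \<exists>y\<in>X. agree w x y"
  have "x i \<in> A" for i using *[of "nat \<bar>i\<bar>"] XA unfolding agree_def by (metis int_nat_eq abs_ge_zero order.refl)
  then show ?thesis using closedX * by (auto simp: closedin_full_shift_iff)
qed

abbreviation XT :: "(int \<Rightarrow> 'a) topology" where "XT \<equiv> shift_top A X"

lemma topspace_XT [simp]: "topspace XT = X"
  using XA by (auto simp: shift_top_def topspace_full_shift)

lemma compact_XT: "compact_space XT"
  using closedin_compact_space[OF compact_full_shift[OF finA] closedX]
  by (simp add: compactin_subspace shift_top_def)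

lemma openin_XT_iff: "openin XT U \<longleftrightarrow> U \<subseteq> X \<and> (\<forall>x\<in>U. \<exists>w. \<forall>y\<in>X. agree w x y \<longrightarrow> y \<in> U)"
proof
  assume L: "openin XT U"
  show "U \<subseteq> X \<and> (\<forall>x\<in>U. \<exists>w. \<forall>y\<in>X. agree w x y \<longrightarrow> y \<in> U)"
  proof -
    obtain V where V: "openin (full_shift A) V" "U = V \<inter> X"
      using L unfolding shift_top_def openin_subtopology by blast
    have "\<exists>w. \<forall>y\<in>X. agree w x y \<longrightarrow> y \<in> U" if "x \<in> U" for x
    proof -
      have "x \<in> V" using V(2) that by simp
      from V(1) this obtain w where w: "\<And>y. \<forall>i. y i \<in> A \<Longrightarrow> agree w x y \<Longrightarrow> y \<in> V"
        by (rule openin_full_shiftD) blast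
      have "\<forall>y\<in>X. agree w x y \<longrightarrow> y \<in> U" using w XA V(2) by simp
      then show ?thesis ..
    qed
    then show ?thesis using V(2) by blast
  qed
next
  assume R: "U \<subseteq> X \<and> (\<forall>x\<in>U. \<exists>w. \<forall>y\<in>X. agree w x y \<longrightarrow> y \<in> U)"
  define V where "V = {y. (\<forall>i. y i \<in> A) \<and> (\<exists>x\<in>U. \<exists>w. agree w x y \<and> (\<forall>z\<in>X. agree w x z \<longrightarrow> z \<in> U))}"
  have "\<exists>w. \<forall>z. (\<forall>i. z i \<in> A) \<longrightarrow> agree w y z \<longrightarrow> z \<in> V" if y: "y \<in> V" for y
  proof -
    obtain x w where xw: "x \<in> U" "agree w x y" "\<forall>z\<in>X. agree w x z \<longrightarrow> z \<in> U" using y unfolding V_def by blast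
    have "z \<in> V" if "\<forall>i. z i \<in> A" "agree w y z" for z
      using xw that agree_trans[OF xw(2) that(2)] unfolding V_def by blast
    then show ?thesis by blast
  qed
  moreover have "V \<subseteq> {x. \<forall>i. x i \<in> A}" unfolding V_def by blast
  ultimately have "openin (full_shift A) V" unfolding openin_full_shift_iff by blast
  moreover have "U \<subseteq> V"
  proof
    fix x assume x: "x \<in> U"
    then obtain w where "\<forall>z\<in>X. agree w x z \<longrightarrow> z \<in> U" using R by blast
    then show "x \<in> V" using x R XA agree_refl[of w x] unfolding V_def by blast
  qed
  then have "U = V \<inter> X" using R unfolding V_def by blast
  ultimately show "openin XT U" unfolding shift_top_def openin_subtopology by blast
qed

lemma openin_window: "openin XT {y \<in> X. agree w x y}"
  unfolding openin_XT_iff by (auto intro: agree_trans)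

lemma sh_X: "x \<in> X \<Longrightarrow> sh t x \<in> X"
proof -
  assume x: "x \<in> X"
  have fwd: "sh 1 y \<in> X" if "y \<in> X" for y using shiftX that by (auto simp: shift_eq_sh)
  have bwd: "sh (-1) y \<in> X" if "y \<in> X" for y
  proof -
    have "y \<in> sh 1 ` X" using shiftX that by (simp add: shift_eq_sh)
    then obtain z where "z \<in> X" "y = sh 1 z" by blast
    then show ?thesis by simp
  qed
  show ?thesis
  proof (induction t rule: int_induct[of _ 0])
    case (step1 i) then show ?case using fwd[of "sh i x"] by (simp only: sh_sh add.commute)
  next
    case (step2 i)
    have "-1 + i = i - 1" by simp
    then show ?case using bwd[of "sh i x"] step2 by (simp only: sh_sh)
  qed (use x in simp)
qed

lemma uniform_window:
  assumes "\<And>x. x \<in> X \<Longrightarrow> \<exists>n. \<forall>z\<in>X. agree n x z \<longrightarrow> Q n z"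
    and "\<And>n m z. Q n z \<Longrightarrow> n \<le> m \<Longrightarrow> Q m z"
  shows "\<exists>n. \<forall>z\<in>X. Q n z"
proof -
  have "\<exists>n. \<forall>z\<in>topspace XT. Q n z"
  proof (rule compact_uniform[OF compact_XT])
    fix x assume "x \<in> topspace XT"
    then obtain n where "\<forall>z\<in>X. agree n x z \<longrightarrow> Q n z" using assms(1) by auto
    then show "\<exists>U n. openin XT U \<and> x \<in> U \<and> (\<forall>z\<in>U. Q n z)"
      using \<open>x \<in> topspace XT\<close> openin_window[of n x] by (intro exI[of _ "{y \<in> X. agree n x y}"] exI[of _ n]) auto
  qed (use assms(2) in blast)
  then show ?thesis by simp
qed

subsection \<open>Automorphisms as block codes\<close>

abbreviation \<Gamma> where "\<Gamma> \<equiv> automorphism_group XT shift"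

lemma carrier_\<Gamma>: "carrier \<Gamma> = {h \<in> Bij X. homeomorphic_map XT XT h \<and> (\<forall>x\<in>X. h (shift x) = shift (h x))}"
  by (simp add: automorphism_group_def)

lemma mult_\<Gamma>: "f \<in> carrier \<Gamma> \<Longrightarrow> g \<in> carrier \<Gamma> \<Longrightarrow> f \<otimes>\<^bsub>\<Gamma>\<^esub> g = compose X f g"
  by (simp add: automorphism_group_def BijGroup_def carrier_\<Gamma>)

lemma one_\<Gamma>: "\<one>\<^bsub>\<Gamma>\<^esub> = (\<lambda>x\<in>X. x)"
  by (simp add: automorphism_group_def BijGroup_def)

lemma shift_X: "x \<in> X \<Longrightarrow> shift x \<in> X" using sh_X[of x 1] by (simp add: shift_eq_sh)

lemma homeo_cong: "homeomorphic_map XT XT f \<Longrightarrow> (\<And>x. x \<in> X \<Longrightarrow> f x = g x) \<Longrightarrow> homeomorphic_map XT XT g"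
  by (rule homeomorphic_map_eq[of XT XT f]) auto

lemma group_\<Gamma>: "group \<Gamma>"
proof -
  have "subgroup {h \<in> Bij X. homeomorphic_map XT XT h \<and> (\<forall>x\<in>X. h (shift x) = shift (h x))} (BijGroup X)"
    (is "subgroup ?H _")
  proof (rule group.subgroupI[OF group_BijGroup])
    have "(\<lambda>x\<in>X. x) \<in> ?H"
      using id_Bij shift_X homeo_cong[of id "\<lambda>x\<in>X. x"] by (simp add: homeomorphic_map_id)
    then show "?H \<noteq> {}" by blast
    show "?H \<subseteq> carrier (BijGroup X)" by (auto simp: BijGroup_def)
    fix f assume f: "f \<in> ?H"
    define g where "g = (\<lambda>x\<in>X. inv_into X f x)"
    have fb: "bij_betw f X X" using f by (auto simp: Bij_def)
    have gB: "g \<in> Bij X" unfolding g_def using restrict_inv_into_Bij f by blast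
    have gX: "g x \<in> X" "f (g x) = x" "g (f x) = x" if "x \<in> X" for x
      using fb that by (auto simp: g_def bij_betw_def inv_into_into f_inv_into_f)
    obtain g' where g': "homeomorphic_maps XT XT f g'" using f homeomorphic_map_maps by blast
    have "g' x = g x" if "x \<in> X" for x
      using g' gX that fb unfolding homeomorphic_maps_def by (metis topspace_XT)
    moreover have "homeomorphic_map XT XT g'" using g' homeomorphic_maps_map by blast
    ultimately have gh: "homeomorphic_map XT XT g" using homeo_cong by blast
    have "g (shift x) = shift (g x)" if "x \<in> X" for x
      using f gX[of x] gX(3)[of "shift (g x)"] shift_X that by auto
    then have "g \<in> ?H" using gB gh by blast
    then show "inv\<^bsub>BijGroup X\<^esub> f \<in> ?H" using inv_BijGroup[of f X] f by (simp add: g_def)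
  next
    fix f g assume fg: "f \<in> ?H" "g \<in> ?H"
    have gX: "g x \<in> X" if "x \<in> X" for x using fg that Bij_imp_funcset by blast
    have "compose X f g \<in> Bij X" using fg compose_Bij by blast
    moreover have "homeomorphic_map XT XT (compose X f g)"
      by (rule homeo_cong[of "f \<circ> g"]) (use fg in \<open>auto simp: compose_def intro: homeomorphic_map_compose\<close>)
    moreover have "compose X f g (shift x) = shift (compose X f g x)" if "x \<in> X" for x
      using fg that gX shift_X by (auto simp: compose_def)
    ultimately show "f \<otimes>\<^bsub>BijGroup X\<^esub> g \<in> ?H" using fg by (simp add: BijGroup_def)
  qed
  then show ?thesis
    unfolding automorphism_group_def topspace_XT
    by (rule subgroup.subgroup_is_group[OF _ group_BijGroup])
qed

sublocale \<Gamma>: group \<Gamma> by (rule group_\<Gamma>)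

lemma aut_X: "f \<in> carrier \<Gamma> \<Longrightarrow> x \<in> X \<Longrightarrow> f x \<in> X"
  using Bij_imp_funcset unfolding carrier_\<Gamma> by blast

lemma mult_apply: "f \<in> carrier \<Gamma> \<Longrightarrow> g \<in> carrier \<Gamma> \<Longrightarrow> x \<in> X \<Longrightarrow> (f \<otimes>\<^bsub>\<Gamma>\<^esub> g) x = f (g x)"
  by (simp add: mult_\<Gamma> compose_def)

lemma one_apply: "x \<in> X \<Longrightarrow> \<one>\<^bsub>\<Gamma>\<^esub> x = x" by (simp add: one_\<Gamma>)

lemma inv_apply: "f \<in> carrier \<Gamma> \<Longrightarrow> x \<in> X \<Longrightarrow> (inv\<^bsub>\<Gamma>\<^esub> f) (f x) = x"
  by (metis \<Gamma>.inv_closed \<Gamma>.l_inv mult_apply one_apply)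

lemma aut_eqI:
  assumes "f \<in> carrier \<Gamma>" "g \<in> carrier \<Gamma>" "\<And>x. x \<in> X \<Longrightarrow> f x = g x" shows "f = g"
  using assms unfolding carrier_\<Gamma> by (intro extensionalityI[of f X g]) (auto dest: Bij_imp_extensional)

lemma aut_sh1: "f \<in> carrier \<Gamma> \<Longrightarrow> x \<in> X \<Longrightarrow> f (sh 1 x) = sh 1 (f x)"
  by (simp add: carrier_\<Gamma> flip: shift_eq_sh)

lemma aut_sh: "f \<in> carrier \<Gamma> \<Longrightarrow> x \<in> X \<Longrightarrow> f (sh t x) = sh t (f x)"
proof (induction t rule: int_induct[of _ 0])
  case (step1 i)
  have "f (sh 1 (sh i x)) = sh 1 (f (sh i x))"
    using step1(3) sh_X[OF step1(4), of i] by (rule aut_sh1)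
  then show ?case using step1 by (simp only: sh_sh add.commute[of i])
next
  case (step2 i)
  have "f (sh 1 (sh (i-1) x)) = sh 1 (f (sh (i-1) x))"
    using step2(3) sh_X[OF step2(4), of "i-1"] by (rule aut_sh1)
  moreover have "1 + (i - 1) = i" by simp
  ultimately have "sh 1 (f (sh (i-1) x)) = sh i (f x)" using step2 by (simp only: sh_sh)
  then have "sh (-1) (sh 1 (f (sh (i-1) x))) = sh (-1) (sh i (f x))" by simp
  moreover have "-1 + 1 = (0::int)" "-1 + i = i - 1" by simp_all
  ultimately show ?case by (simp only: sh_sh sh_0)
qed simp

text \<open>The theorem of Curtis, Hedlund and Lyndon: by compactness the symbol of \<open>f x\<close> at \<open>0\<close>, which depends
  continuously on \<open>x\<close>, is read off from a window of uniform size.\<close>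

lemma aut_radius:
  assumes f: "f \<in> carrier \<Gamma>"
  obtains R where "\<And>x y t. x \<in> X \<Longrightarrow> y \<in> X \<Longrightarrow> (\<And>i. t - int R \<le> i \<Longrightarrow> i \<le> t + int R \<Longrightarrow> x i = y i) \<Longrightarrow> f x t = f y t"
proof -
  have "\<exists>R. \<forall>x\<in>X. \<forall>y\<in>X. agree R x y \<longrightarrow> f x 0 = f y 0"
  proof (rule uniform_window)
    fix x assume x: "x \<in> X"
    have c: "continuous_map XT XT f" using f by (auto simp: carrier_\<Gamma> homeomorphic_imp_continuous_map)
    have "openin XT {z \<in> X. f z \<in> {y \<in> X. agree 0 (f x) y}}"
      using openin_continuous_map_preimage[OF c openin_window[of 0 "f x"]] by simp
    then obtain n where "\<forall>y\<in>X. agree n x y \<longrightarrow> agree 0 (f x) (f y)"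
      using x aut_X[OF f x] unfolding openin_XT_iff by fastforce
    then show "\<exists>n. \<forall>z\<in>X. agree n x z \<longrightarrow> (\<forall>y\<in>X. agree n z y \<longrightarrow> f z 0 = f y 0)"
      unfolding agree_def by (metis abs_zero of_nat_0 order.refl)
  qed (use agree_mono in blast)
  then obtain R where R: "\<And>x y. x \<in> X \<Longrightarrow> y \<in> X \<Longrightarrow> agree R x y \<Longrightarrow> f x 0 = f y 0" by blast
  have "f x t = f y t" if xy: "x \<in> X" "y \<in> X" and ag: "\<And>i. t - int R \<le> i \<Longrightarrow> i \<le> t + int R \<Longrightarrow> x i = y i" for x y t
  proof -
    have "f (sh t x) 0 = f (sh t y) 0" using xy ag by (intro R sh_X) (auto simp: agree_def)
    then show ?thesis using aut_sh[OF f] xy by simp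
  qed
  then show ?thesis using that by blast
qed

definition \<sigma> where "\<sigma> = (\<lambda>x\<in>X. sh 1 x)"

end

section \<open>Automorphisms of minimal subshifts modulo the shift\<close>

context subshift_space
begin

lemma openin_XT_D:
  assumes "openin XT U" "x \<in> U"
  obtains w where "\<And>y. y \<in> X \<Longrightarrow> agree w x y \<Longrightarrow> y \<in> U"
  using bspec[OF conjunct2[OF iffD1[OF openin_XT_iff assms(1)]] assms(2)] by auto

lemma \<sigma>_apply: "x \<in> X \<Longrightarrow> \<sigma> x = sh 1 x" by (simp add: \<sigma>_def)

lemma continuous_sh: "continuous_map XT XT (sh t)"
  unfolding continuous_map
proof (intro conjI allI impI)
  show "sh t ` topspace XT \<subseteq> topspace XT" using sh_X by auto
next
  fix U assume U: "openin XT U"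
  have "\<exists>w. \<forall>y\<in>X. agree w x y \<longrightarrow> sh t y \<in> U" if "x \<in> X" "sh t x \<in> U" for x
  proof -
    obtain w where w: "\<And>y. y \<in> X \<Longrightarrow> agree w (sh t x) y \<Longrightarrow> y \<in> U"
      using openin_XT_D[OF U \<open>sh t x \<in> U\<close>] by blast
    have "\<forall>y\<in>X. agree (w + nat \<bar>t\<bar>) x y \<longrightarrow> sh t y \<in> U"
      using w[OF sh_X[of _ t]] agree_sh[of "w + nat \<bar>t\<bar>" x _ w t] by simp
    then show ?thesis ..
  qed
  then show "openin XT {x \<in> topspace XT. sh t x \<in> U}"
    unfolding openin_XT_iff by simp
qed

lemma homeomorphic_sh: "homeomorphic_map XT XT (sh t)"
proof -
  have "homeomorphic_maps XT XT (sh t) (sh (-t))"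
    unfolding homeomorphic_maps_def using continuous_sh by simp
  then show ?thesis using homeomorphic_maps_map by blast
qed

lemma homeo_in_\<Gamma>:
  assumes h: "homeomorphic_map XT XT h" and c: "\<And>x. x \<in> X \<Longrightarrow> h (sh 1 x) = sh 1 (h x)"
  shows "(\<lambda>x\<in>X. h x) \<in> carrier \<Gamma>"
proof -
  have b: "bij_betw h X X"
    using homeomorphic_imp_injective_map[OF h] homeomorphic_imp_surjective_map[OF h] by (simp add: bij_betw_def)
  have bB: "(\<lambda>x\<in>X. h x) \<in> Bij X" using b by (auto simp: Bij_def bij_betw_restrict_eq)
  have "homeomorphic_map XT XT (\<lambda>x\<in>X. h x)" by (rule homeo_cong[OF h]) simp
  then show ?thesis using bB c shift_X bij_betwE[OF b] unfolding carrier_\<Gamma> by (simp add: shift_eq_sh sh_X)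
qed

lemma \<sigma>_in: "\<sigma> \<in> carrier \<Gamma>"
  unfolding \<sigma>_def by (rule homeo_in_\<Gamma>[OF homeomorphic_sh]) simp

lemma flow_pow:
  assumes g: "g \<in> carrier \<Gamma>" and T1: "\<And>x. x \<in> X \<Longrightarrow> g x = T 1 x" and TX: "\<And>t x. x \<in> X \<Longrightarrow> T t x \<in> X"
    and add: "\<And>s t x. T s (T t x) = T (s + t) x" and zero: "\<And>x. T 0 x = x" and x: "x \<in> X"
  shows "(g [^]\<^bsub>\<Gamma>\<^esub> (k::int)) x = T k x"
proof -
  have nat: "(g [^]\<^bsub>\<Gamma>\<^esub> n) y = T (int n) y" if "y \<in> X" for n :: nat and y
    using that
  proof (induction n arbitrary: y)
    case 0 then show ?case by (simp add: one_apply zero)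
  next
    case (Suc n)
    have "(g [^]\<^bsub>\<Gamma>\<^esub> Suc n) y = (g [^]\<^bsub>\<Gamma>\<^esub> n) (T 1 y)" using Suc.prems g by (simp add: mult_apply T1)
    also have "\<dots> = T (int n) (T 1 y)" by (rule Suc.IH[OF TX[OF Suc.prems]])
    finally show ?case by (simp only: add of_nat_Suc add.commute)
  qed
  show ?thesis
  proof (cases "0 \<le> k")
    case True
    then have "int (nat k) = k" by simp
    then show ?thesis using nat[OF x, of "nat k"] int_pow_int[of \<Gamma> g "nat k"] by (simp only:)
  next
    case False
    define n where "n = nat (- k)"
    define p where "p = g [^]\<^bsub>\<Gamma>\<^esub> n"
    have p: "p \<in> carrier \<Gamma>" using g by (simp add: p_def)
    have k: "k = - int n" using False by (simp add: n_def)
    have "g [^]\<^bsub>\<Gamma>\<^esub> k = inv\<^bsub>\<Gamma>\<^esub> p"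
      using \<Gamma>.int_pow_neg[OF g, of "int n"] int_pow_int[of \<Gamma> g n] by (simp add: k p_def)
    moreover have "p (T k x) = T (int n) (T k x)" unfolding p_def by (rule nat[OF TX[OF x]])
    moreover have "T (int n) (T k x) = x" using k by (simp only: add zero add.right_inverse)
    ultimately show ?thesis using inv_apply[OF p TX[OF x, of k]] by simp
  qed
qed

lemma \<sigma>_pow: "x \<in> X \<Longrightarrow> (\<sigma> [^]\<^bsub>\<Gamma>\<^esub> (k::int)) x = sh k x"
  by (rule flow_pow[where T = sh, OF \<sigma>_in \<sigma>_apply sh_X sh_sh sh_0])

definition radius :: "int \<Rightarrow> ((int \<Rightarrow> 'a) \<Rightarrow> (int \<Rightarrow> 'a)) \<Rightarrow> bool" where
  "radius R f \<longleftrightarrow> (\<forall>x\<in>X. \<forall>y\<in>X. \<forall>t. (\<forall>i. t - R \<le> i \<longrightarrow> i \<le> t + R \<longrightarrow> x i = y i) \<longrightarrow> f x t = f y t)"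

lemma radiusD: "radius R f \<Longrightarrow> x \<in> X \<Longrightarrow> y \<in> X \<Longrightarrow>
    (\<And>i. t - R \<le> i \<Longrightarrow> i \<le> t + R \<Longrightarrow> x i = y i) \<Longrightarrow> f x t = f y t"
  unfolding radius_def by blast

lemma common_radius:
  assumes "finite F" "F \<subseteq> carrier \<Gamma>"
  obtains R where "0 \<le> R" "\<And>f. f \<in> F \<Longrightarrow> radius R f"
proof -
  have "\<exists>R::nat. radius (int R) f" if "f \<in> carrier \<Gamma>" for f
    unfolding radius_def by (rule aut_radius[OF that]) blast
  then obtain r :: "_ \<Rightarrow> nat" where r: "\<And>f. f \<in> carrier \<Gamma> \<Longrightarrow> radius (int (r f)) f" by metis
  have "radius (int (Max (r ` F))) f" if f: "f \<in> F" for f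
  proof -
    have le: "int (r f) \<le> int (Max (r ` F))" using f assms(1) by simp
    have "radius (int (r f)) f" using r f assms(2) by blast
    then show ?thesis unfolding radius_def by (meson le add_left_mono diff_left_mono order.trans)
  qed
  then show ?thesis using that[of "int (Max (r ` F))"] by simp
qed

text \<open>Evaluate \<open>\<psi> (\<xi> x)\<close> near \<open>t + i + j\<close> in two ways, for \<open>t\<close> just to the left of the interval on which \<open>\<xi>\<close>
  matches. Replacing \<open>\<xi> x\<close> by a shift of \<open>x\<close>, which is legitimate around \<open>t + j\<close>, yields \<open>x t\<close>; replacing
  \<open>\<psi> x\<close> by a shift of \<open>x\<close> after commuting the two maps yields \<open>\<xi> x\<close> at \<open>t + i\<close>. So the match of \<open>\<xi>\<close>
  grows by one position at a time as long as \<open>\<psi>\<close> matches.\<close>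

lemma extend_match_left:
  assumes \<psi>: "\<psi> \<in> carrier \<Gamma>" "radius R \<psi>" and \<xi>: "\<xi> \<in> carrier \<Gamma>" "radius R \<xi>"
    and comm: "\<psi> \<otimes>\<^bsub>\<Gamma>\<^esub> \<xi> = \<xi> \<otimes>\<^bsub>\<Gamma>\<^esub> \<psi>" and x: "x \<in> X"
    and mf: "\<forall>u\<in>{a..<b}. \<psi> x (u + j) = x u" and mg: "\<forall>u\<in>{c..<d}. \<xi> x (u + i) = x u"
    and cond: "R < j" "R \<le> i" "c + i + R \<le> b" "c + j + R \<le> d" "0 \<le> R"
    and u: "a \<le> u" "u < d"
  shows "\<xi> x (u + i) = x u"
proof -
  have com: "\<psi> (\<xi> x) = \<xi> (\<psi> x)" using comm mult_apply \<psi> \<xi> x by metis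
  have step: "\<xi> x (t + i) = x t" if t: "a \<le> t" "t < c" and IH: "\<forall>u\<in>{t<..<d}. \<xi> x (u + i) = x u" for t
  proof -
    have "\<xi> x (t + i) = \<xi> (sh j (\<psi> x)) (t + i)"
      by (rule radiusD[OF \<xi>(2)]) (use x sh_X aut_X \<psi> mf t cond in auto)
    also have "\<dots> = \<xi> (\<psi> x) (t + i + j)" using aut_sh[OF \<xi>(1) aut_X[OF \<psi>(1) x]] by simp
    also have "\<dots> = \<psi> (sh i (\<xi> x)) (t + j)" using aut_sh[OF \<psi>(1) aut_X[OF \<xi>(1) x]] com by (simp add: algebra_simps)
    also have "\<dots> = \<psi> x (t + j)"
      by (rule radiusD[OF \<psi>(2)]) (use x sh_X aut_X \<xi> IH t cond in auto)
    also have "\<dots> = x t" using mf t cond by auto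
    finally show ?thesis .
  qed
  have "\<forall>u\<in>{a..<d}. c - int n \<le> u \<longrightarrow> \<xi> x (u + i) = x u" for n
  proof (induction n)
    case 0 then show ?case using mg by auto
  next
    case (Suc n)
    show ?case
    proof (intro ballI impI)
      fix u assume u: "u \<in> {a..<d}" "c - int (Suc n) \<le> u"
      show "\<xi> x (u + i) = x u"
      proof (cases "c - int n \<le> u")
        case False
        have "\<forall>v\<in>{u<..<d}. \<xi> x (v + i) = x v" using Suc u by auto
        then show ?thesis using step[of u] u False by auto
      qed (use Suc u in blast)
    qed
  qed
  from this[of "nat (c - u)"] show ?thesis using u by auto
qed

text \<open>The mirror image of the previous argument. Going to the right requires the inverse of \<open>\<psi>\<close>, because a
  match of \<open>\<psi>\<close> with positive shift compares a position with positions further to the right.\<close>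

lemma extend_match_right:
  assumes \<psi>: "\<psi> \<in> carrier \<Gamma>" "radius R (inv\<^bsub>\<Gamma>\<^esub> \<psi>)" and \<xi>: "\<xi> \<in> carrier \<Gamma>" "radius R \<xi>"
    and comm: "inv\<^bsub>\<Gamma>\<^esub> \<psi> \<otimes>\<^bsub>\<Gamma>\<^esub> \<xi> = \<xi> \<otimes>\<^bsub>\<Gamma>\<^esub> inv\<^bsub>\<Gamma>\<^esub> \<psi>" and x: "x \<in> X"
    and mf: "\<forall>u\<in>{a..<b}. \<psi> x (u + j) = x u" and mg: "\<forall>u\<in>{c..<d}. \<xi> x (u + i) = x u"
    and cond: "d \<le> b" "R < j" "i + 2 * R \<le> j" "R \<le> i" "a + j + 2 * R \<le> d" "c + j + R \<le> d" "0 \<le> R"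
    and u: "c \<le> u" "u < b"
  shows "\<xi> x (u + i) = x u"
proof -
  define \<omega> where "\<omega> = inv\<^bsub>\<Gamma>\<^esub> \<psi>"
  have \<omega>: "\<omega> \<in> carrier \<Gamma>" "radius R \<omega>" using \<psi> by (auto simp: \<omega>_def)
  have com: "\<omega> (\<xi> x) = \<xi> (\<omega> x)" using comm mult_apply \<omega> \<xi> x unfolding \<omega>_def[symmetric] by metis
  have pull: "\<omega> x (t - j) = x t" if "a + j + R \<le> t" "t < b + j - R" for t
  proof -
    have "\<omega> x (t - j) = \<omega> (sh j (\<psi> x)) (t - j)"
      by (rule radiusD[OF \<omega>(2)]) (use x sh_X aut_X \<psi> mf that in auto)
    also have "\<dots> = \<omega> (\<psi> x) t" using aut_sh[OF \<omega>(1) aut_X[OF \<psi>(1) x]] by simp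
    finally show ?thesis using inv_apply[OF \<psi>(1) x] by (simp add: \<omega>_def)
  qed
  have step: "\<xi> x (t + i) = x t" if t: "d \<le> t" "t < b" and IH: "\<forall>u\<in>{c..<t}. \<xi> x (u + i) = x u" for t
  proof -
    have "\<xi> x (t + i) = \<xi> (sh (-j) (\<omega> x)) (t + i)"
      by (rule radiusD[OF \<xi>(2)]) (use x sh_X aut_X \<omega> t cond in \<open>auto simp: pull\<close>)
    also have "\<dots> = \<xi> (\<omega> x) (t + i - j)" using aut_sh[OF \<xi>(1) aut_X[OF \<omega>(1) x]] by simp
    also have "\<dots> = \<omega> (sh i (\<xi> x)) (t - j)" using aut_sh[OF \<omega>(1) aut_X[OF \<xi>(1) x]] com by (simp add: algebra_simps)
    also have "\<dots> = \<omega> x (t - j)"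
      by (rule radiusD[OF \<omega>(2)]) (use x sh_X aut_X \<xi> IH t cond in auto)
    also have "\<dots> = x t" using pull t cond by auto
    finally show ?thesis .
  qed
  have "\<forall>u\<in>{c..<b}. u < d + int n \<longrightarrow> \<xi> x (u + i) = x u" for n
  proof (induction n)
    case 0 then show ?case using mg by auto
  next
    case (Suc n)
    show ?case
    proof (intro ballI impI)
      fix u assume u: "u \<in> {c..<b}" "u < d + int (Suc n)"
      show "\<xi> x (u + i) = x u"
      proof (cases "u < d + int n")
        case False
        have "\<forall>v\<in>{c..<u}. \<xi> x (v + i) = x v" using Suc u by auto
        then show ?thesis using step[of u] u False by auto
      qed (use Suc u in blast)
    qed
  qed
  from this[of "nat (u - d + 1)"] show ?thesis using u by auto
qed

text \<open>What a level of a Bratteli diagram says about the points of \<open>X\<close>: the return times to the base \<open>C\<close>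
  cut each point into blocks, and the block that starts at a point of \<open>C\<close> is determined, with its length, by one of
  at most \<open>K\<close> labels. All blocks have length at least \<open>h\<close>.\<close>

definition towers :: "nat \<Rightarrow> int \<Rightarrow> bool" where
  "towers K h \<longleftrightarrow> (\<exists>C (v :: (int \<Rightarrow> 'a) \<Rightarrow> nat) V H. finite V \<and> card V \<le> K \<and> (\<forall>u\<in>V. h \<le> H u) \<and>
     (\<forall>y\<in>X \<inter> C. v y \<in> V) \<and> (\<forall>x\<in>X. \<exists>t\<le>0. sh t x \<in> C) \<and>
     (\<forall>y\<in>X \<inter> C. sh (H (v y)) y \<in> C \<and> (\<forall>t. 0 < t \<and> t < H (v y) \<longrightarrow> sh t y \<notin> C)) \<and>
     (\<forall>y\<in>X \<inter> C. \<forall>z\<in>X \<inter> C. v y = v z \<longrightarrow> (\<forall>t. 0 \<le> t \<and> t < H (v y) \<longrightarrow> y t = z t)))"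

end

lemma crowd_bound_mono2: "q \<le> r \<Longrightarrow> K \<le> L \<Longrightarrow> crowd_bound K q \<le> crowd_bound L r"
proof -
  assume *: "q \<le> r" "K \<le> L"
  have "crowd_bound K q \<le> crowd_bound L q" using *(2) by (induction q) auto
  then show ?thesis using crowd_bound_mono[OF *(1), of L] by simp
qed

locale minimal_subshift = subshift_space +
  assumes nonempty: "X \<noteq> {}"
    and dense: "x \<in> X \<Longrightarrow> y \<in> X \<Longrightarrow> \<exists>t. agree w y (sh t x)"
begin

text \<open>By compactness the return times given by minimality are bounded.\<close>

lemma syndetic:
  assumes y: "y \<in> X"
  shows "\<exists>N::nat. \<forall>x\<in>X. \<exists>t. 0 \<le> t \<and> t \<le> int N \<and> agree w y (sh t x)"
proof -
  have "\<exists>n. \<forall>x\<in>X. \<exists>t. \<bar>t\<bar> \<le> int n \<and> agree w y (sh t x)"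
  proof (rule uniform_window)
    fix x assume "x \<in> X"
    then obtain t where t: "agree w y (sh t x)" using dense y by blast
    have "\<forall>z\<in>X. agree (w + nat \<bar>t\<bar>) x z \<longrightarrow> (\<exists>t'. \<bar>t'\<bar> \<le> int (w + nat \<bar>t\<bar>) \<and> agree w y (sh t' z))"
    proof (intro ballI impI exI[of _ t] conjI)
      fix z assume "agree (w + nat \<bar>t\<bar>) x z"
      then show "agree w y (sh t z)" by (intro agree_trans[OF t] agree_sh) auto
    qed simp
    then show "\<exists>n. \<forall>z\<in>X. agree n x z \<longrightarrow> (\<exists>t. \<bar>t\<bar> \<le> int n \<and> agree w y (sh t z))" ..
  qed force
  then obtain n where n: "\<And>x. x \<in> X \<Longrightarrow> \<exists>t. \<bar>t\<bar> \<le> int n \<and> agree w y (sh t x)" by blast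
  have "\<exists>t. 0 \<le> t \<and> t \<le> int (2 * n) \<and> agree w y (sh t x)" if xX: "x \<in> X" for x
  proof -
    obtain t where "\<bar>t\<bar> \<le> int n" "agree w y (sh t (sh (int n) x))" using n[of "sh (int n) x"] sh_X[OF xX] by blast
    then show ?thesis by (intro exI[of _ "t + int n"]) auto
  qed
  then show ?thesis by blast
qed

text \<open>If \<open>\<psi>\<close> is not the power of the shift that the match suggests, some window exhibits a position where
  the match fails. This window recurs with bounded gaps in every point.\<close>

lemma match_bounded:
  assumes \<psi>: "\<psi> \<in> carrier \<Gamma>" and ne: "\<psi> \<noteq> \<sigma> [^]\<^bsub>\<Gamma>\<^esub> (-j)"
  shows "\<exists>B::nat. \<forall>x\<in>X. \<forall>a. \<exists>u. a \<le> u \<and> u < a + int B \<and> \<psi> x (u + j) \<noteq> x u"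
proof -
  have "\<exists>y\<in>X. sh j (\<psi> y) \<noteq> y"
  proof (rule ccontr)
    assume *: "\<not> ?thesis"
    have "\<psi> x = sh (-j) x" if "x \<in> X" for x
    proof -
      have "sh j (\<psi> x) = x" using * that by blast
      then have "sh (-j) (sh j (\<psi> x)) = sh (-j) x" by (rule arg_cong)
      then show ?thesis by (simp only: sh_sh add.left_inverse sh_0)
    qed
    then have "\<psi> = \<sigma> [^]\<^bsub>\<Gamma>\<^esub> (-j)"
      using \<psi> \<Gamma>.int_pow_closed[OF \<sigma>_in, of "-j"] \<sigma>_pow by (intro aut_eqI) simp_all
    then show False using ne by simp
  qed
  then obtain y where yX: "y \<in> X" and ne: "sh j (\<psi> y) \<noteq> y" by blast
  from ne obtain i where "sh j (\<psi> y) i \<noteq> y i" by (meson ext)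
  then have y: "y \<in> X" "\<psi> y (i + j) \<noteq> y i" using yX by simp_all
  have "finite {\<psi>}" "{\<psi>} \<subseteq> carrier \<Gamma>" using \<psi> by auto
  then obtain R where R': "0 \<le> R" "\<And>f. f \<in> {\<psi>} \<Longrightarrow> radius R f" by (rule common_radius) blast
  then have R: "0 \<le> R" "radius R \<psi>" by auto
  define y' where "y' = sh i y"
  have y': "y' \<in> X" "\<psi> y' j \<noteq> y' 0"
    using y sh_X[OF yX] aut_sh[OF \<psi> yX, of i] by (simp_all add: y'_def add.commute)
  define w where "w = nat (R + \<bar>j\<bar>)"
  obtain N where N: "\<And>x. x \<in> X \<Longrightarrow> \<exists>t. 0 \<le> t \<and> t \<le> int N \<and> agree w y' (sh t x)"
    using syndetic[OF y'(1), of w] by blast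
  have "\<exists>u. a \<le> u \<and> u < a + int (Suc N) \<and> \<psi> x (u + j) \<noteq> x u" if x: "x \<in> X" for x a
  proof -
    obtain t where t: "0 \<le> t" "t \<le> int N" "agree w y' (sh t (sh a x))" using N[OF sh_X[OF x, of a]] by blast
    define u where "u = t + a"
    have ag: "agree w y' (sh u x)" using t by (simp add: u_def)
    have "\<psi> y' j = \<psi> (sh u x) j"
      by (rule radiusD[OF R(2) y'(1) sh_X[OF x]]) (use ag R(1) in \<open>auto simp: agree_def w_def\<close>)
    then have "\<psi> x (u + j) = \<psi> y' j" using aut_sh[OF \<psi> x] by (simp add: add.commute)
    moreover have "x u = y' 0" using ag by (auto simp: agree_def)
    ultimately show ?thesis using y' t by (intro exI[of _ u]) (auto simp: u_def)
  qed
  then show ?thesis by blast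
qed

lemma aut_determined:
  assumes f: "f \<in> carrier \<Gamma>" "g \<in> carrier \<Gamma>" and x: "x \<in> X" "f x = g x"
  shows "f = g"
proof (rule aut_eqI[OF f])
  fix y assume y: "y \<in> X"
  have "finite {f, g}" "{f, g} \<subseteq> carrier \<Gamma>" using f by auto
  then obtain R where R': "0 \<le> R" "\<And>h. h \<in> {f, g} \<Longrightarrow> radius R h" by (rule common_radius) blast
  have R: "0 \<le> R" "radius R f" "radius R g" using R' by auto
  show "f y = g y"
  proof
    fix i
    obtain t where t: "agree (nat (R + \<bar>i\<bar>)) y (sh t x)" using dense x y by blast
    have *: "h y i = h (sh t x) i" if "radius R h" for h
      by (rule radiusD[OF that y sh_X[OF x(1)]]) (use t R in \<open>auto simp: agree_def\<close>)
    show "f y i = g y i"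
      using *[OF R(2)] *[OF R(3)] aut_sh[OF f(1) x(1), of t] aut_sh[OF f(2) x(1), of t] x(2) by (simp only:)
  qed
qed

text \<open>A nontrivial automorphism moves symbols with bounded gaps in every point, in particular on every
  right half-line.\<close>

lemma aut_eq_if_asymptotic:
  assumes f: "f \<in> carrier \<Gamma>" "g \<in> carrier \<Gamma>" and x: "x \<in> X" and as: "\<And>i. b \<le> i \<Longrightarrow> f x i = g x i"
  shows "f = g"
proof (rule ccontr)
  assume "f \<noteq> g"
  define \<psi> where "\<psi> = f \<otimes>\<^bsub>\<Gamma>\<^esub> inv\<^bsub>\<Gamma>\<^esub> g"
  have \<psi>: "\<psi> \<in> carrier \<Gamma>" using f by (simp add: \<psi>_def)
  have "\<psi> \<otimes>\<^bsub>\<Gamma>\<^esub> g = f" using f by (simp add: \<psi>_def \<Gamma>.m_assoc)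
  then have "\<psi> \<noteq> \<one>\<^bsub>\<Gamma>\<^esub>" using f \<open>f \<noteq> g\<close> by auto
  then have "\<psi> \<noteq> \<sigma> [^]\<^bsub>\<Gamma>\<^esub> (- 0 :: int)" by simp
  then obtain B where B: "\<And>x a. x \<in> X \<Longrightarrow> \<exists>u. a \<le> u \<and> u < a + int B \<and> \<psi> x (u + 0) \<noteq> x u"
    using match_bounded[OF \<psi>, of 0] by blast
  obtain u where u: "b \<le> u" "\<psi> (g x) (u + 0) \<noteq> g x u" using B[OF aut_X[OF f(2) x]] by blast
  have "\<psi> (g x) = f x" using f x aut_X[OF f(2) x] unfolding \<psi>_def by (simp add: mult_apply inv_apply)
  then show False using u as by simp
qed

text \<open>The orbit of a periodic point is finite, hence closed, hence everything.\<close>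

lemma finite_if_periodic:
  assumes x: "x \<in> X" "sh s x = x" "0 < s"
  shows "finite X"
proof (rule finite_subset)
  have x1: "x (i + s) = x i" for i using fun_cong[OF x(2), of i] by simp
  have nat_per: "x (i + s * int n) = x i" for i n
  proof (induction n)
    case (Suc n)
    have "i + s * int (Suc n) = (i + s * int n) + s" by (simp add: algebra_simps)
    then show ?case using x1[of "i + s * int n"] Suc by (simp only:)
  qed simp
  have per: "x (i + s * k) = x i" for i k
  proof (cases "0 \<le> k")
    case True
    then show ?thesis using nat_per[of i "nat k"] by simp
  next
    case False
    then show ?thesis using nat_per[of "i + s * k" "nat (-k)"] by simp
  qed
  show "X \<subseteq> (\<lambda>t. sh t x) ` {0..<s}"
  proof (rule subsetI, rule ccontr)
    fix y assume y: "y \<in> X" "y \<notin> (\<lambda>t. sh t x) ` {0..<s}"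
    have "\<exists>w. \<not> agree w y (sh t x)" if "t \<in> {0..<s}" for t using y that eq_if_agree by blast
    then obtain w where w: "\<And>t. t \<in> {0..<s} \<Longrightarrow> \<not> agree (w t) y (sh t x)" by metis
    obtain t where t: "agree (Max (w ` {0..<s})) y (sh t x)" using dense x y by blast
    have m: "t mod s \<in> {0..<s}" using x by simp
    have "sh t x i = sh (t mod s) x i" for i using per[of "i + t mod s" "t div s"] by (simp add: add.assoc)
    then have "sh t x = sh (t mod s) x" by blast
    then have "agree (Max (w ` {0..<s})) y (sh (t mod s) x)" using t by simp
    moreover have "w (t mod s) \<le> Max (w ` {0..<s})" using m by simp
    ultimately show False using w[OF m] agree_mono by blast
  qed
qed simp


subsection \<open>Automorphisms modulo the shift\<close>

text \<open>Each \<open>f \<in> F\<close> parses \<open>f x\<close> into blocks, and these parsings of the images of one point \<open>x\<close> are rivals: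
  where \<open>f\<close> and \<open>g\<close> see blocks with the same label, the images agree up to a shift, and applying the
  inverse of \<open>f\<close> turns this into a match of \<open>inv f \<otimes> g\<close> on \<open>x\<close>. Because the automorphisms
  differ modulo the shift, all such matches are bounded; choosing the towers
  tall makes every shift large.\<close>

theorem few_automorphisms_mod_shift:
  assumes comm: "\<And>f g. f \<in> carrier \<Gamma> \<Longrightarrow> g \<in> carrier \<Gamma> \<Longrightarrow> f \<otimes>\<^bsub>\<Gamma>\<^esub> g = g \<otimes>\<^bsub>\<Gamma>\<^esub> f"
    and towers: "\<And>h. towers K h"
    and F: "finite F" "F \<subseteq> carrier \<Gamma>"
    and diff: "\<And>f g k. f \<in> F \<Longrightarrow> g \<in> F \<Longrightarrow> f \<noteq> g \<Longrightarrow> inv\<^bsub>\<Gamma>\<^esub> f \<otimes>\<^bsub>\<Gamma>\<^esub> g \<noteq> \<sigma> [^]\<^bsub>\<Gamma>\<^esub> (k::int)"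
  shows "card F < crowd_bound K K"
proof -
  define q where "q f g = inv\<^bsub>\<Gamma>\<^esub> f \<otimes>\<^bsub>\<Gamma>\<^esub> g" for f g
  have q: "q f g \<in> carrier \<Gamma>" if "f \<in> F" "g \<in> F" for f g using that F by (auto simp: q_def)
  have q_inv: "inv\<^bsub>\<Gamma>\<^esub> (q f g) = q g f" if "f \<in> F" "g \<in> F" for f g
    using that F by (auto simp: q_def \<Gamma>.inv_mult_group subset_iff)
  define P where "P = (\<lambda>(f, g). q f g) ` (F \<times> F) \<union> (\<lambda>f. inv\<^bsub>\<Gamma>\<^esub> f) ` F"
  have "finite P" "P \<subseteq> carrier \<Gamma>" using F q by (auto simp: P_def)
  then obtain R where R: "0 \<le> R" "\<And>f. f \<in> P \<Longrightarrow> radius R f" by (rule common_radius) blast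
  have Rq: "radius R (q f g)" if "f \<in> F" "g \<in> F" for f g using R(2) that by (auto simp: P_def)
  have Ri: "radius R (inv\<^bsub>\<Gamma>\<^esub> f)" if "f \<in> F" for f using R(2) that by (auto simp: P_def)
  obtain x where x: "x \<in> X" using nonempty by blast
  define match where "match f g j u \<longleftrightarrow> q f g x (u + j) = x u" for f g j u
  \<comment> \<open>The height of the towers must exceed the lengths of the finitely many matches with small shift.\<close>
  have "\<exists>B::nat. \<forall>x\<in>X. \<forall>a. \<exists>u. a \<le> u \<and> u < a + int B \<and> q f g x (u + j) \<noteq> x u"
    if "f \<in> F" "g \<in> F" "f \<noteq> g" for f g j
    using match_bounded[OF q[OF that(1,2)]] diff[OF that] unfolding q_def by blast
  then have "\<exists>B::nat. \<forall>a. \<exists>u. a \<le> u \<and> u < a + int B \<and> \<not> match f g j u"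
    if "f \<in> F" "g \<in> F" "f \<noteq> g" for f g j using x that unfolding match_def by blast
  then obtain b :: "_ \<Rightarrow> _ \<Rightarrow> int \<Rightarrow> nat" where b: "\<And>f g j a. f \<in> F \<Longrightarrow> g \<in> F \<Longrightarrow> f \<noteq> g \<Longrightarrow>
      \<exists>u. a \<le> u \<and> u < a + int (b f g j) \<and> \<not> match f g j u"
    by metis
  define J where "J = {- (6 * R + 10)..6 * R + 10}"
  define B where "B = Max (insert 0 ((\<lambda>(f, g, j). int (b f g j)) ` (F \<times> F \<times> J)))"
  have finB: "finite (insert 0 ((\<lambda>(f, g, j). int (b f g j)) ` (F \<times> F \<times> J)))" using F by (simp add: J_def)
  have B: "int (b f g j) \<le> B" if "f \<in> F" "g \<in> F" "\<bar>j\<bar> < 6 * R + 10" for f g j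
    unfolding B_def using that by (intro Max_ge[OF finB]) (force simp: J_def)
  have B0: "0 \<le> B" unfolding B_def using Max_ge[OF finB, of 0] by simp
  obtain C V H and v :: "(int \<Rightarrow> 'a) \<Rightarrow> nat" where T: "finite V" "card V \<le> K"
    "\<forall>u\<in>V. B + 2 * R + 1 \<le> H u" "\<forall>y\<in>X \<inter> C. v y \<in> V" "\<forall>x\<in>X. \<exists>t\<le>0. sh t x \<in> C"
    "\<forall>y\<in>X \<inter> C. sh (H (v y)) y \<in> C \<and> (\<forall>t. 0 < t \<and> t < H (v y) \<longrightarrow> sh t y \<notin> C)"
    "\<forall>y\<in>X \<inter> C. \<forall>z\<in>X \<inter> C. v y = v z \<longrightarrow> (\<forall>t. 0 \<le> t \<and> t < H (v y) \<longrightarrow> y t = z t)"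
    using towers[of "B + 2 * R + 1"] unfolding towers_def by (elim exE conjE)
  note V = T(1,2)
  have Hbig: "B + 2 * R + 1 \<le> H u" if "u \<in> V" for u using T(3) that by blast
  have vV: "v y \<in> V" if "y \<in> X" "y \<in> C" for y using T(4) that by blast
  have past: "\<exists>t\<le>0. sh t y \<in> C" if "y \<in> X" for y using T(5) that by blast
  have again: "sh (H (v y)) y \<in> C" if "y \<in> X" "y \<in> C" for y using T(6) that by blast
  have first: "sh t y \<notin> C" if "y \<in> X" "y \<in> C" "0 < t" "t < H (v y)" for y t using T(6) that by blast
  have word: "y t = z t" if "y \<in> X" "y \<in> C" "z \<in> X" "z \<in> C" "v y = v z" "0 \<le> t" "t < H (v y)" for y z t
    using T(7) that by blast
  have fx: "f x \<in> X" if "f \<in> F" for f using that F x aut_X by blast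
  have fxs: "sh t (f x) \<in> X" if "f \<in> F" for f t using fx[OF that] sh_X by blast
  define back_time where "back_time f t = (LEAST n. sh (t - int n) (f x) \<in> C)" for f t
  define lft where "lft f t = t - int (back_time f t)" for f t
  define ty where "ty f t = v (sh (lft f t) (f x))" for f t
  have ex: "\<exists>n. sh (t - int n) (f x) \<in> C" if f: "f \<in> F" for f t
  proof -
    obtain s where "s \<le> 0" "sh s (sh t (f x)) \<in> C" using past[OF fxs[OF f]] by blast
    then show ?thesis by (intro exI[of _ "nat (-s)"]) (simp add: add.commute)
  qed
  have lC: "sh (lft f t) (f x) \<in> C" if f: "f \<in> F" for f t
    unfolding lft_def back_time_def using LeastI_ex[OF ex[OF f]] .
  have l_le: "lft f t \<le> t" for f t by (simp add: lft_def)
  have l_last: "s \<le> lft f t" if "f \<in> F" "s \<le> t" "sh s (f x) \<in> C" for f s t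
  proof -
    have "sh (t - int (nat (t - s))) (f x) \<in> C" using that by simp
    then have "back_time f t \<le> nat (t - s)" unfolding back_time_def by (rule Least_le)
    then show ?thesis using that by (simp add: lft_def)
  qed
  have r_gt: "t < lft f t + H (ty f t)" if f: "f \<in> F" for f t
  proof (rule ccontr)
    assume n: "\<not> ?thesis"
    have H: "0 < H (ty f t)" using Hbig[OF vV[OF fxs[OF f] lC[OF f]], of t] B0 R(1) by (simp add: ty_def)
    have "sh (H (ty f t)) (sh (lft f t) (f x)) \<in> C"
      unfolding ty_def by (rule again[OF fxs[OF f] lC[OF f]])
    then have "sh (H (ty f t) + lft f t) (f x) \<in> C" by (simp only: sh_sh)
    then have "H (ty f t) + lft f t \<le> lft f t" using n by (intro l_last[OF f]) auto
    then show False using H by simp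
  qed
  interpret rival_parsings F V match ty lft H R B
  proof (unfold_locales)
    show "finite F" "finite V" "0 \<le> R" by fact+
  next
    fix k t assume "k \<in> F"
    then show "ty k t \<in> V" unfolding ty_def using vV fxs lC by blast
  next
    fix k t assume "k \<in> F"
    show "lft k t \<le> t" by (rule l_le)
  next
    fix k t assume "k \<in> F"
    then show "t < lft k t + H (ty k t)" by (rule r_gt)
  next
    fix k t s assume k: "k \<in> F" and s: "lft k t \<le> s" "s < lft k t + H (ty k t)"
    have "lft k t \<le> lft k s" by (rule l_last[OF k s(1) lC[OF k]])
    moreover have "\<not> lft k t < lft k s"
    proof
      assume l: "lft k t < lft k s"
      have "sh (lft k s - lft k t) (sh (lft k t) (k x)) \<notin> C"
        using l s(2) l_le[of k s] unfolding ty_def by (intro first[OF fxs[OF k] lC[OF k]]) auto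
      then show False using lC[OF k, of s] by simp
    qed
    ultimately have "lft k s = lft k t" by simp
    then show "lft k s = lft k t \<and> ty k s = ty k t" by (simp add: ty_def)
  next
    fix u assume "u \<in> V"
    then show "B + 2 * R \<le> H u" using Hbig by force
  next
    fix k l t s u
    assume k: "k \<in> F" and l: "l \<in> F" and same: "ty k t = ty l s"
      and u: "lft k t + R \<le> u" "u < lft k t + H (ty k t) - R"
    define d where "d = lft l s - lft k t"
    have agree: "k x i = l x (i + d)" if "lft k t \<le> i" "i < lft k t + H (ty k t)" for i
    proof -
      have "sh (lft k t) (k x) (i - lft k t) = sh (lft l s) (l x) (i - lft k t)"
        by (rule word[OF fxs[OF k] lC[OF k] fxs[OF l] lC[OF l]])
          (use same that in \<open>auto simp: ty_def\<close>)
      then show ?thesis by (simp add: d_def algebra_simps)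
    qed
    have ik: "inv\<^bsub>\<Gamma>\<^esub> k \<in> carrier \<Gamma>" using k F by blast
    have "(inv\<^bsub>\<Gamma>\<^esub> k) (sh d (l x)) u = (inv\<^bsub>\<Gamma>\<^esub> k) (k x) u"
      by (rule radiusD[OF Ri[OF k] fxs[OF l] fx[OF k]]) (use agree u in auto)
    also have "\<dots> = x u" using inv_apply[of k x] k F x by auto
    finally have "(inv\<^bsub>\<Gamma>\<^esub> k) (l x) (u + d) = x u" using aut_sh[OF ik fx[OF l]] by simp
    moreover have "q k l x = (inv\<^bsub>\<Gamma>\<^esub> k) (l x)" unfolding q_def using ik l F x by (intro mult_apply) auto
    ultimately show "match k l (lft l s - lft k t) u" by (simp add: match_def d_def)
  next
    fix k l :: "(int \<Rightarrow> 'a) \<Rightarrow> int \<Rightarrow> 'a" and a b' j :: int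
    assume k: "k \<in> F" "l \<in> F" "k \<noteq> l" and ab: "a + B \<le> b'" and m: "\<And>u. a \<le> u \<Longrightarrow> u < b' \<Longrightarrow> match k l j u"
    show "6 * R + 10 \<le> \<bar>j\<bar>"
    proof (rule ccontr)
      assume "\<not> ?thesis"
      then have "int (b k l j) \<le> B" using B k by simp
      then show False using b[OF k, of a j] m ab by fastforce
    qed
  next
    fix k l :: "(int \<Rightarrow> 'a) \<Rightarrow> int \<Rightarrow> 'a" and b' j :: int
    assume k: "k \<in> F" "l \<in> F" "k \<noteq> l"
    show "\<exists>u<b'. \<not> match k l j u" using b[OF k, of "b' - int (b k l j)" j] by fastforce
  next
    fix k l k' l' :: "(int \<Rightarrow> 'a) \<Rightarrow> int \<Rightarrow> 'a" and a b' j c d i u :: int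
    assume k: "k \<in> F" "l \<in> F" "k' \<in> F" "l' \<in> F"
      and m: "\<forall>u\<in>{a..<b'}. match k l j u" "\<forall>u\<in>{c..<d}. match k' l' i u"
      and cond: "R < j" "R \<le> i" "c + i + R \<le> b'" "c + j + R \<le> d" "a \<le> u" "u < d"
    show "match k' l' i u" unfolding match_def
      by (rule extend_match_left[OF q[OF k(1,2)] Rq[OF k(1,2)] q[OF k(3,4)] Rq[OF k(3,4)]
            comm[OF q[OF k(1,2)] q[OF k(3,4)]] x m[unfolded match_def] cond(1-4) R(1) cond(5,6)])
  next
    fix k l k' l' :: "(int \<Rightarrow> 'a) \<Rightarrow> int \<Rightarrow> 'a" and a b' j c d i u :: int
    assume k: "k \<in> F" "l \<in> F" "k' \<in> F" "l' \<in> F"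
      and m: "\<forall>u\<in>{a..<b'}. match k l j u" "\<forall>u\<in>{c..<d}. match k' l' i u"
      and cond: "d \<le> b'" "R < j" "i + 2 * R \<le> j" "R \<le> i" "a + j + 2 * R \<le> d" "c + j + R \<le> d" "c \<le> u" "u < b'"
    have "radius R (inv\<^bsub>\<Gamma>\<^esub> (q k l))" using q_inv Rq k by simp
    then show "match k' l' i u" unfolding match_def
      using extend_match_right[OF q[OF k(1,2)] _ q[OF k(3,4)] Rq[OF k(3,4)]
            comm[OF \<Gamma>.inv_closed[OF q[OF k(1,2)]] q[OF k(3,4)]] x m[unfolded match_def] cond(1-6) R(1) cond(7,8)]
      by blast
  qed
  have "card F < crowd_bound (card V) (card V)" by (rule few_rivals)
  also have "\<dots> \<le> crowd_bound K K" using V(2) by (intro crowd_bound_mono2)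
  finally show ?thesis .
qed

end

section \<open>Towers of a Bratteli diagram\<close>

\<comment> \<open>As a rewrite rule it also expands shifts that are not applied to a position.\<close>
declare sh_apply [simp del]

lemma finite_chain_least:
  assumes "finite S" "S \<noteq> {}" "S \<subseteq> A" and r: "partial_order_on A r"
    and tot: "\<And>a b. a \<in> S \<Longrightarrow> b \<in> S \<Longrightarrow> (a, b) \<in> r \<or> (b, a) \<in> r"
  shows "\<exists>m\<in>S. \<forall>s\<in>S. (m, s) \<in> r"
  using assms(1,2,3) tot
proof (induction S rule: finite_ne_induct)
  case (singleton a)
  then show ?case by blast
next
  case (insert a S)
  then obtain m where m: "m \<in> S" "\<forall>s\<in>S. (m, s) \<in> r" by blast
  have tr: "trans r" using r by (auto simp: partial_order_on_def preorder_on_def)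
  show ?case
  proof (cases "(m, a) \<in> r")
    case False
    then have am: "(a, m) \<in> r" using insert.prems m by blast
    have "(a, s) \<in> r" if "s \<in> S" for s using transD[OF tr am] m that by blast
    moreover have "(a, a) \<in> r" using insert.prems by blast
    ultimately show ?thesis by blast
  qed (use m in blast)
qed

locale bratteli =
  fixes B :: "('v, 'e) ordered_bratteli"
  assumes proper: "properly_ordered B"
begin

lemma ordered: "ordered_bratteli_diagram B" and diagram: "bratteli_diagram B"
  using proper by (auto simp: properly_ordered_def ordered_bratteli_diagram_def)

lemma edges_props:
  assumes "e \<in> edges B n"
  shows "src B e \<in> verts B n" "rng B e \<in> verts B (Suc n)" "e \<in> all_edges B"
  using assms diagram by (auto simp: bratteli_diagram_def all_edges_def)

lemma edge_levelI:
  assumes "e \<in> all_edges B" "rng B e \<in> verts B (Suc n)" shows "e \<in> edges B n"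
proof -
  obtain m where m: "e \<in> edges B m" using assms by (auto simp: all_edges_def)
  then have "rng B e \<in> verts B (Suc m) \<inter> verts B (Suc n)" using edges_props(2) assms by blast
  moreover have "disjoint_family (verts B)" using diagram by (simp add: bratteli_diagram_def)
  ultimately have "m = n" unfolding disjoint_family_on_def by blast
  then show ?thesis using m by simp
qed

lemma order_rng: "e \<in> all_edges B \<Longrightarrow> f \<in> all_edges B \<Longrightarrow> (e, f) \<in> edge_order B \<Longrightarrow> rng B f = rng B e"
  using ordered unfolding ordered_bratteli_diagram_def by metis

lemma order_total: "e \<in> all_edges B \<Longrightarrow> f \<in> all_edges B \<Longrightarrow> rng B e = rng B f \<Longrightarrow>
    (e, f) \<in> edge_order B \<or> (f, e) \<in> edge_order B"
  using ordered unfolding ordered_bratteli_diagram_def by metis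

lemma order_po: "partial_order_on (all_edges B) (edge_order B)"
  using ordered unfolding ordered_bratteli_diagram_def by metis

lemma order_antisym: "(e, f) \<in> edge_order B \<Longrightarrow> (f, e) \<in> edge_order B \<Longrightarrow> e = f"
  using order_po unfolding partial_order_on_def antisym_def by blast

lemma finite_rng: "v \<in> verts B (Suc n) \<Longrightarrow> finite {e \<in> all_edges B. rng B e = v}"
proof -
  assume "v \<in> verts B (Suc n)"
  then have "{e \<in> all_edges B. rng B e = v} \<subseteq> edges B n" using edge_levelI by auto
  moreover have "finite (edges B n)" using diagram by (simp add: bratteli_diagram_def)
  ultimately show ?thesis by (rule finite_subset)
qed

lemma chain_least:
  assumes v: "v \<in> verts B (Suc n)" and S: "S \<subseteq> {e \<in> all_edges B. rng B e = v}" "S \<noteq> {}"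
  obtains m where "m \<in> S" "\<And>s. s \<in> S \<Longrightarrow> (m, s) \<in> edge_order B"
proof -
  have fin: "finite S" using S(1) finite_rng[OF v] by (rule finite_subset)
  have "S \<subseteq> all_edges B" using S(1) by blast
  moreover have "(a, b) \<in> edge_order B \<or> (b, a) \<in> edge_order B" if "a \<in> S" "b \<in> S" for a b
  proof (rule order_total)
    show "a \<in> all_edges B" "b \<in> all_edges B" "rng B a = rng B b" using S(1) that by auto
  qed
  ultimately have "\<exists>m\<in>S. \<forall>s\<in>S. (m, s) \<in> edge_order B"
    by (rule finite_chain_least[OF fin S(2) _ order_po])
  then show ?thesis using that by blast
qed

lemma min_edge_exists:
  assumes v: "v \<in> verts B (Suc n)"
  obtains e where "e \<in> edges B n" "rng B e = v" "min_edge B e"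
proof -
  let ?S = "{e \<in> all_edges B. rng B e = v}"
  have "?S \<noteq> {}" using diagram v unfolding bratteli_diagram_def by fastforce
  then obtain m where m: "m \<in> ?S" "\<And>s. s \<in> ?S \<Longrightarrow> (m, s) \<in> edge_order B"
    by (rule chain_least[OF v order_refl]) blast
  have "min_edge B m" unfolding min_edge_def
  proof (intro conjI ballI impI)
    fix f assume f: "f \<in> all_edges B" "(f, m) \<in> edge_order B"
    then have "rng B f = v" using order_rng[of f m] m(1) by simp
    then show "f = m" using m(2)[of f] f order_antisym[of f m] by simp
  qed (use m(1) in simp)
  then show ?thesis using that[of m] m(1) edge_levelI[of m n] v by simp
qed

lemma min_edge_unique: "min_edge B e \<Longrightarrow> min_edge B f \<Longrightarrow> rng B e = rng B f \<Longrightarrow> e = f"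
  using order_total unfolding min_edge_def by metis

lemma edge_succ:
  assumes e: "e \<in> edges B n" and nm: "\<not> max_edge B e"
  shows "edge_succ B e \<in> edges B n" "rng B (edge_succ B e) = rng B e" "\<not> min_edge B (edge_succ B e)"
proof -
  let ?S = "{g \<in> all_edges B. g \<noteq> e \<and> (e, g) \<in> edge_order B}"
  note eE = edges_props[OF e]
  have sub: "?S \<subseteq> {f \<in> all_edges B. rng B f = rng B e}" using order_rng eE by auto
  have ne: "?S \<noteq> {}" using nm eE unfolding max_edge_def by blast
  obtain m where m: "m \<in> ?S" "\<And>s. s \<in> ?S \<Longrightarrow> (m, s) \<in> edge_order B"
    by (rule chain_least[OF eE(2) sub ne]) blast
  have "edge_succ B e = m"
    unfolding edge_succ_def
  proof (rule the_equality)
    show "m \<in> all_edges B \<and> m \<noteq> e \<and> (e, m) \<in> edge_order B \<and>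
      (\<forall>g\<in>all_edges B. g \<noteq> e \<and> (e, g) \<in> edge_order B \<longrightarrow> (m, g) \<in> edge_order B)"
      using m(1) m(2) by simp
  next
    fix f assume "f \<in> all_edges B \<and> f \<noteq> e \<and> (e, f) \<in> edge_order B \<and>
      (\<forall>g\<in>all_edges B. g \<noteq> e \<and> (e, g) \<in> edge_order B \<longrightarrow> (f, g) \<in> edge_order B)"
    then show "f = m" using m(1) m(2)[of f] order_antisym[of f m] by blast
  qed
  moreover have rm: "rng B m = rng B e" using m(1) sub by blast
  moreover have "\<not> min_edge B m" using m(1) eE unfolding min_edge_def by blast
  moreover have "m \<in> edges B n" using m(1) rm eE by (intro edge_levelI) simp_all
  ultimately show "edge_succ B e \<in> edges B n" "rng B (edge_succ B e) = rng B e" "\<not> min_edge B (edge_succ B e)"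
    by simp_all
qed

lemma min_prefix_exists:
  "v \<in> verts B n \<Longrightarrow> \<exists>f. \<forall>i<n. f i \<in> edges B i \<and> min_edge B (f i) \<and>
     rng B (f i) = (if Suc i = n then v else src B (f (Suc i)))"
proof (induction n arbitrary: v)
  case (Suc n)
  obtain e where e: "e \<in> edges B n" "rng B e = v" "min_edge B e" using min_edge_exists[OF Suc.prems] .
  then obtain f where f: "\<forall>i<n. f i \<in> edges B i \<and> min_edge B (f i) \<and>
     rng B (f i) = (if Suc i = n then src B e else src B (f (Suc i)))"
    using Suc.IH edges_props(1) by blast
  show ?case by (rule exI[of _ "f(n := e)"]) (use e f in \<open>auto simp: less_Suc_eq\<close>)
qed simp

text \<open>Follow the minimal edges backwards from the common vertex.\<close>

lemma min_prefix_unique: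
  assumes p: "\<forall>i<n. rng B (p i) = src B (p (Suc i)) \<and> min_edge B (p i)"
    and q: "\<forall>i<n. rng B (q i) = src B (q (Suc i)) \<and> min_edge B (q i)"
    and eq: "src B (p n) = src B (q n)" and i: "i < n"
  shows "p i = q i"
  using p q eq i
proof (induction n arbitrary: i)
  case (Suc n)
  have "p n = q n" using Suc.prems by (intro min_edge_unique) auto
  then show ?case using Suc.IH[of i] Suc.prems by (cases "i = n") auto
qed simp

text \<open>The base and the top of the towers at level \<open>N\<close>.\<close>

definition low :: "nat \<Rightarrow> (nat \<Rightarrow> 'e) \<Rightarrow> bool" where "low N p \<longleftrightarrow> (\<forall>i<N. min_edge B (p i))"
definition high :: "nat \<Rightarrow> (nat \<Rightarrow> 'e) \<Rightarrow> bool" where "high N p \<longleftrightarrow> (\<forall>i<N. max_edge B (p i))"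

abbreviation \<Lambda> where "\<Lambda> \<equiv> vershik_map B"

lemma vershik_max:
  assumes "\<forall>n. max_edge B (p n)" shows "\<Lambda> p \<in> paths B" "\<forall>n. min_edge B (\<Lambda> p n)"
proof -
  have "\<exists>!q. q \<in> paths B \<and> (\<forall>n. min_edge B (q n))" using proper by (simp add: properly_ordered_def)
  from theI'[OF this] show "\<Lambda> p \<in> paths B" "\<forall>n. min_edge B (\<Lambda> p n)"
    using assms by (auto simp: vershik_map_def)
qed

text \<open>The definite description in the Vershik map denotes a path, because the minimal edges lead back
  from every vertex to the root in exactly one way.\<close>

lemma vershik_step:
  assumes p: "p \<in> paths B" and k: "\<not> max_edge B (p k)" "\<forall>i<k. max_edge B (p i)"
  shows "\<Lambda> p \<in> paths B \<and> (\<forall>i<k. min_edge B (\<Lambda> p i)) \<and> \<Lambda> p k = edge_succ B (p k) \<and> (\<forall>i>k. \<Lambda> p i = p i)"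
proof -
  let ?P = "\<lambda>q. q \<in> paths B \<and> (\<forall>i<k. min_edge B (q i)) \<and> q k = edge_succ B (p k) \<and> (\<forall>i>k. q i = p i)"
  have pk: "p k \<in> edges B k" using p by (simp add: paths_def)
  note s = edge_succ[OF pk k(1)]
  obtain f where f: "\<forall>i<k. f i \<in> edges B i \<and> min_edge B (f i) \<and>
     rng B (f i) = (if Suc i = k then src B (edge_succ B (p k)) else src B (f (Suc i)))"
    using min_prefix_exists edges_props(1)[OF s(1)] by blast
  define q where "q i = (if i < k then f i else if i = k then edge_succ B (p k) else p i)" for i
  have "q i \<in> edges B i \<and> rng B (q i) = src B (q (Suc i))" for i
  proof -
    consider "i < k" | "i = k" | "k < i" by linarith
    then show ?thesis
    proof cases
      case 1
      then show ?thesis using f s by (auto simp: q_def)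
    qed (use p s in \<open>auto simp: q_def paths_def\<close>)
  qed
  then have "?P q" using f by (auto simp: q_def paths_def)
  then have Pq: "?P q" .
  have uniq: "q' = q" if q': "?P q'" for q'
  proof
    fix i
    show "q' i = q i"
    proof (cases "i < k")
      case True
      show ?thesis
        by (rule min_prefix_unique[of k q' q i]) (use True q' Pq in \<open>auto simp: paths_def\<close>)
    next
      case False
      then show ?thesis using q' by (cases "i = k") (auto simp: q_def)
    qed
  qed
  have "\<exists>!q. ?P q" by (rule ex1I[where P = ?P, OF Pq]) (rule uniq)
  from theI'[OF this] have "?P (THE q. ?P q)" .
  moreover have "(LEAST n. \<not> max_edge B (p n)) = k"
    by (rule Least_equality) (use k not_less in blast)+
  then have "\<Lambda> p = (THE q. ?P q)" using k(1) unfolding vershik_map_def Let_def by auto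
  ultimately show ?thesis by simp
qed

lemma first_nonmax:
  assumes "\<not> high N p"
  obtains k where "k < N" "\<not> max_edge B (p k)" "\<forall>i<k. max_edge B (p i)"
proof -
  have "\<exists>k. k < N \<and> \<not> max_edge B (p k)" using assms by (auto simp: high_def)
  then obtain k where "k < N \<and> \<not> max_edge B (p k)" "\<forall>i<k. \<not> (i < N \<and> \<not> max_edge B (p i))"
    using exists_least_iff[of "\<lambda>k. k < N \<and> \<not> max_edge B (p k)"] by blast
  then show ?thesis using that by auto
qed

lemma high_imp_low:
  assumes p: "p \<in> paths B" and h: "high N p" shows "low N (\<Lambda> p)"
proof (cases "\<forall>n. max_edge B (p n)")
  case True
  then show ?thesis using vershik_max by (simp add: low_def)
next
  case False
  then obtain M where "\<not> high M p" by (auto simp: high_def)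
  then obtain k where k: "\<not> max_edge B (p k)" "\<forall>i<k. max_edge B (p i)" by (rule first_nonmax)
  then have "N \<le> k" using h by (metis high_def not_less)
  then show ?thesis using vershik_step[OF p k] by (auto simp: low_def)
qed

text \<open>A successor edge is never minimal. So away from the top of a tower the Vershik map does not enter
  the base, and it leaves the path beyond level \<open>N\<close> alone.\<close>

lemma not_high_step:
  assumes p: "p \<in> paths B" and h: "\<not> high N p"
  shows "\<not> low N (\<Lambda> p)" "src B (\<Lambda> p N) = src B (p N)"
proof -
  obtain k where k: "k < N" "\<not> max_edge B (p k)" "\<forall>i<k. max_edge B (p i)" using first_nonmax[OF h] .
  note v = vershik_step[OF p k(2,3)]
  have "p k \<in> edges B k" using p by (simp add: paths_def)
  then show "\<not> low N (\<Lambda> p)" using v k edge_succ(3)[of "p k" k] by (auto simp: low_def)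
  show "src B (\<Lambda> p N) = src B (p N)" using v k by simp
qed

lemma prefix_step:
  assumes p: "p \<in> paths B" "q \<in> paths B" and h: "\<not> high N p" and eq: "\<forall>i<N. p i = q i"
  shows "\<forall>i<N. \<Lambda> p i = \<Lambda> q i"
proof -
  obtain k where k: "k < N" "\<not> max_edge B (p k)" "\<forall>i<k. max_edge B (p i)" using first_nonmax[OF h] .
  have kq: "\<not> max_edge B (q k)" "\<forall>i<k. max_edge B (q i)" using k eq by auto
  note v = vershik_step[OF p(1) k(2,3)] vershik_step[OF p(2) kq]
  show ?thesis
  proof (intro allI impI)
    fix i assume i: "i < N"
    show "\<Lambda> p i = \<Lambda> q i"
    proof (cases "i < k")
      case True
      show ?thesis
        by (rule min_prefix_unique[of k "\<Lambda> p" "\<Lambda> q" i]) (use True v eq k in \<open>auto simp: paths_def\<close>)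
    next
      case False
      then show ?thesis using v eq i k by (cases "i = k") auto
    qed
  qed
qed

lemma low_prefix_eq:
  assumes "p \<in> paths B" "q \<in> paths B" "low N p" "low N q" "src B (p N) = src B (q N)"
  shows "\<forall>i<N. p i = q i"
  by (intro allI impI, rule min_prefix_unique[of N p q]) (use assms in \<open>auto simp: low_def paths_def\<close>)

lemma topspace_path_space: "topspace (path_space B) = paths B"
  by (auto simp: path_space_def paths_def PiE_def Pi_def)

lemma openin_prefix:
  assumes "p \<in> paths B" shows "openin (path_space B) {q \<in> paths B. \<forall>i<N. q i = p i}"
proof -
  define U where "U i = (if i < N then {p i} else edges B i)" for i
  have "openin (product_topology (\<lambda>n. discrete_topology (edges B n)) UNIV) (PiE UNIV U)"
  proof (rule product_topology_basis)
    show "finite {i. U i \<noteq> topspace (discrete_topology (edges B i))}"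
      by (rule finite_subset[of _ "{..<N}"]) (auto simp: U_def)
  qed (use assms in \<open>auto simp: U_def paths_def\<close>)
  moreover have "{q \<in> paths B. \<forall>i<N. q i = p i} = PiE UNIV U \<inter> paths B"
    by (auto simp: U_def PiE_def Pi_def paths_def split: if_splits)
  ultimately show ?thesis unfolding path_space_def openin_subtopology by blast
qed

lemma open_contains_prefix:
  assumes W: "openin (path_space B) W" and q: "q \<in> W"
  obtains N where "\<And>p. p \<in> paths B \<Longrightarrow> \<forall>i<N. p i = q i \<Longrightarrow> p \<in> W"
proof -
  obtain T where T: "openin (product_topology (\<lambda>n. discrete_topology (edges B n)) UNIV) T" "W = T \<inter> paths B"
    using W unfolding path_space_def openin_subtopology by blast
  have qT: "q \<in> T" using q T by blast
  from product_topology_open_contains_basis[OF T(1) qT]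
  obtain V where "finite {i. V i \<noteq> topspace (discrete_topology (edges B i))} \<and> q \<in> PiE UNIV V \<and> PiE UNIV V \<subseteq> T"
    by blast
  then have V: "finite {i. V i \<noteq> edges B i}" "q \<in> PiE UNIV V" "PiE UNIV V \<subseteq> T" by simp_all
  define N where "N = Suc (Max (insert 0 {i. V i \<noteq> edges B i}))"
  have N: "i < N" if "V i \<noteq> edges B i" for i
    using that V(1) unfolding N_def by (simp add: less_Suc_eq_le)
  have "p \<in> W" if p: "p \<in> paths B" "\<forall>i<N. p i = q i" for p
  proof -
    have "p i \<in> V i" for i
    proof (cases "V i = edges B i")
      case False
      then show ?thesis using p(2) N V(2) by (metis PiE_mem UNIV_I)
    qed (use p(1) in \<open>simp add: paths_def\<close>)
    then show ?thesis using V(3) T(2) p(1) by (auto simp: PiE_def Pi_def)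
  qed
  then show ?thesis using that by blast
qed

end

locale bratteli_subshift = minimal_subshift A X + bratteli B
  for A :: "'a set" and X :: "(int \<Rightarrow> 'a) set" and B :: "(nat, nat) ordered_bratteli" +
  fixes \<Theta> :: "(int \<Rightarrow> 'a) \<Rightarrow> nat \<Rightarrow> nat"
  assumes homeo: "homeomorphic_map (shift_top A X) (path_space B) \<Theta>"
    and conj: "\<And>x. x \<in> X \<Longrightarrow> \<Theta> (shift x) = vershik_map B (\<Theta> x)"
    and infiniteX: "infinite X"
begin

lemma \<Theta>_image: "\<Theta> ` X = paths B"
  using homeomorphic_imp_surjective_map[OF homeo] topspace_path_space by simp

lemma \<Theta>_paths: "x \<in> X \<Longrightarrow> \<Theta> x \<in> paths B"
  using \<Theta>_image by blast

lemma \<Theta>_surj: "p \<in> paths B \<Longrightarrow> \<exists>x\<in>X. \<Theta> x = p"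
  using \<Theta>_image by (metis imageE)

lemma \<Theta>_inj: "x \<in> X \<Longrightarrow> y \<in> X \<Longrightarrow> \<Theta> x = \<Theta> y \<Longrightarrow> x = y"
  using homeomorphic_imp_injective_map[OF homeo] by (auto simp: inj_on_def)

lemma \<Theta>_sh: "x \<in> X \<Longrightarrow> \<Theta> (sh (t + 1) x) = \<Lambda> (\<Theta> (sh t x))"
proof -
  assume "x \<in> X"
  then have "\<Theta> (sh 1 (sh t x)) = \<Lambda> (\<Theta> (sh t x))" using conj sh_X by (simp flip: shift_eq_sh)
  then show ?thesis by (simp only: sh_sh add.commute)
qed

lemma openin_\<Theta>_prefix: "x \<in> X \<Longrightarrow> openin XT {y \<in> X. \<forall>i<N. \<Theta> y i = \<Theta> x i}"
proof -
  assume x: "x \<in> X"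
  have "continuous_map XT (path_space B) \<Theta>" using homeo homeomorphic_imp_continuous_map by blast
  from openin_continuous_map_preimage[OF this openin_prefix[OF \<Theta>_paths[OF x], of N]]
  have "openin XT {y \<in> X. \<Theta> y \<in> paths B \<and> (\<forall>i<N. \<Theta> y i = \<Theta> x i)}" by simp
  moreover have "{y \<in> X. \<Theta> y \<in> paths B \<and> (\<forall>i<N. \<Theta> y i = \<Theta> x i)} = {y \<in> X. \<forall>i<N. \<Theta> y i = \<Theta> x i}"
    using \<Theta>_paths by blast
  ultimately show ?thesis by simp
qed

lemma \<Theta>_prefix_window:
  assumes x: "x \<in> X"
  obtains N where "\<And>y. y \<in> X \<Longrightarrow> \<forall>i<N. \<Theta> y i = \<Theta> x i \<Longrightarrow> agree w x y"
proof -
  have "open_map XT (path_space B) \<Theta>" using homeo homeomorphic_imp_open_map by blast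
  then have "openin (path_space B) (\<Theta> ` {y \<in> X. agree w x y})" using openin_window by (simp add: open_map_def)
  moreover have "\<Theta> x \<in> \<Theta> ` {y \<in> X. agree w x y}" using x by simp
  ultimately obtain N where N: "\<And>p. p \<in> paths B \<Longrightarrow> \<forall>i<N. p i = \<Theta> x i \<Longrightarrow> p \<in> \<Theta> ` {y \<in> X. agree w x y}"
    by (rule open_contains_prefix) blast
  have "agree w x y" if "y \<in> X" "\<forall>i<N. \<Theta> y i = \<Theta> x i" for y
  proof -
    have "\<Theta> y \<in> \<Theta> ` {y \<in> X. agree w x y}" using N \<Theta>_paths that by blast
    then show ?thesis using \<Theta>_inj that(1) by blast
  qed
  then show ?thesis using that by blast
qed

lemma uniform_prefix:
  assumes "\<And>x. x \<in> X \<Longrightarrow> \<exists>n. \<forall>z\<in>X. (\<forall>i<n. \<Theta> z i = \<Theta> x i) \<longrightarrow> Q n z"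
    and "\<And>n m z. Q n z \<Longrightarrow> n \<le> m \<Longrightarrow> Q m z"
  shows "\<exists>n. \<forall>z\<in>X. Q n z"
proof -
  have "\<exists>n. \<forall>z\<in>topspace XT. Q n z"
  proof (rule compact_uniform[OF compact_XT])
    fix x assume x: "x \<in> topspace XT"
    then have "x \<in> X" by simp
    from assms(1)[OF this] obtain n where "\<forall>z\<in>X. (\<forall>i<n. \<Theta> z i = \<Theta> x i) \<longrightarrow> Q n z" ..
    then show "\<exists>U n. openin XT U \<and> x \<in> U \<and> (\<forall>z\<in>U. Q n z)"
      using x openin_\<Theta>_prefix[of x n]
      by (intro exI[of _ "{y \<in> X. \<forall>i<n. \<Theta> y i = \<Theta> x i}"] exI[of _ n]) auto
  qed (use assms(2) in blast)
  then show ?thesis by simp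
qed

lemma symbol_from_prefix:
  obtains N where "\<And>x y. x \<in> X \<Longrightarrow> y \<in> X \<Longrightarrow> \<forall>i<N. \<Theta> y i = \<Theta> x i \<Longrightarrow> y 0 = x 0"
proof -
  have "\<exists>n. \<forall>z\<in>X. \<forall>y\<in>X. (\<forall>i<n. \<Theta> y i = \<Theta> z i) \<longrightarrow> y 0 = z 0"
  proof (rule uniform_prefix)
    fix x assume x: "x \<in> X"
    obtain N where N: "\<And>y. y \<in> X \<Longrightarrow> \<forall>i<N. \<Theta> y i = \<Theta> x i \<Longrightarrow> agree 0 x y"
      using \<Theta>_prefix_window[OF x, of 0] by blast
    have "y 0 = z 0" if "z \<in> X" "\<forall>i<N. \<Theta> z i = \<Theta> x i" "y \<in> X" "\<forall>i<N. \<Theta> y i = \<Theta> z i" for y z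
      using N[of y] N[of z] that by (simp add: agree_def)
    then show "\<exists>n. \<forall>z\<in>X. (\<forall>i<n. \<Theta> z i = \<Theta> x i) \<longrightarrow> (\<forall>y\<in>X. (\<forall>i<n. \<Theta> y i = \<Theta> z i) \<longrightarrow> y 0 = z 0)"
      by blast
  qed (meson less_le_trans)
  then show ?thesis using that by blast
qed

lemma bottom_point:
  obtains y0 where "y0 \<in> X" "\<And>n. low n (\<Theta> y0)" "\<And>x. x \<in> X \<Longrightarrow> (\<And>n. low n (\<Theta> x)) \<Longrightarrow> x = y0"
proof -
  have ex: "\<exists>!q. q \<in> paths B \<and> (\<forall>n. min_edge B (q n))" using proper by (simp add: properly_ordered_def)
  then obtain q where q: "q \<in> paths B" "\<forall>n. min_edge B (q n)" by blast
  obtain y0 where y0: "y0 \<in> X" "\<Theta> y0 = q" using \<Theta>_surj q by blast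
  have "x = y0" if x: "x \<in> X" "\<And>n. low n (\<Theta> x)" for x
  proof -
    have "\<forall>n. min_edge B (\<Theta> x n)" using x(2) unfolding low_def by blast
    then have "\<Theta> x = q" using ex q \<Theta>_paths[OF x(1)] by blast
    then show ?thesis using \<Theta>_inj x y0 by blast
  qed
  moreover have "low n (\<Theta> y0)" for n using y0 q by (simp add: low_def)
  ultimately show ?thesis using that y0 by blast
qed

text \<open>The bases shrink to the unique minimal path, which is not periodic under the shift. A point near it
  therefore stays away from it for a long time.\<close>

lemma long_return:
  obtains N where "\<And>n x t. N \<le> n \<Longrightarrow> x \<in> X \<Longrightarrow> low n (\<Theta> x) \<Longrightarrow> 0 < t \<Longrightarrow> t \<le> int h \<Longrightarrow> \<not> low n (\<Theta> (sh t x))"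
proof -
  obtain y0 where y0: "y0 \<in> X" "\<And>n. low n (\<Theta> y0)" "\<And>x. x \<in> X \<Longrightarrow> (\<And>n. low n (\<Theta> x)) \<Longrightarrow> x = y0"
    by (rule bottom_point) blast
  have "\<exists>w. \<not> agree w y0 (sh t y0)" if "0 < t" for t
    using finite_if_periodic[OF y0(1) _ that] infiniteX eq_if_agree[of y0 "sh t y0"] by metis
  then obtain ww where ww: "\<And>t. 0 < t \<Longrightarrow> \<not> agree (ww t) y0 (sh t y0)" by metis
  define w where "w = Max (insert 0 (ww ` {0<..int h}))"
  have w: "\<not> agree w y0 (sh t y0)" if "0 < t" "t \<le> int h" for t
  proof -
    have "ww t \<le> w" unfolding w_def using that by (intro Max_ge) auto
    then show ?thesis using ww[OF that(1)] agree_mono by blast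
  qed
  have "\<exists>n. \<forall>z\<in>X. low n (\<Theta> z) \<longrightarrow> agree (w + h) y0 z"
  proof (rule uniform_prefix)
    fix x assume x: "x \<in> X"
    show "\<exists>n. \<forall>z\<in>X. (\<forall>i<n. \<Theta> z i = \<Theta> x i) \<longrightarrow> low n (\<Theta> z) \<longrightarrow> agree (w + h) y0 z"
    proof (cases "x = y0")
      case True
      then show ?thesis using \<Theta>_prefix_window[OF y0(1), of "w + h"] by metis
    next
      case False
      then obtain n where "\<not> low n (\<Theta> x)" using y0(3) x by blast
      then have "\<forall>z\<in>X. (\<forall>i<n. \<Theta> z i = \<Theta> x i) \<longrightarrow> \<not> low n (\<Theta> z)" by (auto simp: low_def)
      then show ?thesis by blast
    qed
  qed (simp add: low_def)
  then obtain N where N: "\<And>z. z \<in> X \<Longrightarrow> low N (\<Theta> z) \<Longrightarrow> agree (w + h) y0 z" by blast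
  have "\<not> low n (\<Theta> (sh t x))" if n: "N \<le> n" and x: "x \<in> X" "low n (\<Theta> x)" and t: "0 < t" "t \<le> int h" for n x t
  proof
    assume l: "low n (\<Theta> (sh t x))"
    have lowN: "low n p \<Longrightarrow> low N p" for p using n by (auto simp: low_def)
    have 1: "agree w y0 (sh t x)" using N[OF sh_X[OF x(1)] lowN[OF l]] agree_mono by force
    have "agree w (sh t y0) (sh t x)" by (rule agree_sh[OF N[OF x(1) lowN[OF x(2)]]]) (use t in auto)
    then have "agree w y0 (sh t y0)" using 1 agree_sym agree_trans by blast
    then show False using w t by blast
  qed
  then show ?thesis using that by blast
qed

text \<open>Starting from the base, the first \<open>N\<close> edges evolve in a way that depends on the vertex at level \<open>N\<close>
  only, until the top is reached. If \<open>N\<close> is large these edges also determine the symbol at \<open>0\<close>; so the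
  vertex determines the whole block.\<close>

lemma towers_at_level:
  assumes sym: "\<And>x y. x \<in> X \<Longrightarrow> y \<in> X \<Longrightarrow> \<forall>i<N. \<Theta> y i = \<Theta> x i \<Longrightarrow> y 0 = x 0"
    and long: "\<And>x t. x \<in> X \<Longrightarrow> low N (\<Theta> x) \<Longrightarrow> 0 < t \<Longrightarrow> t \<le> h \<Longrightarrow> \<not> low N (\<Theta> (sh t x))"
    and K: "card (verts B N) \<le> K"
  shows "towers K h"
proof -
  define C where "C = {x \<in> X. low N (\<Theta> x)}"
  define v where "v x = src B (\<Theta> x N)" for x
  define V where "V = v ` C"
  obtain y0 where y0: "y0 \<in> X" "\<And>n. low n (\<Theta> y0)" by (rule bottom_point) blast
  have "y0 \<in> {y \<in> X. \<forall>i<N. \<Theta> y i = \<Theta> y0 i}" using y0(1) by simp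
  from openin_XT_D[OF openin_\<Theta>_prefix[OF y0(1)] this]
  obtain w where w': "\<And>y. y \<in> X \<Longrightarrow> agree w y0 y \<Longrightarrow> y \<in> {y \<in> X. \<forall>i<N. \<Theta> y i = \<Theta> y0 i}" by blast
  have w: "\<forall>i<N. \<Theta> y i = \<Theta> y0 i" if "y \<in> X" "agree w y0 y" for y using w'[OF that] by simp
  have wC: "y \<in> C" if "y \<in> X" "agree w y0 y" for y
    using w[OF that] y0(2)[of N] that(1) by (simp add: C_def low_def)
  obtain M where M: "\<And>x. x \<in> X \<Longrightarrow> \<exists>t. 0 \<le> t \<and> t \<le> int M \<and> agree w y0 (sh t x)"
    using syndetic[OF y0(1), of w] by blast
  have past: "\<exists>t\<le>0. sh t x \<in> C" if x: "x \<in> X" for x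
  proof -
    obtain t where "0 \<le> t" "t \<le> int M" "agree w y0 (sh t (sh (- int M) x))" using M[OF sh_X[OF x]] by blast
    then show ?thesis using wC sh_X x by (intro exI[of _ "t - int M"]) auto
  qed
  have future: "\<exists>n>0. sh (int n) x \<in> C" if x: "x \<in> X" for x
  proof -
    obtain t where "0 \<le> t" "agree w y0 (sh t (sh 1 x))" using M[OF sh_X[OF x, of 1]] by blast
    then show ?thesis using wC[OF sh_X[OF x]] by (intro exI[of _ "nat (t + 1)"]) auto
  qed
  define \<rho> where "\<rho> x = (LEAST n. 0 < n \<and> sh (int n) x \<in> C)" for x
  have \<rho>: "0 < \<rho> x" "sh (int (\<rho> x)) x \<in> C" if "x \<in> X" for x
    using LeastI_ex[OF future[OF that]] by (auto simp: \<rho>_def)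
  have \<rho>_first: "sh (int n) x \<notin> C" if "0 < n" "n < \<rho> x" for n x
    using not_less_Least[of n "\<lambda>n. 0 < n \<and> sh (int n) x \<in> C"] that by (auto simp: \<rho>_def)
  have vV: "v y \<in> verts B N" if "y \<in> X" for y
    using edges_props(1) \<Theta>_paths[OF that] by (simp add: v_def paths_def)
  have CX: "y \<in> X" if "y \<in> C" for y using that by (simp add: C_def)
  \<comment> \<open>As long as no base is hit, two points over the same vertex climb the tower in parallel.\<close>
  have key: "(\<forall>i<N. \<Theta> (sh (int n) y) i = \<Theta> (sh (int n) z) i)"
    if y: "y \<in> C" and z: "z \<in> C" and vv: "v y = v z" and n: "\<forall>m. 0 < m \<and> m \<le> n \<longrightarrow> sh (int m) y \<notin> C" for y z n
    using n
  proof (induction n)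
    case 0
    show ?case
      using low_prefix_eq[of "\<Theta> y" "\<Theta> z" N] y z vv \<Theta>_paths by (simp add: C_def v_def)
  next
    case (Suc n)
    have p: "\<Theta> (sh (int n) y) \<in> paths B" "\<Theta> (sh (int n) z) \<in> paths B" using \<Theta>_paths sh_X CX y z by auto
    have "\<forall>m. 0 < m \<and> m \<le> n \<longrightarrow> sh (int m) y \<notin> C" using Suc.prems le_SucI by blast
    then have IH: "\<forall>i<N. \<Theta> (sh (int n) y) i = \<Theta> (sh (int n) z) i" by (rule Suc.IH)
    have "sh (int (Suc n)) y \<notin> C" using Suc.prems by blast
    then have "\<not> low N (\<Theta> (sh (int n + 1) y))" using sh_X[OF CX[OF y]] by (simp add: C_def add.commute)
    then have "\<not> low N (\<Lambda> (\<Theta> (sh (int n) y)))" using \<Theta>_sh CX y by simp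
    then have "\<not> high N (\<Theta> (sh (int n) y))" using high_imp_low p by blast
    from prefix_step[OF p this IH] show ?case
      using \<Theta>_sh[OF CX[OF y], of "int n"] \<Theta>_sh[OF CX[OF z], of "int n"] by (simp add: add.commute)
  qed
  have hl: "sh (int n + 1) x \<in> C \<longleftrightarrow> high N (\<Theta> (sh (int n) x))" if x: "x \<in> X" for x n
    using high_imp_low[OF \<Theta>_paths[OF sh_X[OF x]]] not_high_step(1)[OF \<Theta>_paths[OF sh_X[OF x]]]
      \<Theta>_sh[OF x, of "int n"] sh_X[OF x] by (auto simp: C_def)
  have \<rho>_le: "\<rho> z \<le> \<rho> y" if y: "y \<in> C" and z: "z \<in> C" and vv: "v y = v z" for y z
  proof -
    obtain n where n: "\<rho> y = Suc n" using \<rho>(1)[OF CX[OF y]] gr0_implies_Suc by blast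
    have "\<forall>i<N. \<Theta> (sh (int n) y) i = \<Theta> (sh (int n) z) i"
      by (rule key[OF y z vv]) (use \<rho>_first n in auto)
    moreover have "high N (\<Theta> (sh (int n) y))"
      using hl[OF CX[OF y], of n] \<rho>(2)[OF CX[OF y]] n by (simp add: add.commute)
    ultimately have "high N (\<Theta> (sh (int n) z))" by (simp add: high_def)
    then have "sh (int (Suc n)) z \<in> C" using hl[OF CX[OF z], of n] by (simp add: add.commute)
    then show ?thesis unfolding n by (subst \<rho>_def) (rule Least_le, simp)
  qed
  have \<rho>_eq: "\<rho> y = \<rho> z" if "y \<in> C" "z \<in> C" "v y = v z" for y z
    using \<rho>_le[of y z] \<rho>_le[of z y] that by simp
  \<comment> \<open>The return time is a function of the label, so any point with that label may be chosen.\<close>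
  define H where "H u = int (\<rho> (SOME y. y \<in> C \<and> v y = u))" for u
  have H: "H (v y) = int (\<rho> y)" if y: "y \<in> C" for y
  proof -
    let ?z = "SOME z. z \<in> C \<and> v z = v y"
    have "?z \<in> C \<and> v ?z = v y" by (rule someI[of "\<lambda>z. z \<in> C \<and> v z = v y" y]) (use y in simp)
    then have "\<rho> ?z = \<rho> y" using \<rho>_eq[of ?z y] y by simp
    then show ?thesis by (simp only: H_def)
  qed
  have finV: "finite (verts B N)" using diagram by (simp add: bratteli_diagram_def)
  have sub: "V \<subseteq> verts B N" using vV CX by (auto simp: V_def)
  have "finite V" using sub finV finite_subset by blast
  moreover have "card V \<le> K" using card_mono[OF finV sub] K by simp
  moreover have "h \<le> H u" if u: "u \<in> V" for u
  proof -
    obtain y where y: "y \<in> C" "u = v y" using u by (auto simp: V_def)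
    have "\<not> int (\<rho> y) \<le> h"
      using long[of y "int (\<rho> y)"] y(1) \<rho>[OF CX[OF y(1)]] by (auto simp: C_def)
    then show ?thesis using H[OF y(1)] y(2) by simp
  qed
  moreover have "v y \<in> V" if "y \<in> X \<inter> C" for y using that by (simp add: V_def)
  moreover have "sh (H (v y)) y \<in> C \<and> (\<forall>t. 0 < t \<and> t < H (v y) \<longrightarrow> sh t y \<notin> C)" if y: "y \<in> X \<inter> C" for y
  proof -
    have "sh t y \<notin> C" if "0 < t" "t < int (\<rho> y)" for t using \<rho>_first[of "nat t" y] that by simp
    then show ?thesis using H \<rho>(2) y by auto
  qed
  moreover have "y t = z t" if y: "y \<in> X \<inter> C" and z: "z \<in> X \<inter> C" and vv: "v y = v z" and t: "0 \<le> t" "t < H (v y)" for y z t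
  proof -
    have "nat t < \<rho> y" using t H[of y] y by simp
    then have "\<forall>m. 0 < m \<and> m \<le> nat t \<longrightarrow> sh (int m) y \<notin> C" using \<rho>_first[of _ y] by simp
    then have "\<forall>i<N. \<Theta> (sh (int (nat t)) y) i = \<Theta> (sh (int (nat t)) z) i"
      using key[OF _ _ vv] y z by blast
    then have "sh t y 0 = sh t z 0" using sym[of "sh t z" "sh t y"] y z t sh_X by auto
    then show ?thesis by (simp add: sh_apply)
  qed
  ultimately show ?thesis unfolding towers_def using past by (intro exI[of _ C] exI[of _ v] exI[of _ V] exI[of _ H]) blast
qed

lemma towers:
  assumes rank: "bratteli_rank B < \<infinity>"
  shows "\<exists>K. \<forall>h. towers K h"
proof -
  obtain K where K: "bratteli_rank B = enat K" using rank by (cases "bratteli_rank B") auto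
  have inf: "\<exists>n\<ge>N. card (verts B n) \<le> K" for N
  proof (rule ccontr)
    assume "\<not> ?thesis"
    then have "K < card (verts B n)" if "N \<le> n" for n using that not_le by blast
    then have "\<forall>n\<ge>N. enat (Suc K) \<le> enat (card (verts B n))" by (simp add: Suc_le_eq)
    then have "enat (Suc K) \<le> liminf (\<lambda>n. enat (card (verts B n)))"
      by (intro Liminf_bounded) (auto simp: eventually_sequentially)
    then show False using K by (simp add: bratteli_rank_def)
  qed
  have "towers K h" for h
  proof -
    obtain N0 where N0: "\<And>x y. x \<in> X \<Longrightarrow> y \<in> X \<Longrightarrow> \<forall>i<N0. \<Theta> y i = \<Theta> x i \<Longrightarrow> y 0 = x 0"
      using symbol_from_prefix by blast
    obtain N1 where N1: "\<And>n x t. N1 \<le> n \<Longrightarrow> x \<in> X \<Longrightarrow> low n (\<Theta> x) \<Longrightarrow> 0 < t \<Longrightarrow> t \<le> int (nat h) \<Longrightarrow> \<not> low n (\<Theta> (sh t x))"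
      using long_return[of "nat h"] by blast
    obtain N where N: "max N0 N1 \<le> N" "card (verts B N) \<le> K" using inf by blast
    show ?thesis
    proof (rule towers_at_level[OF _ _ N(2)])
      show "y 0 = x 0" if "x \<in> X" "y \<in> X" "\<forall>i<N. \<Theta> y i = \<Theta> x i" for x y using N0[of x y] N that by auto
      show "\<not> low N (\<Theta> (sh t x))" if "x \<in> X" "low N (\<Theta> x)" "0 < t" "t \<le> h" for x t
        using N1[of N x t] N that by auto
    qed
  qed
  then show ?thesis by blast
qed

end

lemma minimal_cantor_imp:
  assumes sub: "subshift A X" and min: "minimal_cantor_system (shift_top A X) shift"
  shows "minimal_subshift A X" "infinite X"
proof -
  interpret subshift_space A X by unfold_locales (rule sub)
  have "XT homeomorphic_space product_topology (\<lambda>_::nat. discrete_topology (UNIV :: bool set)) UNIV"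
    using min by (simp add: minimal_cantor_system_def cantor_space_def)
  then obtain f where "homeomorphic_map XT (product_topology (\<lambda>_::nat. discrete_topology (UNIV :: bool set)) UNIV) f"
    unfolding homeomorphic_space by blast
  from homeomorphic_imp_surjective_map[OF this] have fX: "f ` X = UNIV" by (simp add: PiE_UNIV_domain)
  have "infinite (UNIV :: (nat \<Rightarrow> bool) set)"
  proof
    assume "finite (UNIV :: (nat \<Rightarrow> bool) set)"
    then have "finite (UNIV :: nat set)" by (rule finite_fun_UNIVD1) simp
    then show False by simp
  qed
  then show inf: "infinite X" using fX by (metis finite_imageI)
  show "minimal_subshift A X"
  proof
    show "X \<noteq> {}" using inf by auto
  next
    fix x y w assume x: "x \<in> X" and y: "y \<in> X"
    define C where "C = {z \<in> X. \<forall>w. \<exists>t. agree w z (sh t x)}"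
    have CX: "C \<subseteq> X" by (auto simp: C_def)
    have "openin XT (X - C)"
      unfolding openin_XT_iff
    proof (intro conjI ballI)
      fix z assume "z \<in> X - C"
      then obtain w where w: "\<And>t. \<not> agree w z (sh t x)" by (auto simp: C_def)
      have "u \<in> X - C" if "u \<in> X" "agree w z u" for u
      proof -
        have "u \<notin> C"
        proof
          assume "u \<in> C"
          then obtain t where "agree w u (sh t x)" by (auto simp: C_def)
          then show False using w agree_trans[OF that(2)] by blast
        qed
        then show ?thesis using that by blast
      qed
      then show "\<exists>w. \<forall>u\<in>X. agree w z u \<longrightarrow> u \<in> X - C" by blast
    qed simp
    then have cl: "closedin XT C" using CX by (simp add: closedin_def)
    have shX: "sh s z \<in> C" if zC: "z \<in> C" for s z
    proof -
      have "\<exists>t. agree w (sh s z) (sh t x)" for w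
      proof -
        obtain t where "agree (w + nat \<bar>s\<bar>) z (sh t x)" using zC by (auto simp: C_def)
        then have "agree w (sh s z) (sh s (sh t x))" by (rule agree_sh) simp
        then show ?thesis by auto
      qed
      then show ?thesis using that sh_X by (auto simp: C_def)
    qed
    have "shift ` C = C" using shX by (rule shift_image_eq)
    then have "C = {} \<or> C = X" using min cl by (simp add: minimal_cantor_system_def)
    moreover have "x \<in> C"
    proof -
      have "agree w x (sh 0 x)" for w by simp
      then show ?thesis using x unfolding C_def by blast
    qed
    ultimately have "y \<in> C" using y by blast
    then show "\<exists>t. agree w y (sh t x)" by (simp add: C_def)
  qed
qed

theorem finite_rank_towers:
  assumes sub: "subshift A X" and rank: "finite_topological_rank (shift_top A X) shift"
  shows "minimal_subshift A X" "infinite X" "\<exists>K. \<forall>h. subshift_space.towers X K h"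
proof -
  have mc: "minimal_cantor_system (shift_top A X) shift" using rank by (simp add: finite_topological_rank_def)
  show m: "minimal_subshift A X" and inf: "infinite X" using minimal_cantor_imp[OF sub mc] by auto
  interpret minimal_subshift A X by (rule m)
  obtain B :: "(nat, nat) ordered_bratteli" and \<Theta> where B: "properly_ordered B" "bratteli_rank B < \<infinity>"
    and \<Theta>: "homeomorphic_map XT (path_space B) \<Theta>" "\<forall>x\<in>X. \<Theta> (shift x) = vershik_map B (\<Theta> x)"
    using rank unfolding finite_topological_rank_def conjugate_systems_def topspace_XT by blast
  interpret bratteli_subshift A X B \<Theta>
    by unfold_locales (use B \<Theta> inf in auto)
  show "\<exists>K. \<forall>h. towers K h" by (rule towers[OF B(2)])
qed

section \<open>Commutative groups that are virtually infinite cyclic\<close>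

context group
begin

lemma int_pow_period:
  assumes "r \<in> carrier G" "r [^] (m::nat) = \<one>"
  shows "r [^] (c mod int m) = r [^] (c::int)"
proof -
  have "r [^] (int m * (c div int m)) = (r [^] int m) [^] (c div int m)"
    using assms(1) by (simp add: int_pow_pow)
  then have one: "r [^] (int m * (c div int m)) = \<one>" using assms(2) by (simp add: int_pow_int)
  have "r [^] c = r [^] (int m * (c div int m) + c mod int m)" by simp
  also have "\<dots> = r [^] (int m * (c div int m)) \<otimes> r [^] (c mod int m)" by (rule int_pow_mult[OF assms(1)])
  also have "\<dots> = r [^] (c mod int m)" using one assms(1) by simp
  finally show ?thesis by simp
qed

lemma order_of_generator:
  assumes r: "r \<in> carrier G" and tor: "0 < n" "r [^] (n::nat) = \<one>"
  obtains m :: nat where "0 < m" "r [^] m = \<one>" "\<And>c::int. r [^] c = \<one> \<Longrightarrow> int m dvd c"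
proof -
  define m where "m = (LEAST n. 0 < n \<and> r [^] (n::nat) = \<one>)"
  have m: "0 < m \<and> r [^] m = \<one>" unfolding m_def by (rule LeastI[of _ n]) (use tor in simp)
  have least: "m \<le> j" if "0 < j" "r [^] j = \<one>" for j :: nat unfolding m_def by (rule Least_le) (use that in simp)
  have "int m dvd c" if "r [^] c = \<one>" for c :: int
  proof (rule ccontr)
    assume "\<not> int m dvd c"
    then have pos: "0 < c mod int m" using m by (metis dvd_eq_mod_eq_0 of_nat_0_less_iff order_le_less pos_mod_sign)
    have "r [^] (c mod int m) = \<one>" using int_pow_period[OF r conjunct2[OF m]] that by simp
    moreover have "int (nat (c mod int m)) = c mod int m" using pos by linarith
    ultimately have "r [^] int (nat (c mod int m)) = \<one>" by (simp only:)
    then have "r [^] nat (c mod int m) = \<one>" by (simp only: int_pow_int)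
    then have "m \<le> nat (c mod int m)" using pos by (intro least) simp_all
    moreover have "c mod int m < int m" using m by simp
    ultimately show False using pos by linarith
  qed
  then show ?thesis using that m by blast
qed

end

context comm_group
begin

lemma iso_integer_times_cyclic:
  assumes s: "s \<in> carrier G" and r: "r \<in> carrier G"
    and m: "0 < m" "r [^] (m::nat) = \<one>"
    and gen: "\<And>x. x \<in> carrier G \<Longrightarrow> \<exists>(k::int) (c::int). x = s [^] k \<otimes> r [^] c"
    and indep: "\<And>(k::int) (c::int). s [^] k \<otimes> r [^] c = \<one> \<Longrightarrow> k = 0 \<and> int m dvd c"
  shows "G \<cong> integer_group \<times>\<times> integer_mod_group m"
proof -
  define h where "h = (\<lambda>(k::int, c::int). s [^] k \<otimes> r [^] c)"
  let ?P = "integer_group \<times>\<times> integer_mod_group m"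
  have cP: "carrier ?P = UNIV \<times> {0..<int m}" using m by (simp add: DirProd_def carrier_integer_mod_group)
  have comm_pow: "r [^] (c::int) \<otimes> s [^] (k::int) = s [^] k \<otimes> r [^] c" for c k
    using s r by (simp add: m_comm)
  have mult: "(s [^] k \<otimes> r [^] c) \<otimes> (s [^] k' \<otimes> r [^] c') = s [^] (k + k') \<otimes> r [^] (c + c')" for k k' c c' :: int
  proof -
    have cl: "s [^] k \<in> carrier G" "s [^] k' \<in> carrier G" "r [^] c \<in> carrier G" "r [^] c' \<in> carrier G"
      using s r by auto
    have "(s [^] k \<otimes> r [^] c) \<otimes> (s [^] k' \<otimes> r [^] c') = s [^] k \<otimes> ((r [^] c \<otimes> s [^] k') \<otimes> r [^] c')"
      using cl by (simp add: m_assoc)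
    also have "\<dots> = (s [^] k \<otimes> s [^] k') \<otimes> (r [^] c \<otimes> r [^] c')"
      unfolding comm_pow using cl by (simp add: m_assoc)
    finally show ?thesis using s r by (simp add: int_pow_mult)
  qed
  have hom: "h \<in> hom ?P G"
  proof (rule homI)
    fix x assume "x \<in> carrier ?P"
    then show "h x \<in> carrier G" using s r by (auto simp: h_def split: prod.split)
  next
    fix x y assume xy: "x \<in> carrier ?P" "y \<in> carrier ?P"
    obtain k c k' c' where e: "x = (k, c)" "y = (k', c')" by (metis surj_pair)
    have "h (x \<otimes>\<^bsub>?P\<^esub> y) = s [^] (k + k') \<otimes> r [^] ((c + c') mod int m)"
      using e by (simp add: h_def DirProd_def)
    also have "\<dots> = h x \<otimes> h y" using mult e by (simp add: h_def int_pow_period[OF r m(2)])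
    finally show "h (x \<otimes>\<^bsub>?P\<^esub> y) = h x \<otimes> h y" .
  qed
  have "inj_on h (carrier ?P)"
  proof (rule inj_onI)
    fix x y assume xy: "x \<in> carrier ?P" "y \<in> carrier ?P" and eq: "h x = h y"
    obtain k c k' c' where e: "x = (k, c)" "y = (k', c')" by (metis surj_pair)
    have e0: "(s [^] k' \<otimes> r [^] c') \<otimes> (s [^] (-k') \<otimes> r [^] (-c')) = \<one>"
      using mult[of k' c' "-k'" "-c'"] s r by simp
    have "s [^] (k - k') \<otimes> r [^] (c - c') = (s [^] k \<otimes> r [^] c) \<otimes> (s [^] (-k') \<otimes> r [^] (-c'))"
      using mult[of k c "-k'" "-c'"] by simp
    also have "\<dots> = \<one>" using eq e e0 by (simp add: h_def)
    finally have d: "k - k' = 0" "int m dvd c - c'" using indep by blast+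
    have "c \<in> {0..<int m}" "c' \<in> {0..<int m}" using xy unfolding e cP by simp_all
    then have "\<bar>c - c'\<bar> < int m" by auto
    then have "c = c'" using d(2) zdvd_imp_le[of "int m" "\<bar>c - c'\<bar>"] by (cases "c = c'") auto
    then show "x = y" using d e by simp
  qed
  moreover have "h ` carrier ?P = carrier G"
  proof
    show "h ` carrier ?P \<subseteq> carrier G" using hom by (auto simp: hom_def)
    show "carrier G \<subseteq> h ` carrier ?P"
    proof
      fix x assume "x \<in> carrier G"
      then obtain k c :: int where x: "x = s [^] k \<otimes> r [^] c" using gen by blast
      have "x = h (k, c mod int m)" using x by (simp add: h_def int_pow_period[OF r m(2)])
      moreover have "(k, c mod int m) \<in> carrier ?P" using m cP by simp
      ultimately show "x \<in> h ` carrier ?P" by blast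
    qed
  qed
  ultimately have "h \<in> iso ?P G" using hom by (simp add: iso_def bij_betw_def)
  then have "?P \<cong> G" by (auto simp: is_iso_def)
  moreover have "group ?P" by (simp add: DirProd_group)
  ultimately show ?thesis by (rule group.iso_sym[rotated])
qed

definition torsion :: "'a set" where
  "torsion = {f \<in> carrier G. \<exists>n::nat. 0 < n \<and> f [^] n = \<one>}"

lemma torsion_mult:
  assumes "f \<in> torsion" "g \<in> torsion" shows "f \<otimes> g \<in> torsion"
proof -
  obtain a b :: nat where ab: "0 < a" "f [^] a = \<one>" "0 < b" "g [^] b = \<one>" and fg: "f \<in> carrier G" "g \<in> carrier G"
    using assms by (auto simp: torsion_def)
  have "f [^] (a * b) = (f [^] a) [^] b" "g [^] (a * b) = (g [^] b) [^] a"
    using fg by (simp_all add: nat_pow_pow mult.commute)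
  then have "f [^] (a * b) = \<one>" "g [^] (a * b) = \<one>" using ab by (simp_all only: nat_pow_one)
  then have "(f \<otimes> g) [^] (a * b) = \<one>" using fg by (simp add: nat_pow_distrib)
  then show ?thesis using ab fg unfolding torsion_def by (auto intro!: exI[of _ "a * b"])
qed

lemma torsion_int_pow:
  assumes "f \<in> torsion" shows "f [^] (k::int) \<in> torsion"
proof -
  obtain a :: nat where a: "0 < a" "f [^] a = \<one>" and f: "f \<in> carrier G" using assms by (auto simp: torsion_def)
  have "(f [^] k) [^] int a = (f [^] int a) [^] k" using f by (simp add: int_pow_pow mult.commute)
  then have "(f [^] k) [^] a = \<one>" using a f by (simp add: int_pow_int)
  then show ?thesis using a f by (auto simp: torsion_def)
qed

text \<open>The map \<open>\<rho>\<close> is a homomorphism into the integers modulo \<open>e\<close> that is injective on the torsion subgroup.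
  As in Euclid's algorithm, an element with the least positive residue generates.\<close>

lemma cyclic_torsion:
  assumes fin: "finite torsion" and e: "0 < e"
    and hom: "\<And>f g. f \<in> carrier G \<Longrightarrow> g \<in> carrier G \<Longrightarrow> e dvd \<rho> (f \<otimes> g) - (\<rho> f + \<rho> g :: int)"
    and sep: "\<And>f. f \<in> torsion \<Longrightarrow> e dvd \<rho> f \<Longrightarrow> f = \<one>"
  obtains r where "r \<in> torsion" "\<And>f. f \<in> torsion \<Longrightarrow> \<exists>c::int. f = r [^] c"
proof (cases "torsion - {\<one>} = {}")
  case True
  have one: "\<one> \<in> torsion" by (auto simp: torsion_def intro: exI[of _ "1::nat"])
  show ?thesis
  proof (rule that[OF one])
    fix f assume "f \<in> torsion"
    then have "f = \<one> [^] (0::int)" using True by auto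
    then show "\<exists>c::int. f = \<one> [^] c" ..
  qed
next
  case False
  have "finite (torsion - {\<one>})" using fin by simp
  then have fin': "finite ((\<lambda>f. \<rho> f mod e) ` (torsion - {\<one>}))" by simp
  then have "Min ((\<lambda>f. \<rho> f mod e) ` (torsion - {\<one>})) \<in> (\<lambda>f. \<rho> f mod e) ` (torsion - {\<one>})"
    using False by (intro Min_in) auto
  then obtain r where r: "r \<in> torsion - {\<one>}"
    and rM: "\<rho> r mod e = Min ((\<lambda>f. \<rho> f mod e) ` (torsion - {\<one>}))" by (elim imageE) simp
  have rmin: "\<rho> r mod e \<le> \<rho> f mod e" if "f \<in> torsion - {\<one>}" for f
    unfolding rM using fin' that by (intro Min_le) auto
  have rG: "r \<in> carrier G" using r by (simp add: torsion_def)
  define b where "b = \<rho> r mod e"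
  have "\<not> e dvd \<rho> r" using sep r by blast
  then have b0: "0 < b" using e by (simp add: b_def dvd_eq_mod_eq_0 order_less_le)
  have powhom: "e dvd \<rho> (r [^] (k::int)) - k * \<rho> r" for k
  proof -
    have one: "e dvd \<rho> \<one>" using hom[of \<one> \<one>] by simp
    have inv: "e dvd \<rho> (inv x) + \<rho> x" if "x \<in> carrier G" for x
    proof -
      have "e dvd \<rho> \<one> - (\<rho> x + \<rho> (inv x))" using hom[of x "inv x"] that by simp
      from dvd_diff[OF one this] show ?thesis by (simp add: add.commute)
    qed
    have np: "e dvd \<rho> (r [^] n) - int n * \<rho> r" for n :: nat
    proof (induction n)
      case (Suc n)
      have "e dvd \<rho> (r [^] n \<otimes> r) - (\<rho> (r [^] n) + \<rho> r)" using rG by (intro hom) auto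
      from dvd_add[OF this Suc] show ?case by (simp add: algebra_simps)
    qed (use one in simp)
    show ?thesis
    proof (cases "0 \<le> k")
      case True
      then obtain n where k: "k = int n" by (rule nonneg_int_cases)
      show ?thesis unfolding k int_pow_int by (rule np)
    next
      case False
      then obtain n where k: "k = - int n" by (metis int_cases not_le of_nat_0_le_iff order_less_imp_le)
      have "e dvd \<rho> (inv (r [^] n)) + \<rho> (r [^] n)" using rG by (intro inv) auto
      from dvd_diff[OF this np[of n]] have "e dvd \<rho> (inv (r [^] n)) + int n * \<rho> r" by (simp add: algebra_simps)
      moreover have "r [^] k = inv (r [^] n)" unfolding k int_pow_neg[OF rG] int_pow_int ..
      ultimately show ?thesis by (simp add: k)
    qed
  qed
  have "\<exists>c::int. f = r [^] c" if f: "f \<in> torsion" for f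
  proof -
    define q where "q = (\<rho> f mod e) div b"
    define g where "g = f \<otimes> r [^] (-q)"
    have g: "g \<in> torsion" unfolding g_def using f r torsion_int_pow by (intro torsion_mult) auto
    have fG: "f \<in> carrier G" using f by (simp add: torsion_def)
    have D1: "e dvd \<rho> g - (\<rho> f + \<rho> (r [^] (-q)))" unfolding g_def using fG rG by (intro hom) auto
    have D2: "e dvd \<rho> (r [^] (-q)) - (- q * \<rho> r)" by (rule powhom)
    have D3: "e dvd \<rho> r - b" and D4: "e dvd \<rho> f - \<rho> f mod e" by (simp_all add: b_def)
    from dvd_diff[OF dvd_add[OF dvd_add[OF D1 D2] D4] dvd_mult[OF D3, of q]]
    have "e dvd \<rho> g - (\<rho> f mod e - q * b)" by (simp add: algebra_simps)
    moreover have md: "\<rho> f mod e - q * b = (\<rho> f mod e) mod b" by (simp add: q_def minus_div_mult_eq_mod)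
    ultimately have "\<rho> g mod e = ((\<rho> f mod e) mod b) mod e" by (simp add: mod_eq_dvd_iff)
    also have "\<dots> = (\<rho> f mod e) mod b"
    proof (rule mod_pos_pos_trivial)
      have "(\<rho> f mod e) mod b < b" using b0 by (rule pos_mod_bound)
      moreover have "b < e" unfolding b_def using e by (rule pos_mod_bound)
      ultimately show "(\<rho> f mod e) mod b < e" by linarith
    qed (use b0 in simp)
    also have "\<dots> < b" using b0 by simp
    finally have "g = \<one>" using rmin[of g] g by (auto simp: b_def)
    have "f = g \<otimes> r [^] q" using fG rG by (simp add: g_def m_assoc int_pow_neg)
    then show ?thesis using \<open>g = \<one>\<close> rG by auto
  qed
  then show ?thesis using that r by blast
qed

text \<open>Torsion elements are pairwise different modulo the powers of \<open>s\<close>, so they form a finite group, which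
  is cyclic by the residues. By finite index some power \<open>f [^] E\<close> of each \<open>f\<close> is a power \<open>s [^] d f\<close>, with
  one exponent \<open>E\<close> for all \<open>f\<close>; then \<open>d\<close> is a homomorphism to the integers whose kernel is the
  torsion subgroup, and an element on which \<open>d\<close> takes its least positive value splits it off.\<close>

theorem virtually_cyclic_iso:
  assumes s: "s \<in> carrier G" and inf: "\<And>k::int. s [^] k = \<one> \<Longrightarrow> k = 0"
    and idx: "\<And>F. finite F \<Longrightarrow> F \<subseteq> carrier G \<Longrightarrow>
      (\<And>f g k. f \<in> F \<Longrightarrow> g \<in> F \<Longrightarrow> f \<noteq> g \<Longrightarrow> inv f \<otimes> g \<noteq> s [^] (k::int)) \<Longrightarrow> card F < N"
    and residues: "\<And>F. finite F \<Longrightarrow> F \<subseteq> carrier G \<Longrightarrow> \<exists>(e::int) \<rho>. 0 < e \<and>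
      (\<forall>f\<in>carrier G. \<forall>g\<in>carrier G. e dvd \<rho> (f \<otimes> g) - (\<rho> f + \<rho> g)) \<and> (\<forall>f\<in>F. e dvd \<rho> f \<longrightarrow> f = \<one>)"
  shows "\<exists>m>0. G \<cong> integer_group \<times>\<times> integer_mod_group m"
proof -
  have torG: "torsion \<subseteq> carrier G" by (auto simp: torsion_def)
  have s_tor: "k = 0" if "s [^] k \<in> torsion" for k :: int
  proof -
    obtain n :: nat where n: "0 < n" "(s [^] k) [^] n = \<one>" using \<open>s [^] k \<in> torsion\<close> by (auto simp: torsion_def)
    then have "s [^] (k * int n) = \<one>" using s int_pow_pow[of s k "int n"] by (simp add: int_pow_int)
    then show ?thesis using inf n(1) by force
  qed
  have finT: "finite torsion"
  proof (rule ccontr)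
    assume "infinite torsion"
    then obtain F where F: "F \<subseteq> torsion" "card F = N" "finite F" using infinite_arbitrarily_large by blast
    have "card F < N"
    proof (rule idx[OF F(3)])
      fix f g and k :: int assume fg: "f \<in> F" "g \<in> F" "f \<noteq> g"
      show "inv f \<otimes> g \<noteq> s [^] k"
      proof
        assume eq: "inv f \<otimes> g = s [^] k"
        have fg': "f \<in> torsion" "g \<in> torsion" "f \<in> carrier G" "g \<in> carrier G" using fg F torG by auto
        have "inv f \<in> torsion" using torsion_int_pow[OF fg'(1), of "-1"] fg'(3) by (simp add: int_pow_neg)
        then have "s [^] k \<in> torsion" unfolding eq[symmetric] using fg' by (intro torsion_mult)
        then have "k = 0" by (rule s_tor)
        then have "inv f \<otimes> g = \<one>" using eq by simp
        moreover have "f \<otimes> (inv f \<otimes> g) = g" using fg'(3,4) by (simp add: m_assoc[symmetric])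
        ultimately have "g = f" using fg'(3) by simp
        then show False using fg by simp
      qed
    qed (use F torG in auto)
    then show False using F by simp
  qed
  obtain e :: int and \<rho> where e: "0 < e" "\<And>f g. f \<in> carrier G \<Longrightarrow> g \<in> carrier G \<Longrightarrow> e dvd \<rho> (f \<otimes> g) - (\<rho> f + \<rho> g)"
      "\<And>f. f \<in> torsion \<Longrightarrow> e dvd \<rho> f \<Longrightarrow> f = \<one>"
    using residues[OF finT torG] by blast
  obtain r where r: "r \<in> torsion" "\<And>f. f \<in> torsion \<Longrightarrow> \<exists>c::int. f = r [^] c"
    using cyclic_torsion[OF finT e] by blast
  have rG: "r \<in> carrier G" using r torG by blast
  obtain m :: nat where m: "0 < m" "r [^] m = \<one>" "\<And>c::int. r [^] c = \<one> \<Longrightarrow> int m dvd c"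
    using r(1) order_of_generator[OF rG] by (auto simp: torsion_def)
  \<comment> \<open>A common exponent that takes every element into the powers of \<open>s\<close>.\<close>
  define E :: nat where "E = fact N"
  have "\<exists>k::int. f [^] E = s [^] k" if f: "f \<in> carrier G" for f
  proof -
    have "\<exists>n. 0 < n \<and> n \<le> N \<and> (\<exists>k::int. f [^] (n::nat) = s [^] k)"
    proof (cases "inj_on (\<lambda>i::nat. f [^] i) {..N}")
      case True
      define F where "F = (\<lambda>i::nat. f [^] i) ` {..N}"
      have "\<not> card F < N" using True by (simp add: F_def card_image)
      then obtain x y and k :: int where "x \<in> F" "y \<in> F" "x \<noteq> y" "inv x \<otimes> y = s [^] k"
        using idx[of F] f unfolding F_def by (metis (no_types, lifting) finite_atMost finite_imageI image_subset_iff nat_pow_closed)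
      then obtain i j where ij: "i \<le> N" "j \<le> N" "i \<noteq> j" "inv (f [^] i) \<otimes> f [^] j = s [^] k" by (auto simp: F_def)
      have "f [^] (int j - int i) = s [^] k"
        using ij(4) f int_pow_diff[of f "int j" "int i"] by (simp add: int_pow_int m_comm)
      show ?thesis
      proof (cases "i < j")
        case True
        then have "f [^] (j - i) = s [^] k" using \<open>f [^] (int j - int i) = _\<close> by (simp add: int_pow_int[symmetric] of_nat_diff)
        then show ?thesis using True ij by (intro exI[of _ "j - i"]) auto
      next
        case False
        have "f [^] (int i - int j) = inv (f [^] (int j - int i))" using f int_pow_neg[of f "int j - int i"] by simp
        then have "f [^] (i - j) = s [^] (-k)"
          using \<open>f [^] (int j - int i) = _\<close> False s by (simp add: int_pow_int[symmetric] of_nat_diff int_pow_neg)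
        then show ?thesis using False ij by (intro exI[of _ "i - j"]) auto
      qed
    next
      case False
      then obtain i j where ij: "i < j" "j \<le> N" "f [^] i = f [^] j"
        unfolding inj_on_def by (metis atMost_iff linorder_neqE_nat)
      have "f [^] i \<otimes> f [^] (j - i) = f [^] i" using nat_pow_mult[OF f, of i "j - i"] ij by simp
      then have "f [^] (j - i) = \<one>" using l_cancel_one[of "f [^] i" "f [^] (j - i)"] f by simp
      then show ?thesis using ij by (intro exI[of _ "j - i"]) (auto intro: exI[of _ 0])
    qed
    then obtain n and k :: int where n: "0 < n" "n \<le> N" "f [^] n = s [^] k" by blast
    then have "n dvd E" by (simp add: E_def dvd_fact)
    then obtain l where l: "E = n * l" by blast
    have "f [^] E = (f [^] n) [^] l" using f l by (simp add: nat_pow_pow)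
    also have "\<dots> = s [^] (k * int l)" using n s int_pow_pow[of s k "int l"] by (simp add: int_pow_int)
    finally show ?thesis by blast
  qed
  then obtain d where d: "\<And>f. f \<in> carrier G \<Longrightarrow> f [^] E = s [^] (d f :: int)" by metis
  have s_inj: "k = l" if "s [^] k = s [^] l" for k l :: int
  proof -
    have "s [^] (k - l) = \<one>" using that s by (simp add: int_pow_diff)
    then show ?thesis using inf by force
  qed
  have E0: "0 < E" by (simp add: E_def)
  have d_mult: "d (f \<otimes> g) = d f + d g" if "f \<in> carrier G" "g \<in> carrier G" for f g
    by (rule s_inj) (use that s in \<open>simp add: d[symmetric] int_pow_mult nat_pow_distrib\<close>)
  have d_s: "d s = int E" by (rule s_inj) (use s d[OF s] in \<open>simp add: int_pow_int\<close>)
  have d_ker: "f \<in> torsion" if "f \<in> carrier G" "d f = 0" for f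
    using d[OF that(1)] that E0 unfolding torsion_def by auto
  have d_pow: "d (f [^] k) = k * d f" if "f \<in> carrier G" for f and k :: int
  proof (rule s_inj)
    have "(f [^] k) [^] int E = (f [^] int E) [^] k" using that by (simp add: int_pow_pow mult.commute)
    then have "(f [^] k) [^] E = (s [^] d f) [^] k" using d[OF that] by (simp add: int_pow_int)
    then show "s [^] d (f [^] k) = s [^] (k * d f)" using d[of "f [^] k"] that s by (simp add: int_pow_pow mult.commute)
  qed
  define P where "P n \<longleftrightarrow> 0 < n \<and> (\<exists>f\<in>carrier G. d f = int n)" for n :: nat
  have "P E" using E0 d_s s by (auto simp: P_def)
  define a where "a = (LEAST n. P n)"
  have "P a" unfolding a_def using \<open>P E\<close> by (rule LeastI)
  then obtain g where g: "g \<in> carrier G" "d g = int a" and a: "0 < a" by (auto simp: P_def)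
  have split: "\<exists>c::int. f = g [^] (d f div int a) \<otimes> r [^] c" if f: "f \<in> carrier G" for f
  proof -
    define q where "q = d f div int a"
    define t where "t = f \<otimes> g [^] (-q)"
    have tG: "t \<in> carrier G" using f g by (simp add: t_def)
    have "d t = d f - q * int a" using f g d_mult d_pow[OF g(1)] by (simp add: t_def)
    then have dt: "d t = d f mod int a" by (simp add: q_def minus_div_mult_eq_mod)
    have "d t = 0"
    proof (rule ccontr)
      assume "d t \<noteq> 0"
      moreover have "0 \<le> d t" using dt a by simp
      ultimately have pos: "0 < d t" by simp
      then have "d t = int (nat (d t))" by simp
      then have "P (nat (d t))" unfolding P_def using tG pos by (intro conjI bexI[of _ t]) simp_all
      then have "a \<le> nat (d t)" unfolding a_def by (rule Least_le)
      moreover have "d t < int a" using dt a by simp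
      ultimately show False using a by linarith
    qed
    then obtain c :: int where c: "t = r [^] c" using d_ker[OF tG] r(2) by blast
    have "f = t \<otimes> g [^] q" using f g by (simp add: t_def m_assoc int_pow_neg)
    then have "f = g [^] q \<otimes> r [^] c" using c g rG by (simp add: m_comm)
    then show ?thesis by (auto simp: q_def)
  qed
  have "G \<cong> integer_group \<times>\<times> integer_mod_group m"
  proof (rule iso_integer_times_cyclic[OF g(1) rG m(1,2)])
    fix x assume "x \<in> carrier G"
    then show "\<exists>(k::int) (c::int). x = g [^] k \<otimes> r [^] c" using split by blast
  next
    fix k c :: int assume one: "g [^] k \<otimes> r [^] c = \<one>"
    have "d (r [^] c) = 0"
    proof -
      have "d (r [^] int m) = int m * d r" using d_pow[OF rG] by simp
      moreover have "d \<one> = 0" using d_mult[of \<one> \<one>] by simp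
      ultimately have "d r = 0" using m(1,2) by (simp add: int_pow_int)
      then show ?thesis using d_pow[OF rG] by simp
    qed
    moreover have "d (g [^] k \<otimes> r [^] c) = k * int a + d (r [^] c)" using d_mult d_pow g rG by simp
    moreover have "d \<one> = 0" using d_mult[of \<one> \<one>] by simp
    ultimately have "k = 0" using one a by simp
    then show "k = 0 \<and> int m dvd c" using one m(3) rG by simp
  qed
  then show ?thesis using m(1) by blast
qed

end

lemma (in group) finite_cyclic_iso:
  assumes cyc: "cyclic_group G" and fin: "finite (carrier G)"
  obtains m :: nat where "1 \<le> m" "integer_mod_group m \<cong> G"
proof -
  obtain g where g: "g \<in> carrier G" "carrier G = range (\<lambda>n::int. g [^] n)"
    using cyc unfolding cyclic_group by blast
  have "\<not> inj (\<lambda>n::nat. g [^] n)"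
  proof
    assume "inj (\<lambda>n::nat. g [^] n)"
    moreover have "range (\<lambda>n::nat. g [^] n) \<subseteq> carrier G" using g(1) by auto
    ultimately show False using fin finite_subset finite_imageD infinite_UNIV_nat by blast
  qed
  then obtain i j :: nat where "i \<noteq> j" "g [^] i = g [^] j" unfolding inj_def by blast
  then obtain i j :: nat where ij: "i < j" "g [^] i = g [^] j" by (metis linorder_neqE_nat)
  have "g [^] i \<otimes> g [^] (j - i) = g [^] i" using nat_pow_mult[OF g(1), of i "j - i"] ij by simp
  then have "g [^] (j - i) = \<one>" using l_cancel_one[of "g [^] i" "g [^] (j - i)"] g(1) by simp
  moreover have "0 < j - i" using ij by simp
  ultimately obtain m :: nat where m: "0 < m" "g [^] m = \<one>" "\<And>c::int. g [^] c = \<one> \<Longrightarrow> int m dvd c"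
    using order_of_generator[OF g(1)] by blast
  define h where "h k = g [^] k" for k :: int
  have c: "carrier (integer_mod_group m) = {0..<int m}" using m(1) by (simp add: carrier_integer_mod_group)
  have hom: "h \<in> hom (integer_mod_group m) G"
    by (rule homI) (use g(1) in \<open>simp_all add: h_def int_pow_period[OF g(1) m(2)] int_pow_mult\<close>)
  have "inj_on h {0..<int m}"
  proof (rule inj_onI)
    fix x y assume xy: "x \<in> {0..<int m}" "y \<in> {0..<int m}" "h x = h y"
    have "g [^] (x - y) = \<one>" using xy(3) g(1) by (simp add: h_def int_pow_diff)
    then have "int m dvd x - y" by (rule m(3))
    then have "x mod int m = y mod int m" by (simp add: mod_eq_dvd_iff)
    then show "x = y" using xy(1,2) by simp
  qed
  moreover have "h ` {0..<int m} = carrier G"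
  proof
    show "h ` {0..<int m} \<subseteq> carrier G" using g(1) by (auto simp: h_def)
    show "carrier G \<subseteq> h ` {0..<int m}"
    proof
      fix x assume "x \<in> carrier G"
      then obtain n :: int where "x = g [^] n" using g(2) by auto
      then have "x = h (n mod int m)" by (simp add: h_def int_pow_period[OF g(1) m(2)])
      then show "x \<in> h ` {0..<int m}" using m(1) by simp
    qed
  qed
  ultimately have "h \<in> iso (integer_mod_group m) G" using hom c by (simp add: iso_def bij_betw_def)
  then have "integer_mod_group m \<cong> G" by (auto simp: is_iso_def)
  then show ?thesis using that[of m] m(1) by simp
qed

lemma cyclic_integer_mod_group: "0 < m \<Longrightarrow> cyclic_group (integer_mod_group m) \<and> finite (carrier (integer_mod_group m))"
proof -
  assume m: "0 < m"
  have c: "carrier (integer_mod_group m) = {0..<int m}" using m by (simp add: carrier_integer_mod_group)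
  define x :: int where "x = 1 mod int m"
  have x: "x \<in> carrier (integer_mod_group m)" using m by (simp add: c x_def)
  have "y = x [^]\<^bsub>integer_mod_group m\<^esub> y" if "y \<in> carrier (integer_mod_group m)" for y :: int
    using that m unfolding int_pow_integer_mod_group c x_def by (simp add: mod_simps)
  moreover have "x [^]\<^bsub>integer_mod_group m\<^esub> (n::int) \<in> carrier (integer_mod_group m)" for n
    using group.int_pow_closed[OF group_integer_mod_group x] .
  ultimately have "carrier (integer_mod_group m) = range (\<lambda>n::int. x [^]\<^bsub>integer_mod_group m\<^esub> n)" by blast
  then have "cyclic_group (integer_mod_group m)" using group.cyclic_group[OF group_integer_mod_group] x by blast
  then show ?thesis by (simp add: c)
qed

section \<open>Automorphisms of Toeplitz subshifts\<close>

lemma toeplitz_window_period: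
  assumes "toeplitz_sequence x"
  obtains p :: int where "1 \<le> p" "\<And>k. agree w x (sh (k * p) x)"
proof -
  have "\<exists>p\<ge>1. \<forall>k i. \<bar>i\<bar> \<le> int w \<longrightarrow> x i = x (i + k * p)" for w :: nat
  proof (induction w)
    case 0
    obtain p where "p \<ge> 1" "\<forall>k. x 0 = x (0 + k * p)" using assms unfolding toeplitz_sequence_def by blast
    then show ?case by (intro exI[of _ p]) auto
  next
    case (Suc w)
    then obtain p where p: "p \<ge> 1" "\<And>k i. \<bar>i\<bar> \<le> int w \<Longrightarrow> x i = x (i + k * p)" by blast
    obtain a where a: "a \<ge> 1" "\<And>k. x (int (Suc w)) = x (int (Suc w) + k * a)"
      using assms unfolding toeplitz_sequence_def by blast
    obtain b where b: "b \<ge> 1" "\<And>k. x (- int (Suc w)) = x (- int (Suc w) + k * b)"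
      using assms unfolding toeplitz_sequence_def by blast
    have "x i = x (i + k * (p * a * b))" if i: "\<bar>i\<bar> \<le> int (Suc w)" for k i
    proof -
      consider "\<bar>i\<bar> \<le> int w" | "i = int (Suc w)" | "i = - int (Suc w)" using i by linarith
      then show ?thesis
      proof cases
        case 1 then show ?thesis using p(2)[of i "k * a * b"] by (simp add: algebra_simps)
      next
        case 2
        have "k * p * b * a = k * (p * a * b)" by simp
        then show ?thesis using a(2)[of "k * p * b"] 2 by (simp only:)
      next
        case 3
        have "k * p * a * b = k * (p * a * b)" by simp
        then show ?thesis using b(2)[of "k * p * a"] 3 by (simp only:)
      qed
    qed
    moreover have "0 < p * a * b" using p(1) a(1) b(1) by simp
    then have "1 \<le> p * a * b" by linarith
    ultimately show ?case by blast
  qed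
  then obtain p where "1 \<le> p" "\<forall>k i. \<bar>i\<bar> \<le> int w \<longrightarrow> x i = x (i + k * p)" by blast
  then show ?thesis using that[of p] by (simp add: agree_def sh_apply)
qed

locale toeplitz_system = minimal_subshift A X for A :: "'a set" and X +
  fixes x0 :: "int \<Rightarrow> 'a"
  assumes x0: "x0 \<in> X" and toeplitz: "toeplitz_sequence x0"
begin

text \<open>The closure of the orbit of \<open>x0\<close> under the \<open>q\<close>-th power of the shift. Its translates are the
  fibres of the factor map from \<open>X\<close> to the integers modulo a divisor of \<open>q\<close>; all of them together
  represent the odometer that underlies the Toeplitz system.\<close>

definition Y :: "int \<Rightarrow> (int \<Rightarrow> 'a) set" where
  "Y q = {y \<in> X. \<forall>w. \<exists>k. agree w y (sh (q * k) x0)}"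

lemma YX: "y \<in> Y q \<Longrightarrow> y \<in> X" by (simp add: Y_def)

lemma Y_window: "y \<in> Y q \<Longrightarrow> \<exists>k. agree w y (sh (q * k) x0)" by (simp add: Y_def)

lemma x0_Y: "x0 \<in> Y q"
proof -
  have "agree w x0 (sh (q * 0) x0)" for w by simp
  then show ?thesis using x0 unfolding Y_def by blast
qed

lemma Y_closed:
  assumes "\<And>w. \<exists>z\<in>Y q. agree w y z" shows "y \<in> Y q"
proof -
  have "y \<in> X" by (rule closed_window) (use assms YX in blast)
  moreover have "\<exists>k. agree w y (sh (q * k) x0)" for w
  proof -
    obtain z where "z \<in> Y q" "agree w y z" using assms by blast
    then show ?thesis using Y_window agree_trans by blast
  qed
  ultimately show ?thesis by (simp add: Y_def)
qed

lemma Y_sh: "y \<in> Y q \<Longrightarrow> sh (q * k) y \<in> Y q"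
proof -
  assume y: "y \<in> Y q"
  have "\<exists>l. agree w (sh (q * k) y) (sh (q * l) x0)" for w
  proof -
    obtain l where l: "agree (w + nat \<bar>q * k\<bar>) y (sh (q * l) x0)" using Y_window[OF y] by blast
    have "agree w (sh (q * k) y) (sh (q * k) (sh (q * l) x0))" using l by (rule agree_sh) simp
    moreover have "q * k + q * l = q * (k + l)" by (simp add: algebra_simps)
    ultimately have "agree w (sh (q * k) y) (sh (q * (k + l)) x0)" by (simp only: sh_sh)
    then show ?thesis ..
  qed
  then show ?thesis using YX[OF y] sh_X by (simp add: Y_def)
qed

text \<open>Let \<open>p\<close> be a period of the window of \<open>x0\<close>. A point of \<open>Y q\<close> looks like \<open>x0\<close> shifted by a multiple
  of \<open>q\<close>, and fewer than \<open>p\<close> further steps of length \<open>q\<close> lead to a multiple of \<open>p * q\<close>.\<close>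

lemma Y_return:
  assumes y: "y \<in> Y q" and q: "0 < q"
  shows "\<exists>s. agree w x0 (sh (q * s) y)"
proof -
  obtain p where p: "1 \<le> p" "\<And>k. agree w x0 (sh (k * p) x0)" using toeplitz_window_period[OF toeplitz] by blast
  obtain k where k: "agree (w + nat (q * p)) y (sh (q * k) x0)" using Y_window[OF y] by blast
  define s where "s = (-k) mod p"
  have s: "0 \<le> s" "s < p" using p by (auto simp: s_def)
  have "p dvd k + s" unfolding s_def by (simp add: dvd_eq_mod_eq_0 mod_simps)
  then obtain l where l: "k + s = p * l" by blast
  have "\<bar>q * s\<bar> \<le> q * p" using s q by (simp add: abs_mult mult_left_mono)
  then have "agree w (sh (q * s) y) (sh (q * s) (sh (q * k) x0))" by (intro agree_sh[OF k]) simp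
  moreover have "q * s + q * k = (q * l) * p" using l by (metis add.commute distrib_left mult.assoc mult.commute)
  ultimately have "agree w (sh (q * s) y) (sh ((q * l) * p) x0)" by (simp only: sh_sh)
  then have "agree w x0 (sh (q * s) y)" using p(2)[of "q * l"] agree_sym agree_trans by blast
  then show ?thesis ..
qed

text \<open>Pigeonhole over the residues modulo \<open>q\<close> of the shifts of \<open>x0\<close> that approximate \<open>y\<close>.\<close>

lemma Y_cover:
  assumes y: "y \<in> X" and q: "0 < q" shows "\<exists>r. sh (-r) y \<in> Y q"
proof (rule ccontr)
  assume "\<not> ?thesis"
  then have "\<exists>w. \<forall>k. \<not> agree w (sh (-r) y) (sh (q * k) x0)" for r using sh_X[OF y] unfolding Y_def by blast
  then obtain W where W: "\<And>r k. \<not> agree (W r) (sh (-r) y) (sh (q * k) x0)" by metis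
  define w where "w = Max (W ` {0..<q}) + nat q"
  obtain t where t: "agree w y (sh t x0)" using dense[OF x0 y] by blast
  define r where "r = t mod q"
  have r: "r \<in> {0..<q}" using q by (simp add: r_def)
  have "W r \<le> Max (W ` {0..<q})" using r by simp
  then have "W r + nat \<bar>-r\<bar> \<le> w" using r unfolding w_def by (intro add_mono) auto
  from agree_sh[OF t this] have "agree (W r) (sh (-r) y) (sh (-r) (sh t x0))" .
  moreover have "- r + t = q * (t div q)" unfolding r_def by (simp add: minus_mod_eq_mult_div)
  ultimately have "agree (W r) (sh (-r) y) (sh (q * (t div q)) x0)" by (simp only: sh_sh)
  then show False using W by blast
qed

text \<open>An automorphism commutes with the shift, so it carries the \<open>q\<close>-orbit closure of \<open>x0\<close> into that of \<open>f x0\<close>.\<close>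

lemma Y_move:
  assumes f: "f \<in> carrier \<Gamma>" and r: "sh (-r) (f x0) \<in> Y q" and y: "y \<in> Y q"
  shows "sh (-r) (f y) \<in> Y q"
proof (rule Y_closed)
  fix w
  have "finite {f}" "{f} \<subseteq> carrier \<Gamma>" using f by auto
  then obtain R where R': "0 \<le> R" "\<And>g. g \<in> {f} \<Longrightarrow> radius R g" by (rule common_radius) blast
  then have R: "0 \<le> R" "radius R f" by auto
  obtain k where k: "agree (w + nat \<bar>r\<bar> + nat R) y (sh (q * k) x0)" using Y_window[OF y] by blast
  have "agree (w + nat \<bar>r\<bar>) (f y) (f (sh (q * k) x0))"
    unfolding agree_def
  proof (intro allI impI)
    fix i assume i: "\<bar>i\<bar> \<le> int (w + nat \<bar>r\<bar>)"
    show "f y i = f (sh (q * k) x0) i"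
      by (rule radiusD[OF R(2) YX[OF y] sh_X[OF x0]]) (use k i R(1) in \<open>auto simp: agree_def\<close>)
  qed
  then have "agree w (sh (-r) (f y)) (sh (-r) (f (sh (q * k) x0)))" by (rule agree_sh) simp
  moreover have "sh (-r) (f (sh (q * k) x0)) = sh (q * k) (sh (-r) (f x0))"
    using aut_sh[OF f x0, of "q * k"] by (simp add: add.commute)
  ultimately show "\<exists>z\<in>Y q. agree w (sh (-r) (f y)) z" using Y_sh[OF r] by auto
qed

text \<open>The component modulo \<open>period q\<close> of the translation that \<open>f\<close> induces on the odometer.\<close>

definition residue :: "int \<Rightarrow> ((int \<Rightarrow> 'a) \<Rightarrow> (int \<Rightarrow> 'a)) \<Rightarrow> int" where
  "residue q f = (SOME r. sh (-r) (f x0) \<in> Y q)"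

lemma residue: "f \<in> carrier \<Gamma> \<Longrightarrow> 0 < q \<Longrightarrow> sh (- residue q f) (f x0) \<in> Y q"
  unfolding residue_def using someI_ex[OF Y_cover[OF aut_X[OF _ x0]]] by blast

definition period :: "int \<Rightarrow> int" where
  "period q = int (LEAST n. 0 < n \<and> sh (int n) x0 \<in> Y q)"

lemma sh_Y: "sh d x0 \<in> Y q \<Longrightarrow> y \<in> Y q \<Longrightarrow> sh d y \<in> Y q"
proof (rule Y_closed)
  fix w assume d: "sh d x0 \<in> Y q" and y: "y \<in> Y q"
  obtain k where "agree (w + nat \<bar>d\<bar>) y (sh (q * k) x0)" using Y_window[OF y] by blast
  then have "agree w (sh d y) (sh d (sh (q * k) x0))" by (rule agree_sh) simp
  moreover have "sh d (sh (q * k) x0) = sh (q * k) (sh d x0)" by (simp add: add.commute)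
  ultimately show "\<exists>z\<in>Y q. agree w (sh d y) z" using Y_sh[OF d] by auto
qed

lemma period:
  assumes q: "0 < q"
  shows "0 < period q" "sh d x0 \<in> Y q \<longleftrightarrow> period q dvd d"
proof -
  have "sh (q * 1) x0 \<in> Y q" by (rule Y_sh[OF x0_Y])
  then have ex: "\<exists>n. 0 < n \<and> sh (int n) x0 \<in> Y q" using q by (intro exI[of _ "nat q"]) simp
  define n where "n = (LEAST n. 0 < n \<and> sh (int n) x0 \<in> Y q)"
  have n: "0 < n" "sh (int n) x0 \<in> Y q" using LeastI_ex[OF ex] by (auto simp: n_def)
  have least: "n \<le> m" if "0 < m" "sh (int m) x0 \<in> Y q" for m unfolding n_def using that by (intro Least_le) simp
  have pn: "period q = int n" by (simp add: period_def n_def)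
  show "0 < period q" using n pn by simp
  have add: "sh (a + b) x0 \<in> Y q" if "sh a x0 \<in> Y q" "sh b x0 \<in> Y q" for a b
    using sh_Y[OF that] by (simp only: sh_sh)
  have mulnat: "sh (int m * a) x0 \<in> Y q" if "sh a x0 \<in> Y q" for m a
  proof (induction m)
    case (Suc m)
    have "int (Suc m) * a = int m * a + a" by (simp add: algebra_simps)
    then show ?case using add[OF Suc that] by (simp only:)
  qed (use x0_Y in simp)
  have neg: "sh (-a) x0 \<in> Y q" if "sh a x0 \<in> Y q" for a
  proof -
    have "sh (int (nat (q - 1)) * a) x0 \<in> Y q" using that by (rule mulnat)
    moreover have "int (nat (q - 1)) = q - 1" using q by simp
    ultimately have "sh ((q - 1) * a) x0 \<in> Y q" by (simp only:)
    from Y_sh[OF this, of "-a"] have "sh (q * (-a) + (q - 1) * a) x0 \<in> Y q" by (simp only: sh_sh)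
    moreover have "q * (-a) + (q - 1) * a = -a" by (simp add: algebra_simps)
    ultimately show ?thesis by (simp only:)
  qed
  have mul: "sh (int n * m) x0 \<in> Y q" for m
  proof (cases "0 \<le> m")
    case True
    then have "int (nat m) * int n = int n * m" by simp
    then show ?thesis using mulnat[OF n(2), of "nat m"] by (simp only:)
  next
    case False
    then have "- (int (nat (-m)) * int n) = int n * m" by simp
    then show ?thesis using neg[OF mulnat[OF n(2), of "nat (-m)"]] by (simp only:)
  qed
  show "sh d x0 \<in> Y q \<longleftrightarrow> period q dvd d"
  proof
    assume d: "sh d x0 \<in> Y q"
    have "sh (d + int n * (- (d div int n))) x0 \<in> Y q" by (rule add[OF d mul])
    moreover have "d + int n * (- (d div int n)) = d mod int n" by (simp add: minus_mult_div_eq_mod)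
    ultimately have m: "sh (d mod int n) x0 \<in> Y q" by (simp only:)
    have "d mod int n = 0"
    proof (rule ccontr)
      assume "d mod int n \<noteq> 0"
      moreover have "0 \<le> d mod int n" "d mod int n < int n" using n by simp_all
      ultimately have "0 < nat (d mod int n)" "int (nat (d mod int n)) = d mod int n" by simp_all
      then have "n \<le> nat (d mod int n)" using m by (intro least) (simp_all only:)
      then show False using \<open>d mod int n < int n\<close> \<open>0 \<le> d mod int n\<close> by linarith
    qed
    then show "period q dvd d" using pn by (simp add: dvd_eq_mod_eq_0)
  next
    assume "period q dvd d"
    then show "sh d x0 \<in> Y q" using mul pn by (auto elim!: dvdE)
  qed
qed

lemma residue_unique:
  assumes q: "0 < q" and y: "y \<in> X" and r: "sh (-r) y \<in> Y q" "sh (-s) y \<in> Y q"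
  shows "period q dvd r - s"
proof -
  define z where "z = sh (-r) y"
  have z: "z \<in> Y q" using r by (simp add: z_def)
  have "(r - s) + (- r) = - s" by simp
  then have dz: "sh (r - s) z \<in> Y q" using r(2) unfolding z_def by (simp only: sh_sh)
  have "sh (r - s) x0 \<in> Y q"
  proof (rule Y_closed)
    fix w
    obtain k where "agree (w + nat \<bar>r - s\<bar>) x0 (sh (q * k) z)" using Y_return[OF z q] by blast
    then have "agree w (sh (r - s) x0) (sh (r - s) (sh (q * k) z))" by (rule agree_sh) simp
    moreover have "sh (r - s) (sh (q * k) z) = sh (q * k) (sh (r - s) z)" by (simp add: add.commute)
    ultimately show "\<exists>u\<in>Y q. agree w (sh (r - s) x0) u" using Y_sh[OF dz] by auto
  qed
  then show ?thesis using period(2)[OF q] by simp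
qed

lemma residue_mult:
  assumes f: "f \<in> carrier \<Gamma>" "g \<in> carrier \<Gamma>" and q: "0 < q"
  shows "period q dvd residue q (f \<otimes>\<^bsub>\<Gamma>\<^esub> g) - (residue q f + residue q g)"
proof (rule residue_unique[OF q])
  let ?r = "residue q f" and ?s = "residue q g"
  have fg: "f \<otimes>\<^bsub>\<Gamma>\<^esub> g \<in> carrier \<Gamma>" using f by simp
  show "(f \<otimes>\<^bsub>\<Gamma>\<^esub> g) x0 \<in> X" by (rule aut_X[OF fg x0])
  show "sh (- residue q (f \<otimes>\<^bsub>\<Gamma>\<^esub> g)) ((f \<otimes>\<^bsub>\<Gamma>\<^esub> g) x0) \<in> Y q" by (rule residue[OF fg q])
  have "sh (- ?r) (f (sh (- ?s) (g x0))) \<in> Y q" by (rule Y_move[OF f(1) residue[OF f(1) q] residue[OF f(2) q]])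
  moreover have "f (sh (- ?s) (g x0)) = sh (- ?s) (f (g x0))" by (rule aut_sh[OF f(1) aut_X[OF f(2) x0]])
  moreover have "- ?r + - ?s = - (?r + ?s)" by simp
  ultimately show "sh (- (?r + ?s)) ((f \<otimes>\<^bsub>\<Gamma>\<^esub> g) x0) \<in> Y q"
    using mult_apply[OF f x0] by (simp only: sh_sh)
qed

lemma residue_zero:
  assumes f: "f \<in> carrier \<Gamma>" and q: "0 < q" and z: "period q dvd residue q f"
  shows "f x0 \<in> Y q"
proof -
  have "sh (residue q f) x0 \<in> Y q" using period(2)[OF q] z by simp
  from sh_Y[OF this residue[OF f q]] show ?thesis by simp
qed

text \<open>If \<open>q\<close> is a period of a window of \<open>x0\<close> then no point of \<open>Y q\<close> differs from \<open>x0\<close> there. So the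
  sets \<open>Y q\<close> shrink to \<open>x0\<close>.\<close>

lemma Y_small:
  obtains q where "0 < q" "\<And>y. y \<in> Y q \<Longrightarrow> agree w x0 y"
proof -
  obtain p where p: "1 \<le> p" "\<And>k. agree w x0 (sh (k * p) x0)" using toeplitz_window_period[OF toeplitz] by blast
  have "agree w x0 y" if y: "y \<in> Y p" for y
  proof -
    obtain k where "agree w y (sh (p * k) x0)" using Y_window[OF y] by blast
    then show ?thesis using p(2)[of k] agree_sym agree_trans by (metis mult.commute)
  qed
  then show ?thesis using that p(1) by force
qed

lemma separated:
  assumes F: "finite F" "F \<subseteq> carrier \<Gamma>"
  obtains q where "0 < q" "\<And>f. f \<in> F \<Longrightarrow> period q dvd residue q f \<Longrightarrow> f = \<one>\<^bsub>\<Gamma>\<^esub>"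
proof -
  have "\<exists>w. \<not> agree w x0 (f x0)" if f: "f \<in> carrier \<Gamma>" "f \<noteq> \<one>\<^bsub>\<Gamma>\<^esub>" for f
  proof (rule ccontr)
    assume "\<not> ?thesis"
    then have "x0 = f x0" using eq_if_agree by blast
    then have "f x0 = \<one>\<^bsub>\<Gamma>\<^esub> x0" using one_apply[OF x0] by simp
    then show False using aut_determined[OF f(1) \<Gamma>.one_closed x0] f(2) by blast
  qed
  then obtain W where W: "\<And>f. f \<in> carrier \<Gamma> \<Longrightarrow> f \<noteq> \<one>\<^bsub>\<Gamma>\<^esub> \<Longrightarrow> \<not> agree (W f) x0 (f x0)" by metis
  define w where "w = Max (insert 0 (W ` F))"
  obtain q where q: "0 < q" "\<And>y. y \<in> Y q \<Longrightarrow> agree w x0 y" using Y_small by blast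
  have "f = \<one>\<^bsub>\<Gamma>\<^esub>" if f: "f \<in> F" "period q dvd residue q f" for f
  proof (rule ccontr)
    assume ne: "f \<noteq> \<one>\<^bsub>\<Gamma>\<^esub>"
    have fG: "f \<in> carrier \<Gamma>" using f F by blast
    have "agree w x0 (f x0)" by (rule q(2)[OF residue_zero[OF fG q(1) f(2)]])
    moreover have "W f \<le> w" unfolding w_def using F(1) f(1) by (intro Max_ge) auto
    ultimately show False using W[OF fG ne] agree_mono by blast
  qed
  then show ?thesis using that q(1) by blast
qed

text \<open>A commutator has vanishing residues.\<close>

lemma comm_group_\<Gamma>: "comm_group \<Gamma>"
proof (rule \<Gamma>.group_comm_groupI)
  fix f g assume fg: "f \<in> carrier \<Gamma>" "g \<in> carrier \<Gamma>"
  define c where "c = (f \<otimes>\<^bsub>\<Gamma>\<^esub> g) \<otimes>\<^bsub>\<Gamma>\<^esub> inv\<^bsub>\<Gamma>\<^esub> (g \<otimes>\<^bsub>\<Gamma>\<^esub> f)"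
  have c: "c \<in> carrier \<Gamma>" using fg by (simp add: c_def)
  have cl: "f \<otimes>\<^bsub>\<Gamma>\<^esub> g \<in> carrier \<Gamma>" "g \<otimes>\<^bsub>\<Gamma>\<^esub> f \<in> carrier \<Gamma>" using fg by auto
  have cgf: "c \<otimes>\<^bsub>\<Gamma>\<^esub> (g \<otimes>\<^bsub>\<Gamma>\<^esub> f) = f \<otimes>\<^bsub>\<Gamma>\<^esub> g" using cl by (simp add: c_def \<Gamma>.m_assoc)
  have "finite {c}" "{c} \<subseteq> carrier \<Gamma>" using c by auto
  then obtain q where q: "0 < q" "\<And>h. h \<in> {c} \<Longrightarrow> period q dvd residue q h \<Longrightarrow> h = \<one>\<^bsub>\<Gamma>\<^esub>"
    by (rule separated) blast
  have 1: "period q dvd residue q (f \<otimes>\<^bsub>\<Gamma>\<^esub> g) - (residue q c + residue q (g \<otimes>\<^bsub>\<Gamma>\<^esub> f))"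
    using residue_mult[OF c cl(2) q(1)] by (simp only: cgf)
  have 2: "period q dvd residue q (f \<otimes>\<^bsub>\<Gamma>\<^esub> g) - (residue q f + residue q g)" by (rule residue_mult[OF fg q(1)])
  have 3: "period q dvd residue q (g \<otimes>\<^bsub>\<Gamma>\<^esub> f) - (residue q g + residue q f)" by (rule residue_mult[OF fg(2,1) q(1)])
  from dvd_diff[OF dvd_diff[OF 2 3] 1] have "period q dvd residue q c" by (simp add: algebra_simps)
  then have "c = \<one>\<^bsub>\<Gamma>\<^esub>" using q(2) by blast
  then show "f \<otimes>\<^bsub>\<Gamma>\<^esub> g = g \<otimes>\<^bsub>\<Gamma>\<^esub> f" using cgf cl by simp
qed

lemma \<sigma>_infinite_order:
  assumes inf: "infinite X" and k: "\<sigma> [^]\<^bsub>\<Gamma>\<^esub> (k::int) = \<one>\<^bsub>\<Gamma>\<^esub>" shows "k = 0"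
proof (rule ccontr)
  assume "k \<noteq> 0"
  have s: "sh k x0 = x0" using \<sigma>_pow[OF x0, of k] one_apply[OF x0] k by simp
  then have "sh (-k) (sh k x0) = sh (-k) x0" by simp
  then have s': "sh (-k) x0 = x0" by simp
  show False
    using finite_if_periodic[OF x0 s] finite_if_periodic[OF x0 s'] inf \<open>k \<noteq> 0\<close> by linarith
qed

theorem \<Gamma>_iso_integers_times_cyclic:
  assumes inf: "infinite X" and towers: "\<And>h. towers K h"
  shows "\<exists>m>0. \<Gamma> \<cong> integer_group \<times>\<times> integer_mod_group m"
proof -
  interpret C: comm_group \<Gamma> by (rule comm_group_\<Gamma>)
  show ?thesis
  proof (rule C.virtually_cyclic_iso[OF \<sigma>_in, where N = "crowd_bound K K"])
    fix k :: int assume "\<sigma> [^]\<^bsub>\<Gamma>\<^esub> k = \<one>\<^bsub>\<Gamma>\<^esub>"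
    then show "k = 0" by (rule \<sigma>_infinite_order[OF inf])
  next
    fix F assume "finite F" "F \<subseteq> carrier \<Gamma>"
      and "\<And>f g k. f \<in> F \<Longrightarrow> g \<in> F \<Longrightarrow> f \<noteq> g \<Longrightarrow> inv\<^bsub>\<Gamma>\<^esub> f \<otimes>\<^bsub>\<Gamma>\<^esub> g \<noteq> \<sigma> [^]\<^bsub>\<Gamma>\<^esub> (k::int)"
    then show "card F < crowd_bound K K"
      by (intro few_automorphisms_mod_shift[OF C.m_comm towers])
  next
    fix F assume "finite F" "F \<subseteq> carrier \<Gamma>"
    then obtain q where q: "0 < q" "\<And>f. f \<in> F \<Longrightarrow> period q dvd residue q f \<Longrightarrow> f = \<one>\<^bsub>\<Gamma>\<^esub>"
      by (rule separated) blast
    then show "\<exists>(e::int) \<rho>. 0 < e \<and> (\<forall>f\<in>carrier \<Gamma>. \<forall>g\<in>carrier \<Gamma>. e dvd \<rho> (f \<otimes>\<^bsub>\<Gamma>\<^esub> g) - (\<rho> f + \<rho> g)) \<and>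
        (\<forall>f\<in>F. e dvd \<rho> f \<longrightarrow> f = \<one>\<^bsub>\<Gamma>\<^esub>)"
      using period(1)[OF q(1)] residue_mult[OF _ _ q(1)] by (intro exI[of _ "period q"] exI[of _ "residue q"]) blast
  qed
qed

end

lemma toeplitz_subshift_subshift:
  assumes "finite A" "\<forall>i. x i \<in> A" "X = full_shift A closure_of (range (\<lambda>n i. x (i + n)))"
  shows "subshift A X" "x \<in> X"
proof -
  have orb: "range (\<lambda>n i. x (i + n)) = range (\<lambda>t. sh t x)" by (simp add: sh_def)
  have X: "y \<in> X \<longleftrightarrow> (\<forall>i. y i \<in> A) \<and> (\<forall>w. \<exists>t. agree w y (sh t x))" for y
  proof -
    have "range (\<lambda>t. sh t x) \<subseteq> {x. \<forall>i. x i \<in> A}" using assms(2) by (auto simp: sh_apply)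
    from in_closure_full_shift_iff[OF this] show ?thesis unfolding assms(3) orb by simp
  qed
  have "agree w x (sh 0 x)" for w by simp
  then show "x \<in> X" using assms(2) X by blast
  have shX: "sh s y \<in> X" if y: "y \<in> X" for s y
  proof -
    have "\<exists>t. agree w (sh s y) (sh t x)" for w
    proof -
      obtain t where "agree (w + nat \<bar>s\<bar>) y (sh t x)" using y X by blast
      then have "agree w (sh s y) (sh s (sh t x))" by (rule agree_sh) simp
      then show ?thesis by auto
    qed
    then show ?thesis using y by (simp add: X sh_apply)
  qed
  have "shift ` X = X" using shX by (rule shift_image_eq)
  moreover have "closedin (full_shift A) X" unfolding assms(3) by (rule closedin_closure_of)
  ultimately show "subshift A X" using assms(1) by (simp add: subshift_def)
qed

theorem toeplitz_finite_rank_automorphisms: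
  assumes T: "toeplitz_subshift A X" and rank: "finite_topological_rank (shift_top A X) shift"
  shows "\<exists>m>0. automorphism_group (shift_top A X) shift \<cong> integer_group \<times>\<times> integer_mod_group m"
proof -
  obtain x where x: "finite A" "\<forall>i. x i \<in> A" "toeplitz_sequence x"
      "X = full_shift A closure_of (range (\<lambda>n i. x (i + n)))"
    using T unfolding toeplitz_subshift_def by blast
  note sub = toeplitz_subshift_subshift[OF x(1,2,4)]
  note r = finite_rank_towers[OF sub(1) rank]
  interpret minimal_subshift A X by (rule r(1))
  interpret toeplitz_system A X x by unfold_locales (rule sub(2), rule x(3))
  obtain K where "\<And>h. towers K h" using r(3) by blast
  then show ?thesis by (rule \<Gamma>_iso_integers_times_cyclic[OF r(2)])
qed

section \<open>S-adic subshifts of constant length\<close>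

lemma sublist_nthI:
  assumes "d + length u \<le> length v" "\<And>k. k < length u \<Longrightarrow> u ! k = v ! (d + k)"
  shows "sublist u v"
proof -
  have "u = take (length u) (drop d v)" using assms by (intro nth_equalityI) auto
  then have "v = take d v @ u @ drop (length u) (drop d v)" by (metis append_take_drop_id)
  then show ?thesis unfolding sublist_def by blast
qed

lemma sublist_nthD:
  assumes "sublist u v"
  obtains d where "d + length u \<le> length v" "\<And>k. k < length u \<Longrightarrow> u ! k = v ! (d + k)"
proof -
  obtain ps ss where "v = ps @ u @ ss" using assms by (auto simp: sublist_def)
  then show ?thesis using that[of "length ps"] by (simp add: nth_append)
qed

lemma length_concat_const:
  "(\<And>x. x \<in> set xs \<Longrightarrow> length (f x) = L) \<Longrightarrow> length (concat (map f xs)) = length xs * L"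
  by (induction xs) auto

lemma nth_concat_const:
  assumes "\<And>x. x \<in> set xs \<Longrightarrow> length (f x) = L" "i < length xs * L"
  shows "concat (map f xs) ! i = f (xs ! (i div L)) ! (i mod L)"
  using assms
proof (induction xs arbitrary: i)
  case (Cons x xs)
  have L: "length (f x) = L" "0 < L" using Cons.prems by (auto intro: gr0I)
  show ?case
  proof (cases "i < L")
    case False
    then have "i div L = Suc ((i - L) div L)" "i mod L = (i - L) mod L"
      using L by (simp_all add: le_div_geq le_mod_geq)
    moreover have "concat (map f xs) ! (i - L) = f (xs ! ((i - L) div L)) ! ((i - L) mod L)"
      using Cons.prems False by (intro Cons.IH) auto
    ultimately show ?thesis using False L by (simp add: nth_append)
  qed (use L in \<open>simp add: nth_append\<close>)
qed simp

lemma word_morphism_concat_map: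
  assumes "\<And>a. a \<in> A \<Longrightarrow> f a \<noteq> [] \<and> set (f a) \<subseteq> B"
  shows "word_morphism A B (concat \<circ> map f)"
  using assms unfolding word_morphism_def by fastforce

lemma cut_const:
  assumes "\<And>i. length (f (y i)) = L"
  shows "cut (concat \<circ> map f) y k = k * int L"
  using assms by (simp add: cut_def)

lemma morph_seq_const:
  assumes len: "\<And>i. length (f (y i)) = L" and L: "0 < L"
  shows "morph_seq (concat \<circ> map f) y i = f (y (i div int L)) ! nat (i mod int L)"
proof -
  have "(THE k. k * int L \<le> i \<and> i < (k + 1) * int L) = i div int L"
  proof (rule the_equality)
    show "i div int L * int L \<le> i \<and> i < (i div int L + 1) * int L"
      using L by (simp add: distrib_right div_times_less_eq_dividend dividend_less_div_times minus_mod_eq_div_mult[symmetric])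
  next
    fix k assume "k * int L \<le> i \<and> i < (k + 1) * int L"
    then show "k = i div int L" using L by (intro int_div_pos_eq[symmetric, where r = "i - k * int L"]) (auto simp: algebra_simps)
  qed
  moreover have "i - i div int L * int L = i mod int L" by (simp add: minus_div_mult_eq_mod)
  ultimately show ?thesis unfolding morph_seq_def cut_const[where f = f and y = y and L = L, OF len] Let_def by simp
qed

lemma funpow_shift: "(shift ^^ k) x = sh (int k) x"
proof (induction k)
  case (Suc k)
  have "(shift ^^ Suc k) x = sh 1 (sh (int k) x)" using Suc by (simp add: shift_eq_sh)
  then show ?case by (simp only: sh_sh of_nat_Suc)
qed simp

text \<open>The letter \<open>c\<close> marks the position \<open>q0\<close> inside every image word except \<open>f z\<close>, and it occurs nowhere else. So
  a single occurrence of \<open>c\<close> pins down all cutting points.\<close>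

lemma marker_recognizable:
  fixes f :: "nat \<Rightarrow> nat list" and x :: "int \<Rightarrow> nat"
  assumes len: "\<And>a. a \<in> D \<Longrightarrow> length (f a) = L" and inj: "inj_on f D"
    and mark: "\<And>a q. a \<in> D \<Longrightarrow> q < L \<Longrightarrow> f a ! q = c \<longleftrightarrow> q = q0 \<and> a \<noteq> z" and q0: "q0 < L"
    and Y: "\<And>y i. y \<in> Y \<Longrightarrow> y i \<in> D" "\<And>y. y \<in> Y \<Longrightarrow> \<exists>i. y i \<noteq> z"
  shows "\<exists>\<^sub>\<le>\<^sub>1 (y, k). y \<in> Y \<and> k < length ((concat \<circ> map f) [y 0]) \<and> x = (shift ^^ k) (morph_seq (concat \<circ> map f) y)"
proof -
  have L: "0 < L" using q0 by simp
  have form: "x i = f (y ((i + int k) div int L)) ! nat ((i + int k) mod int L)"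
    if "y \<in> Y" "x = (shift ^^ k) (morph_seq (concat \<circ> map f) y)" for y k i
    using that(2) morph_seq_const[of f y L "i + int k"] len[OF Y(1)[OF that(1)]] L by (simp add: funpow_shift sh_apply)
  have "y = y' \<and> k = k'" if y: "y \<in> Y" "k < L" "x = (shift ^^ k) (morph_seq (concat \<circ> map f) y)"
    and y': "y' \<in> Y" "k' < L" "x = (shift ^^ k') (morph_seq (concat \<circ> map f) y')" for y k y' k'
  proof -
    have k: "k = k'"
    proof -
      obtain i1 where i1: "y i1 \<noteq> z" using Y(2) y(1) by blast
      define i where "i = i1 * int L + int q0 - int k"
      have "(i + int k) div int L = i1" "(i + int k) mod int L = int q0" using q0 by (simp_all add: i_def)
      then have "x i = c" using form[OF y(1,3), of i] mark[OF Y(1)[OF y(1)], of q0 i1] i1 q0 by simp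
      moreover have "nat ((i + int k') mod int L) < L" using L by (simp add: nat_less_iff)
      ultimately have "nat ((i + int k') mod int L) = q0"
        using form[OF y'(1,3), of i] mark[OF Y(1)[OF y'(1)], of "nat ((i + int k') mod int L)"] by simp
      then have "(i + int k') mod int L = (i + int k) mod int L"
        using \<open>(i + int k) mod int L = int q0\<close> L by (metis int_nat_eq of_nat_0_less_iff pos_mod_sign)
      then have "int L dvd int k' - int k" by (simp add: mod_eq_dvd_iff)
      then have "int k' mod int L = int k mod int L" by (simp add: mod_eq_dvd_iff)
      then show ?thesis using y(2) y'(2) by simp
    qed
    have "y j = y' j" for j
    proof (rule inj_onD[OF inj _ Y(1)[OF y(1)] Y(1)[OF y'(1)]], rule nth_equalityI)
      show "length (f (y j)) = length (f (y' j))" using len Y(1) y(1) y'(1) by simp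
      fix q assume "q < length (f (y j))"
      then have q: "q < L" using len Y(1) y(1) by simp
      define i where "i = j * int L + int q - int k"
      have "(i + int k) div int L = j" "(i + int k) mod int L = int q" using q by (simp_all add: i_def)
      then show "f (y j) ! q = f (y' j) ! q" using form[OF y(1,3), of i] form[OF y'(1,3), of i] k by simp
    qed
    then show ?thesis using k by blast
  qed
  moreover have "length ((concat \<circ> map f) [y 0]) = L" if "y \<in> Y" for y using len Y(1)[OF that] by simp
  ultimately show ?thesis unfolding Uniq_def by auto
qed

lemma foldr_comp_snoc: "foldr (\<circ>) (xs @ [g]) id = foldr (\<circ>) xs id \<circ> g"
  by (induction xs) auto

lemma seg_Suc: "n \<le> N \<Longrightarrow> seg \<tau> n (Suc N) w = seg \<tau> n N (\<tau> N w)"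
proof -
  assume "n \<le> N"
  then have "map \<tau> [n..<Suc N] = map \<tau> [n..<N] @ [\<tau> N]" by simp
  then show ?thesis by (simp only: seg_def foldr_comp_snoc comp_apply)
qed

lemma seg_first: "n < N \<Longrightarrow> seg \<tau> n N w = \<tau> n (seg \<tau> (Suc n) N w)"
  by (simp add: seg_def upt_conv_Cons)

lemma seg_refl [simp]: "seg \<tau> n n w = w" by (simp add: seg_def)

lemma map_upto_nth: "k < length [i..j] \<Longrightarrow> map x [i..j] ! k = x (i + int k)"
  by (simp add: nth_upto)

text \<open>Membership in an S-adic subshift depends on the finite subwords only.\<close>

lemma level_shift_windows:
  assumes x: "x \<in> level_shift D \<tau> n" and y: "\<And>i. y i \<in> D n"
    and win: "\<And>w. \<exists>t. agree w y (sh t x)"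
  shows "y \<in> level_shift D \<tau> n"
proof -
  have "\<exists>N>n. \<exists>a\<in>D N. sublist (map y [i..j]) (seg \<tau> n N [a])" for i j
  proof -
    obtain t where t: "agree (nat (\<bar>i\<bar> + \<bar>j\<bar>)) y (sh t x)" using win by blast
    have "map y [i..j] = map x [i + t..j + t]"
    proof (rule nth_equalityI)
      fix k assume "k < length (map y [i..j])"
      then have k: "int k \<le> j - i" by simp
      have "y (i + int k) = x (i + int k + t)" using t k unfolding agree_def by (simp add: sh_apply)
      then show "map y [i..j] ! k = map x [i + t..j + t] ! k" using k by (simp add: nth_upto algebra_simps)
    qed simp
    then show ?thesis using x unfolding level_shift_def by fastforce
  qed
  then show ?thesis using y by (simp add: level_shift_def)
qed

lemma subshift_level_shift:
  assumes fin: "finite (D n)" shows "subshift (D n) (level_shift D \<tau> n)"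
proof -
  let ?X = "level_shift D \<tau> n"
  have shX: "sh s x \<in> ?X" if x: "x \<in> ?X" for s x
  proof (rule level_shift_windows[OF x])
    show "sh s x i \<in> D n" for i using x by (simp add: level_shift_def sh_apply)
    show "\<exists>t. agree w (sh s x) (sh t x)" for w by (rule exI[of _ s]) simp
  qed
  have "shift ` ?X = ?X" using shX by (rule shift_image_eq)
  moreover have "closedin (full_shift (D n)) ?X"
    unfolding closedin_full_shift_iff
  proof (intro conjI allI impI)
    show "?X \<subseteq> {x. \<forall>i. x i \<in> D n}" by (auto simp: level_shift_def)
    fix x assume xD: "\<forall>i. x i \<in> D n" and win: "\<forall>w. \<exists>y\<in>?X. agree w x y"
    have "\<exists>N>n. \<exists>a\<in>D N. sublist (map x [i..j]) (seg \<tau> n N [a])" for i j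
    proof -
      obtain y where y: "y \<in> ?X" "agree (nat (\<bar>i\<bar> + \<bar>j\<bar>)) x y" using win by blast
      have eq: "map x [i..j] = map y [i..j]" using y(2) by (auto simp: agree_def)
      have "\<exists>N>n. \<exists>a\<in>D N. sublist (map y [i..j]) (seg \<tau> n N [a])" using y(1) by (simp add: level_shift_def)
      then show ?thesis by (simp only: eq)
    qed
    then show "x \<in> ?X" using xD by (simp add: level_shift_def)
  qed
  ultimately show ?thesis using fin by (simp add: subshift_def)
qed

section \<open>A family of S-adic Toeplitz subshifts\<close>

text \<open>Let \<open>P = 2 m + 1\<close> and let \<open>y\<close> be the Toeplitz sequence whose entry at \<open>i\<close> is the parity of the exponent
  of \<open>P\<close> in \<open>2 i + 1\<close>. The subshift of this locale is generated by the sequence of pairs \<open>(y i, i mod m)\<close>. Since \<open>P\<close> is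
  congruent to \<open>1\<close> modulo \<open>m\<close>, the two components are independent of each other, and adding a constant to the second
  one is an automorphism of order \<open>m\<close>.

  In a window of \<open>m\<close> consecutive positions at most one entry of \<open>y\<close> is \<open>1\<close>, which makes \<open>m + 1\<close> possible
  windows; the letter \<open>t < m\<close> stands for a \<open>1\<close> at place \<open>t\<close>, the letter \<open>m\<close> for no \<open>1\<close>. The
  sequence satisfies \<open>y (P * i + m) = 1 - y i\<close> and vanishes at the other positions; read in windows of
  length \<open>m\<close> this is the substitution \<open>\<theta>\<close>. Every word \<open>\<theta> a\<close> begins and ends with \<open>m\<close>, which is the reason for
  the choice of \<open>P\<close> and of \<open>2 i + 1\<close> instead of \<open>i\<close>.\<close>

locale torsion_toeplitz =
  fixes m :: nat
  assumes m: "1 \<le> m"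
begin

definition P :: nat where "P = 2 * m + 1"

definition \<theta> :: "nat \<Rightarrow> nat list" where
  "\<theta> a = map (\<lambda>r. if odd r \<and> r div 2 \<noteq> a then r div 2 else m) [0..<P]"

text \<open>A pair \<open>(v, s)\<close> is coded as \<open>v * m + s\<close>, and \<open>block 0 a\<close> is the window with letter \<open>a\<close>. The first morphism of
  the directive sequence is \<open>block 1\<close>, because the words \<open>block 0 a\<close> do not all start with the same letter.\<close>

fun block :: "nat \<Rightarrow> nat \<Rightarrow> nat list" where
  "block 0 a = map (\<lambda>i. (if i = a then m else 0) + i) [0..<m]"
| "block (Suc N) a = concat (map (block N) (\<theta> a))"

definition D :: "nat \<Rightarrow> nat set" where "D n = (if n = 0 then {0..<2 * m} else {0..m})"

definition \<tau> :: "nat \<Rightarrow> nat list \<Rightarrow> nat list" where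
  "\<tau> n = (if n = 0 then concat \<circ> map (block 1) else concat \<circ> map \<theta>)"

lemma \<tau>_0: "\<tau> 0 = concat \<circ> map (block 1)" and \<tau>_pos: "0 < n \<Longrightarrow> \<tau> n = concat \<circ> map \<theta>"
  by (simp_all add: \<tau>_def)

lemma length_\<theta> [simp]: "length (\<theta> a) = P" by (simp add: \<theta>_def)

lemma \<theta>_nth: "r < P \<Longrightarrow> \<theta> a ! r = (if odd r \<and> r div 2 \<noteq> a then r div 2 else m)"
  by (simp add: \<theta>_def)

lemma set_\<theta>: "set (\<theta> a) \<subseteq> {0..m}" by (auto simp: \<theta>_def P_def)

lemma length_block: "length (block N a) = m * P ^ N"
proof (induction N arbitrary: a)
  case (Suc N)
  have "length (block (Suc N) a) = length (\<theta> a) * (m * P ^ N)"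
    using length_concat_const[of "\<theta> a" "block N" "m * P ^ N"] Suc by simp
  then show ?case by simp
qed simp

lemma block_Suc_nth:
  assumes "i < m * P ^ Suc N"
  shows "block (Suc N) a ! i = block N (\<theta> a ! (i div (m * P ^ N))) ! (i mod (m * P ^ N))"
  using nth_concat_const[of "\<theta> a" "block N" "m * P ^ N" i] length_block assms by (simp add: mult_ac)

lemma block_1_nth: "i < m * P \<Longrightarrow> block 1 a ! i = (if i mod m = \<theta> a ! (i div m) then m else 0) + i mod m"
  using block_Suc_nth[of i 0 a] m by simp

lemma set_block_0: "set (block 0 a) \<subseteq> {0..<2 * m}" by auto

lemma set_block: "set (block N a) \<subseteq> {0..<2 * m}"
proof (induction N arbitrary: a)
  case 0 show ?case by (rule set_block_0)
next
  case (Suc N)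
  then show ?case by fastforce
qed

lemma \<theta>_m: "m \<in> set (\<theta> a)"
proof -
  have "\<theta> a ! 0 = m" "0 < length (\<theta> a)" by (simp_all add: \<theta>_nth P_def)
  then show ?thesis by (metis nth_mem)
qed

lemma set_\<theta>_m: "{0..m} \<subseteq> set (\<theta> m)"
proof
  fix t assume t: "t \<in> {0..m}"
  show "t \<in> set (\<theta> m)"
  proof (cases "t = m")
    case False
    then have "\<theta> m ! (2 * t + 1) = t" "2 * t + 1 < length (\<theta> m)" using t by (auto simp: \<theta>_nth P_def)
    then show ?thesis by (metis nth_mem)
  qed (simp add: \<theta>_m)
qed

lemma hd_last_\<theta>: "hd (\<theta> a) = m" "last (\<theta> a) = m"
proof -
  have ne: "\<theta> a \<noteq> []" by (metis length_\<theta> P_def add_is_0 list.size(3) one_neq_zero)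
  have "hd (\<theta> a) = \<theta> a ! 0" using ne by (rule hd_conv_nth)
  then show "hd (\<theta> a) = m" by (simp add: \<theta>_nth P_def)
  have "last (\<theta> a) = \<theta> a ! (P - 1)" using ne by (simp add: last_conv_nth)
  then show "last (\<theta> a) = m" by (simp add: \<theta>_nth P_def)
qed

lemma directive: "directive_sequence D \<tau>"
  unfolding directive_sequence_def
proof (intro allI conjI)
  fix n
  show "finite (D n)" "D n \<noteq> {}" using m by (auto simp: D_def)
  have "block 1 a \<noteq> [] \<and> set (block 1 a) \<subseteq> {0..<2 * m}" for a
    using length_block[of 1 a] set_block[of 1 a] m by (auto simp: P_def simp del: block.simps)
  moreover have "\<theta> a \<noteq> [] \<and> set (\<theta> a) \<subseteq> {0..m}" for a
    using \<theta>_m[of a] set_\<theta>[of a] by auto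
  ultimately show "word_morphism (D (Suc n)) (D n) (\<tau> n)"
    by (auto simp: D_def \<tau>_def simp del: block.simps intro!: word_morphism_concat_map)
qed

lemma constlen: "constant_length D \<tau>"
  using length_block[of 1] by (simp add: constant_length_def \<tau>_def del: block.simps)

lemma hd_last_block1: "hd (block 1 a) = hd (block 0 m)" "last (block 1 a) = last (block 0 m)"
proof -
  have ne: "block 0 c \<noteq> []" for c using m by simp
  obtain us vs where \<theta>1: "\<theta> a = m # us" and \<theta>2: "\<theta> a = vs @ [m]"
  proof -
    have n: "\<theta> a \<noteq> []" using \<theta>_m[of a] by auto
    show ?thesis using that[of "tl (\<theta> a)" "butlast (\<theta> a)"] n hd_last_\<theta>[of a]
      by (metis append_butlast_last_id list.collapse)
  qed
  have "block 1 a = block 0 m @ concat (map (block 0) us)" using \<theta>1 by simp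
  then show "hd (block 1 a) = hd (block 0 m)" using ne by (simp only: hd_append if_False)
  have "block 1 a = concat (map (block 0) vs) @ block 0 m" using \<theta>2 by simp
  then show "last (block 1 a) = last (block 0 m)" using ne by (simp only: last_append if_False)
qed

lemma is_proper: "proper D \<tau>"
  using hd_last_block1 hd_last_\<theta> by (simp add: proper_def \<tau>_def del: block.simps)

lemma seg_0: "1 \<le> N \<Longrightarrow> seg \<tau> 0 N w = concat (map (block N) w)"
proof (induction N arbitrary: w rule: nat_induct_at_least)
  case base
  show ?case using seg_Suc[of 0 0 \<tau> w] by (simp add: \<tau>_0 del: block.simps)
next
  case (Suc N)
  have "seg \<tau> 0 (Suc N) w = concat (map (block N) (concat (map \<theta> w)))"
    using Suc seg_Suc[of 0 N \<tau> w] by (simp add: \<tau>_pos)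
  also have "\<dots> = concat (map (block (Suc N)) w)" by (induction w) simp_all
  finally show ?case .
qed

lemma is_primitive: "primitive D \<tau>"
  unfolding primitive_def
proof
  fix n
  show "\<exists>N>n. \<forall>a\<in>D N. D n \<subseteq> set (seg \<tau> n N [a])"
  proof (cases "n = 0")
    case True
    have "{0..<2 * m} \<subseteq> set (block 1 m)"
    proof
      fix t assume t: "t \<in> {0..<2 * m}"
      define c where "c = (if t < m then m else t - m)"
      have "c \<in> set (\<theta> m)" using set_\<theta>_m t by (auto simp: c_def)
      moreover have "t \<in> set (block 0 c)" using t by (auto simp: c_def image_iff intro: bexI[of _ "t - m"])
      ultimately show "t \<in> set (block 1 m)" by auto
    qed
    moreover have "set (block 1 m) \<subseteq> set (seg \<tau> 0 2 [a])" for a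
      using \<theta>_m[of a] seg_0[of 2 "[a]"] by (auto simp: numeral_2_eq_2)
    ultimately show ?thesis using True by (intro exI[of _ 2]) (auto simp: D_def simp del: block.simps)
  next
    case False
    have "{0..m} \<subseteq> set (seg \<tau> n (n + 2) [a])" for a
    proof -
      have "seg \<tau> n (n + 2) [a] = concat (map \<theta> (\<theta> a))"
        using False seg_Suc[of n "Suc n" \<tau> "[a]"] seg_Suc[of n n \<tau>] by (simp add: \<tau>_pos)
      then show ?thesis using \<theta>_m[of a] set_\<theta>_m by auto
    qed
    then show ?thesis using False by (intro exI[of _ "n + 2"]) (auto simp: D_def)
  qed
qed

text \<open>A window of length \<open>P\<close> contains the first letter of some \<open>\<theta> a\<close>, and this letter is \<open>m\<close>.\<close>

lemma nonzero_letter: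
  assumes y: "y \<in> level_shift D \<tau> (Suc n)" shows "\<exists>i. y i \<noteq> 0"
proof -
  obtain N a where N: "Suc n < N" and sub: "sublist (map y [0..int P - 1]) (seg \<tau> (Suc n) N [a])"
  proof -
    have "\<exists>N>Suc n. \<exists>a\<in>D N. sublist (map y [0..int P - 1]) (seg \<tau> (Suc n) N [a])"
      using y by (simp add: level_shift_def)
    then show ?thesis using that by blast
  qed
  define w where "w = seg \<tau> (Suc (Suc n)) N [a]"
  have s: "seg \<tau> (Suc n) N [a] = concat (map \<theta> w)" using seg_first[OF N, of \<tau> "[a]"] by (simp add: \<tau>_pos w_def)
  have P0: "0 < P" by (simp add: P_def)
  obtain d where d: "d + P \<le> length (concat (map \<theta> w))"
    and eq: "\<And>k. k < P \<Longrightarrow> y (int k) = concat (map \<theta> w) ! (d + k)"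
    using sub unfolding s by (rule sublist_nthD) (auto simp: nth_upto)
  define k where "k = (P - d mod P) mod P"
  have k: "k < P" using P0 by (simp add: k_def)
  have "(d + k) mod P = 0"
  proof -
    have "d mod P < P" using P0 by simp
    then have "d + (P - d mod P) = d div P * P + P" using div_mult_mod_eq[of d P] by linarith
    then show ?thesis by (simp add: k_def mod_simps)
  qed
  moreover have "d + k < length w * P" using k d length_concat_const[of w \<theta> P] by simp
  ultimately have "concat (map \<theta> w) ! (d + k) = \<theta> (w ! ((d + k) div P)) ! 0"
    using nth_concat_const[of w \<theta> P "d + k"] by simp
  then have "y (int k) = m" using eq[OF k] P0 by (simp add: \<theta>_nth)
  then show ?thesis using m by (intro exI[of _ "int k"]) simp
qed

lemma \<theta>_inj: "inj_on \<theta> {0..m}"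
proof (rule inj_onI)
  have *: "a = a'" if "a < m" "\<theta> a = \<theta> a'" for a a'
  proof (rule ccontr)
    assume "a \<noteq> a'"
    then have "\<theta> a ! (2 * a + 1) = m" "\<theta> a' ! (2 * a + 1) = a" using that(1) by (simp_all add: \<theta>_nth P_def)
    then show False using that by simp
  qed
  fix a a' assume "a \<in> {0..m}" "a' \<in> {0..m}" "\<theta> a = \<theta> a'"
  then show "a = a'" using *[of a a'] *[of a' a] by (cases "a < m"; cases "a' < m") auto
qed

lemma block1_inj: "inj_on (block 1) {0..m}"
proof (rule inj_onI)
  have *: "a = a'" if a: "a < m" and eq: "block 1 a = block 1 a'" for a a'
  proof (rule ccontr)
    assume ne: "a \<noteq> a'"
    define i where "i = (2 * a + 1) * m + a"
    have "2 * a + 1 < P" using a by (simp add: P_def)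
    have "(2 * a + 2) * m \<le> P * m" using a by (intro mult_right_mono) (simp_all add: P_def)
    then have i: "i < m * P" using a by (simp add: i_def mult.commute)
    have i': "i = a + (2 * a + 1) * m" by (simp only: i_def add.commute)
    have "i div m = (2 * a + 1) + a div m" unfolding i' by (rule div_mult_self1) (use m in simp)
    moreover have "i mod m = a mod m" unfolding i' by (rule mod_mult_self1)
    ultimately have di: "i div m = 2 * a + 1" "i mod m = a" using a by simp_all
    have "\<theta> a ! (2 * a + 1) = m" "\<theta> a' ! (2 * a + 1) = a" using a ne by (simp_all add: \<theta>_nth P_def)
    then have "block 1 a ! i = a" "block 1 a' ! i = m + a"
      using block_1_nth[OF i, of a] block_1_nth[OF i, of a'] a di by simp_all
    then show False using eq m by simp
  qed
  fix a a' assume "a \<in> {0..m}" "a' \<in> {0..m}" "block 1 a = block 1 a'"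
  then show "a = a'" using *[of a a'] *[of a' a] by (cases "a < m"; cases "a' < m") (auto simp del: block.simps)
qed

lemma is_recognizable: "recognizable D \<tau>"
  unfolding recognizable_def
proof (intro allI impI)
  fix n and x :: "int \<Rightarrow> nat"
  have Y: "y i \<in> {0..m}" if "y \<in> level_shift D \<tau> (Suc n)" for y i
    using that by (auto simp: level_shift_def D_def)
  show "\<exists>\<^sub>\<le>\<^sub>1 (y, k). y \<in> level_shift D \<tau> (Suc n) \<and> k < length (\<tau> n [y 0]) \<and> x = (shift ^^ k) (morph_seq (\<tau> n) y)"
  proof (cases "n = 0")
    case True
    have t: "\<tau> n = concat \<circ> map (block 1)" using True by (simp add: \<tau>_def)
    show ?thesis unfolding t
    proof (rule marker_recognizable[where D = "{0..m}" and L = "m * P" and c = m and ?q0.0 = m and z = 0])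
      show "length (block 1 a) = m * P" for a using length_block[of 1 a] by simp
      show "m < m * P" using m by (simp add: P_def)
      \<comment> \<open>The letter \<open>m\<close> codes the pair \<open>(1, 0)\<close>.\<close>
      show "block 1 a ! q = m \<longleftrightarrow> q = m \<and> a \<noteq> 0" if "a \<in> {0..m}" "q < m * P" for a q
      proof -
        have qd: "q div m < P" using that(2) by (simp add: less_mult_imp_div_less mult.commute)
        have "q mod m < m" using m by simp
        then have "block 1 a ! q = m \<longleftrightarrow> q mod m = 0 \<and> \<theta> a ! (q div m) = 0" using block_1_nth[OF that(2), of a] by auto
        also have "\<dots> \<longleftrightarrow> q mod m = 0 \<and> q div m = 1 \<and> a \<noteq> 0"
          using \<theta>_nth[OF qd, of a] m by (auto simp: odd_pos elim!: oddE)
        also have "q mod m = 0 \<and> q div m = 1 \<and> a \<noteq> 0 \<longleftrightarrow> q = m \<and> a \<noteq> 0"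
        proof -
          have "q = m" if "q mod m = 0" "q div m = 1" using div_mult_mod_eq[of q m] that by simp
          then show ?thesis using m by auto
        qed
        finally show ?thesis .
      qed
    qed (use block1_inj Y nonzero_letter in auto)
  next
    case False
    have t: "\<tau> n = concat \<circ> map \<theta>" using False by (simp add: \<tau>_def)
    show ?thesis unfolding t
    proof (rule marker_recognizable[where D = "{0..m}" and L = P and c = 0 and ?q0.0 = 1 and z = 0])
      show "1 < P" using m by (simp add: P_def)
      show "\<theta> a ! q = 0 \<longleftrightarrow> q = 1 \<and> a \<noteq> 0" if "a \<in> {0..m}" "q < P" for a q
        using \<theta>_nth[OF that(2), of a] m by (auto simp: odd_pos elim!: oddE)
    qed (use \<theta>_inj Y nonzero_letter in auto)
  qed
qed

lemma rank: "alphabet_rank D \<le> enat (m + 1)"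
proof -
  have "\<forall>\<^sub>F n in sequentially. enat (card (D n)) = enat (m + 1)"
    unfolding eventually_sequentially by (rule exI[of _ 1]) (simp add: D_def)
  from Liminf_eq[OF this] show ?thesis by (simp add: alphabet_rank_def Liminf_const)
qed

end

section \<open>Automorphisms of the family\<close>

context torsion_toeplitz
begin

abbreviation q :: int where "q \<equiv> int P"

definition par :: "int \<Rightarrow> nat" where "par k = multiplicity q k mod 2"

lemma q_odd: "odd q" and q_gt: "1 < q" using m by (simp_all add: P_def)

lemma par_eqI: "q ^ e dvd k \<Longrightarrow> \<not> q ^ Suc e dvd k \<Longrightarrow> par k = e mod 2"
proof -
  assume "q ^ e dvd k" "\<not> q ^ Suc e dvd k"
  then have "multiplicity q k = e" by (rule multiplicity_eqI)
  then show ?thesis by (simp only: par_def)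
qed

lemma par_level:
  assumes "\<not> q ^ n dvd k"
  obtains e where "e < n" "q ^ e dvd k" "\<not> q ^ Suc e dvd k" "par k = e mod 2"
proof -
  define d where "d = (LEAST e. \<not> q ^ e dvd k)"
  have d: "\<not> q ^ d dvd k" "d \<le> n" unfolding d_def
    using LeastI[of "\<lambda>e. \<not> q ^ e dvd k" n, OF assms] Least_le[of "\<lambda>e. \<not> q ^ e dvd k" n, OF assms] by blast+
  have "d \<noteq> 0" using d(1) by (metis one_dvd power_0)
  then obtain e where e: "d = Suc e" using not0_implies_Suc by blast
  have "q ^ e dvd k"
  proof (rule ccontr)
    assume "\<not> ?thesis"
    then have "d \<le> e" unfolding d_def by (rule Least_le)
    then show False using e by simp
  qed
  then show ?thesis using that[of e] d e par_eqI[of e k] by auto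
qed

text \<open>Powers of \<open>P\<close> up to the \<open>n\<close>-th do not distinguish numbers that are congruent modulo \<open>P ^ n\<close>. The number \<open>P\<close>
  may be composite; the exponent meant here is that of the largest power of \<open>P\<close> dividing a number.\<close>

lemma par_cong:
  assumes n: "\<not> q ^ n dvd k" and d: "q ^ n dvd k - l"
  shows "par l = par k" "\<not> q ^ n dvd l"
proof -
  obtain e where e: "e < n" "q ^ e dvd k" "\<not> q ^ Suc e dvd k" "par k = e mod 2" using n by (rule par_level)
  have de: "q ^ j dvd k - l" if "j \<le> n" for j using d le_imp_power_dvd[OF that, of q] dvd_trans by blast
  have iff: "q ^ j dvd k \<longleftrightarrow> q ^ j dvd l" if "j \<le> n" for j
    using de[OF that] by (metis dvd_add_right_iff diff_add_cancel dvd_diff_commute)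
  have "q ^ e dvd l" "\<not> q ^ Suc e dvd l" using e iff[of e] iff[of "Suc e"] by simp_all
  then show "par l = par k" using par_eqI e(4) by simp
  show "\<not> q ^ n dvd l" using n iff[of n] by simp
qed

lemma dvd_double: "q ^ e dvd 2 * k \<longleftrightarrow> q ^ e dvd k"
proof -
  have "coprime (q ^ e) 2" using q_odd by simp
  then show ?thesis by (rule coprime_dvd_mult_right_iff)
qed

lemma par_double: "\<not> q ^ n dvd k \<Longrightarrow> par (2 * k) = par k"
proof -
  assume "\<not> q ^ n dvd k"
  then obtain e where e: "q ^ e dvd k" "\<not> q ^ Suc e dvd k" "par k = e mod 2" by (rule par_level)
  have "par (2 * k) = e mod 2"
    by (rule par_eqI) (use e(1,2) in \<open>simp_all only: dvd_double not_False_eq_True\<close>)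
  then show ?thesis using e(3) by simp
qed

lemma par_less: "par k < 2" by (simp add: par_def)

lemma m_dvd: "int m dvd q ^ n - 1"
proof (induction n)
  case (Suc n)
  have "q ^ Suc n - 1 = q * (q ^ n - 1) + 2 * int m" by (simp add: P_def algebra_simps)
  then show ?case using Suc by (metis dvd_add dvd_mult dvd_triv_right)
qed simp

subsection \<open>The letters of the generating words\<close>

text \<open>The first component of the pair at place \<open>i\<close> in \<open>block N a\<close>. Only the \<open>m\<close> places where \<open>P ^ N\<close> divides
  \<open>2 i + 1\<close> depend on \<open>a\<close>.\<close>

definition bit :: "nat \<Rightarrow> nat \<Rightarrow> nat \<Rightarrow> nat" where
  "bit N a i = (if P ^ N dvd 2 * i + 1 then (N + (if (2 * i + 1) div P ^ N = 2 * a + 1 then 1 else 0)) mod 2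
     else par (int (2 * i + 1)))"

lemma nat_int_dvd: "P ^ N dvd k \<longleftrightarrow> q ^ N dvd int k"
  by (metis int_dvd_int_iff of_nat_power)

text \<open>The place \<open>J\<close> in the \<open>r\<close>-th factor of \<open>block (Suc N) a\<close> has been filled at level \<open>N\<close> unless \<open>P ^ N\<close>
  divides \<open>2 J + 1\<close>, say with quotient \<open>g\<close>. In that case one more factor \<open>P\<close> appears exactly if \<open>r = g\<close>,
  which is the place where \<open>\<theta> a\<close> depends on \<open>a\<close>.\<close>

lemma bit_Suc:
  assumes r: "r < P" and J: "J < m * P ^ N"
  shows "bit (Suc N) a (r * (m * P ^ N) + J) = bit N (\<theta> a ! r) J"
proof -
  define i where "i = r * (m * P ^ N) + J"
  have P0: "0 < P" by (simp add: P_def)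
  have i2: "2 * i + 1 = 2 * r * m * P ^ N + (2 * J + 1)" by (simp add: i_def)
  show ?thesis
  proof (cases "P ^ N dvd 2 * J + 1")
    case False
    have diff: "int (2 * J + 1) - int (2 * i + 1) = q ^ N * (- (2 * int r * int m))"
      unfolding i2 by simp
    have nJ: "\<not> q ^ N dvd int (2 * J + 1)" using False by (simp only: nat_int_dvd not_False_eq_True)
    have dd: "q ^ N dvd int (2 * J + 1) - int (2 * i + 1)" unfolding diff by (rule dvd_triv_left)
    note pc = par_cong[OF nJ dd]
    have "\<not> q ^ Suc N dvd int (2 * i + 1)"
      using pc(2) by (metis dvd_trans le_imp_power_dvd lessI less_imp_le_nat)
    then have "\<not> P ^ Suc N dvd 2 * i + 1" by (simp only: nat_int_dvd not_False_eq_True)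
    then show ?thesis using False pc(1) unfolding i_def[symmetric] by (simp only: bit_def if_False)
  next
    case True
    then obtain g where g: "2 * J + 1 = P ^ N * g" by blast
    have PN: "0 < P ^ N" using P0 by simp
    have "odd (P ^ N * g)" unfolding g[symmetric] by simp
    then have "odd g" by simp
    then obtain h where h: "g = 2 * h + 1" by (rule oddE)
    have "2 * J + 1 < 2 * (m * P ^ N)" using J by linarith
    also have "\<dots> = P ^ N * (2 * m)" by simp
    finally have "P ^ N * g < P ^ N * (2 * m)" unfolding g .
    then have "g < 2 * m" by simp
    then have hm: "h < m" using h by simp
    have i3: "2 * i + 1 = P ^ N * (2 * r * m + g)" unfolding i2 g by (simp add: algebra_simps)
    have "int (2 * r * m + g) = q * int r + (int g - int r)" by (simp add: P_def algebra_simps)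
    then have Pd: "P dvd 2 * r * m + g \<longleftrightarrow> q dvd int g - int r"
      by (metis dvd_add_right_iff dvd_triv_left int_dvd_int_iff)
    have "\<bar>int g - int r\<bar> < q" using r h hm by (simp add: P_def)
    then have Pd2: "P dvd 2 * r * m + g \<longleftrightarrow> r = g"
      unfolding Pd using zdvd_imp_le[of q "\<bar>int g - int r\<bar>"] by (cases "r = g") auto
    have "(2 * J + 1) div P ^ N = g" unfolding g using PN by simp
    then have bJ: "bit N c J = (N + (if h = c then 1 else 0)) mod 2" for c
      using True h by (simp add: bit_def)
    show ?thesis
    proof (cases "r = g")
      case rg: True
      have i4: "2 * i + 1 = P ^ Suc N * g" unfolding i3 rg by (simp add: P_def algebra_simps)
      have "(2 * i + 1) div P ^ Suc N = g" unfolding i4 using P0 by (simp del: power_Suc)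
      moreover have "P ^ Suc N dvd 2 * i + 1" unfolding i4 by (rule dvd_triv_left)
      ultimately have "bit (Suc N) a i = (Suc N + (if h = a then 1 else 0)) mod 2"
        using h by (simp add: bit_def del: power_Suc)
      moreover have "\<theta> a ! r = (if h = a then m else h)" using \<theta>_nth[OF r, of a] rg h by simp
      ultimately show ?thesis using bJ hm unfolding i_def[symmetric] by auto
    next
      case rg: False
      have n: "\<not> q ^ Suc N dvd int (2 * i + 1)"
      proof
        assume "q ^ Suc N dvd int (2 * i + 1)"
        then have "P ^ Suc N dvd P ^ N * (2 * r * m + g)" by (simp only: nat_int_dvd[symmetric] i3)
        then have "P ^ N * P dvd P ^ N * (2 * r * m + g)" by (simp add: mult.commute)
        then have "P dvd 2 * r * m + g" using P0 by (simp add: nat_mult_dvd_cancel_disj)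
        then show False using Pd2 rg by simp
      qed
      have "P ^ N dvd 2 * i + 1" unfolding i3 by (rule dvd_triv_left)
      then have "q ^ N dvd int (2 * i + 1)" by (simp only: nat_int_dvd)
      from par_eqI[OF this n] have "par (int (2 * i + 1)) = N mod 2" .
      moreover have "\<not> P ^ Suc N dvd 2 * i + 1" using n by (simp only: nat_int_dvd not_False_eq_True)
      ultimately have "bit (Suc N) a i = N mod 2" by (simp only: bit_def if_False)
      moreover have "\<theta> a ! r \<noteq> h" using \<theta>_nth[OF r, of a] rg h hm by (auto elim!: oddE)
      ultimately show ?thesis using bJ unfolding i_def[symmetric] by simp
    qed
  qed
qed

lemma block_nth: "i < m * P ^ N \<Longrightarrow> block N a ! i = bit N a i * m + i mod m"
proof (induction N arbitrary: a i)
  case 0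
  then show ?case by (simp add: bit_def)
next
  case (Suc N)
  define L where "L = m * P ^ N"
  have L0: "0 < L" using m by (simp add: L_def P_def)
  define r J where "r = i div L" and "J = i mod L"
  have i: "i = r * L + J" by (simp add: r_def J_def)
  have J: "J < L" using L0 by (simp add: J_def)
  have "i < P * L" using Suc.prems by (simp add: L_def mult_ac)
  then have r: "r < P" unfolding r_def by (rule less_mult_imp_div_less)
  have "block (Suc N) a ! i = block N (\<theta> a ! r) ! J" using block_Suc_nth[OF Suc.prems] by (simp only: L_def r_def J_def)
  also have "\<dots> = bit N (\<theta> a ! r) J * m + J mod m" using J by (intro Suc.IH) (simp add: L_def)
  also have "bit N (\<theta> a ! r) J = bit (Suc N) a i"
    using bit_Suc[OF r, of J N a] J i by (simp only: L_def)
  also have "J mod m = i mod m" unfolding J_def L_def by (rule mod_mod_cancel) simp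
  finally show ?case .
qed

subsection \<open>The subshift in terms of odometer phases\<close>

text \<open>Seen up to level \<open>n\<close>, a point is the generating sequence translated by its phase \<open>c\<close>, with holes at
  the positions \<open>i\<close> where \<open>P ^ n\<close> divides \<open>i + c\<close>. Since \<open>2\<close> is invertible modulo \<open>P ^ n\<close>, translation
  turns the valuation of \<open>2 i + 1\<close> into that of \<open>i + c\<close>.\<close>

definition phase :: "nat \<Rightarrow> int \<Rightarrow> (int \<Rightarrow> nat) \<Rightarrow> int \<Rightarrow> bool" where
  "phase n c w i \<longleftrightarrow> w i mod m = nat ((i + c) mod int m) \<and> (\<not> q ^ n dvd i + c \<longrightarrow> w i div m = par (i + c))"

definition Z :: "(int \<Rightarrow> nat) set" where
  "Z = {w. (\<forall>i. w i < 2 * m) \<and> (\<forall>n. \<exists>c. \<forall>i. phase n c w i)}"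

lemma Z_phase: "w \<in> Z \<Longrightarrow> \<exists>c. \<forall>i. phase n c w i"
  unfolding Z_def by blast

lemma phase_cong:
  assumes d: "int m * q ^ n dvd c - c'" and p: "phase n c w i" shows "phase n c' w i"
proof -
  have "int m dvd (i + c) - (i + c')" using d dvd_mult_left by fastforce
  then have "(i + c) mod int m = (i + c') mod int m" by (simp add: mod_eq_dvd_iff)
  moreover have "w i div m = par (i + c')" if n': "\<not> q ^ n dvd i + c'"
  proof -
    have dd: "q ^ n dvd (i + c') - (i + c)" using d dvd_mult_right by (metis add_diff_cancel_left dvd_diff_commute)
    from par_cong[OF n' dd] show ?thesis using p by (simp add: phase_def)
  qed
  ultimately show ?thesis using p by (simp add: phase_def)
qed

text \<open>Phases matter modulo \<open>m * P ^ n\<close> only; if each of these finitely many failed somewhere, all would fail in one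
  large window.\<close>

lemma phase_from_windows:
  assumes "\<And>l::nat. \<exists>c. \<forall>i. \<bar>i\<bar> \<le> int l \<longrightarrow> phase n c w i" shows "\<exists>c. \<forall>i. phase n c w i"
proof (rule ccontr)
  define M where "M = int m * q ^ n"
  have M: "0 < M" using m q_gt by (simp add: M_def)
  assume "\<not> ?thesis"
  then obtain f where f: "\<And>c. \<not> phase n c w (f c)" by metis
  define l where "l = Max ((\<lambda>c. nat \<bar>f c\<bar>) ` {0..<M})"
  obtain c where c: "\<And>i. \<bar>i\<bar> \<le> int l \<Longrightarrow> phase n c w i" using assms[of l] by blast
  define c' where "c' = c mod M"
  have c': "c' \<in> {0..<M}" using M by (simp add: c'_def)
  then have "nat \<bar>f c'\<bar> \<le> l" unfolding l_def by (intro Max_ge) auto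
  then have "phase n c w (f c')" by (intro c) simp
  moreover have "M dvd c - c'" by (simp add: c'_def)
  ultimately have "phase n c' w (f c')" unfolding M_def by (rule phase_cong[rotated])
  then show False using f by blast
qed

text \<open>So \<open>h = (q ^ n + 1) div 2 * (1 - q ^ n)\<close> is one half modulo \<open>q ^ n\<close> and at the same time a multiple of \<open>m\<close>.\<close>

lemma even_shift: "2 * ((q ^ n + 1) div 2 * (1 - q ^ n)) = 1 - q ^ n * q ^ n"
proof -
  have "even (q ^ n + 1)" using q_odd by simp
  then have "2 * ((q ^ n + 1) div 2) = q ^ n + 1" by (rule dvd_mult_div_cancel)
  then have "2 * ((q ^ n + 1) div 2 * (1 - q ^ n)) = (q ^ n + 1) * (1 - q ^ n)" by (metis mult.assoc)
  then show ?thesis by (simp add: algebra_simps)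
qed

lemma level_shift_subset: "level_shift D \<tau> 0 \<subseteq> Z"
proof
  fix w assume w: "w \<in> level_shift D \<tau> 0"
  have "\<exists>c. \<forall>i. \<bar>i\<bar> \<le> int l \<longrightarrow> phase n c w i" for n l
  proof -
    define l' where "l' = max l (m * P ^ n)"
    have "\<exists>N>0. \<exists>a\<in>D N. sublist (map w [-int l'..int l']) (seg \<tau> 0 N [a])" using w by (simp add: level_shift_def)
    then obtain N a where N: "0 < N" "sublist (map w [-int l'..int l']) (block N a)" using seg_0 by auto
    have len: "length (map w [-int l'..int l']) = 2 * l' + 1" by simp
    obtain d where d: "d + (2 * l' + 1) \<le> m * P ^ N"
      and e: "\<And>k. k < 2 * l' + 1 \<Longrightarrow> map w [-int l'..int l'] ! k = block N a ! (d + k)"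
      using N(2) unfolding len[symmetric] length_block[of N a, symmetric] by (rule sublist_nthD) auto
    have "m * P ^ n \<le> l'" by (simp add: l'_def)
    then have "m * P ^ n < m * P ^ N" using d by linarith
    then have "P ^ n < P ^ N" by simp
    then have nN: "n < N" using q_gt by (simp add: power_strict_increasing_iff)
    define h where "h = (q ^ n + 1) div 2 * (1 - q ^ n)"
    have mh: "int m dvd h" unfolding h_def using m_dvd[of n] by (intro dvd_mult) (metis dvd_diff_commute)
    have h2: "2 * h = 1 - q ^ n * q ^ n" unfolding h_def by (rule even_shift)
    have "phase n (int d + int l' + h) w i" if i: "\<bar>i\<bar> \<le> int l" for i
    proof -
      define k where "k = nat (i + int l')"
      have k: "k < 2 * l' + 1" "int k = i + int l'" using i by (auto simp: k_def l'_def)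
      define I where "I = d + k"
      have iI: "i + (int d + int l' + h) = int I + h" using k by (simp add: I_def)
      have "w i = block N a ! I"
        using e[OF k(1)] map_upto_nth[of k "-int l'" "int l'" w] k by (simp add: I_def)
      then have wi: "w i = bit N a I * m + I mod m" using block_nth[of I N a] d k(1) by (simp add: I_def)
      have Im: "I mod m < m" using m by simp
      have mods: "w i mod m = I mod m" "w i div m = bit N a I" using wi Im by simp_all
      have "(int I + h) mod int m = int I mod int m" using mh by (metis add.right_neutral dvd_imp_mod_0 mod_add_right_eq)
      then have "nat ((int I + h) mod int m) = I mod m" by (simp add: zmod_int[symmetric])
      moreover have "bit N a I = par (int I + h)" if n: "\<not> q ^ n dvd int I + h"
      proof -
        have n2: "\<not> q ^ n dvd 2 * (int I + h)" using n dvd_double by blast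
        have "2 * (int I + h) - int (2 * I + 1) = q ^ n * (- (q ^ n))" using h2 by simp
        then have dd: "q ^ n dvd 2 * (int I + h) - int (2 * I + 1)" by (metis dvd_triv_left)
        note pc = par_cong[OF n2 dd]
        have "\<not> q ^ N dvd int (2 * I + 1)" using pc(2) nN by (meson dvd_trans le_imp_power_dvd less_imp_le_nat)
        then have "\<not> P ^ N dvd 2 * I + 1" by (simp only: nat_int_dvd not_False_eq_True)
        then have "bit N a I = par (int (2 * I + 1))" by (simp only: bit_def if_False)
        then show ?thesis using pc(1) par_double[OF n] by simp
      qed
      ultimately show ?thesis unfolding phase_def iI using mods by simp
    qed
    then show ?thesis by blast
  qed
  then have "\<exists>c. \<forall>i. phase n c w i" for n using phase_from_windows by blast
  moreover have "w i < 2 * m" for i using w by (simp add: level_shift_def D_def)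
  ultimately show "w \<in> Z" by (simp add: Z_def)
qed

lemma q_pow_le: "q ^ N \<le> int m * q ^ N"
proof -
  have "1 * q ^ N \<le> int m * q ^ N" using m by (intro mult_right_mono) simp_all
  then show ?thesis by simp
qed

text \<open>The generating sequence itself belongs to the subshift: around \<open>0\<close> it looks like \<open>block (Suc N) 0\<close> around
  \<open>m * P ^ N\<close>.\<close>

lemma level_shift_nonempty: "level_shift D \<tau> 0 \<noteq> {}"
proof -
  define w where "w i = par (2 * i + 1) * m + nat (i mod int m)" for i
  have mr: "nat (i mod int m) < m" for i using m by (simp add: nat_less_iff)
  have wD: "w i < 2 * m" for i
  proof -
    have "par (2 * i + 1) \<le> 1" using par_less[of "2 * i + 1"] by simp
    then have "par (2 * i + 1) * m \<le> m" by (metis mult_le_mono1 nat_mult_1)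
    then show ?thesis using mr[of i] unfolding w_def by linarith
  qed
  have "\<exists>N>0. \<exists>a\<in>D N. sublist (map w [i..j]) (seg \<tau> 0 N [a])" for i j
  proof -
    define l where "l = nat (\<bar>i\<bar> + \<bar>j\<bar>)"
    define N where "N = 2 * l + 2"
    have "N < P ^ N" using q_gt by (intro power_gt_expt) simp
    then have "int N < int (P ^ N)" by (simp only: of_nat_less_iff)
    then have PN: "2 * int l + 2 < q ^ N" by (simp add: N_def)
    have ent: "block (Suc N) 0 ! nat (int (m * P ^ N) + k) = w k" "nat (int (m * P ^ N) + k) < m * P ^ Suc N"
      if k: "\<bar>k\<bar> \<le> int l" for k
    proof -
      define I where "I = nat (int (m * P ^ N) + k)"
      have "q ^ N \<le> int (m * P ^ N)" using q_pow_le by simp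
      then have I: "int I = int m * q ^ N + k" using PN k by (simp add: I_def)
      have "int m * q ^ N + k < int m * (q ^ N * q)"
      proof -
        have "k < q ^ N" using PN k by linarith
        also have "q ^ N \<le> int m * q ^ N" by (rule q_pow_le)
        finally have "int m * q ^ N + k < int m * q ^ N * 2" by simp
        also have "\<dots> \<le> int m * q ^ N * q" using q_gt by (intro mult_left_mono) auto
        finally show ?thesis by (simp add: mult.assoc)
      qed
      then have "int I < int (m * P ^ Suc N)" unfolding I by (simp add: mult_ac)
      then have "I < m * P ^ Suc N" by (simp only: of_nat_less_iff)
      then show lt: "nat (int (m * P ^ N) + k) < m * P ^ Suc N" by (simp only: I_def)
      have nk: "\<not> q ^ N dvd 2 * k + 1"
      proof
        assume "q ^ N dvd 2 * k + 1"
        moreover have "2 * k + 1 \<noteq> 0" by presburger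
        ultimately have "q ^ N \<le> \<bar>2 * k + 1\<bar>" by (intro zdvd_imp_le) simp_all
        then show False using PN k by linarith
      qed
      have "2 * k + 1 - int (2 * I + 1) = q ^ N * (- 2 * int m)" using I by simp
      then have dd: "q ^ N dvd 2 * k + 1 - int (2 * I + 1)" by (metis dvd_triv_left)
      note pc = par_cong[OF nk dd]
      have "\<not> q ^ Suc N dvd int (2 * I + 1)" using pc(2) by (meson dvd_trans le_imp_power_dvd lessI less_imp_le_nat)
      then have "\<not> P ^ Suc N dvd 2 * I + 1" by (simp only: nat_int_dvd not_False_eq_True)
      then have "bit (Suc N) 0 I = par (2 * k + 1)" using pc(1) by (simp only: bit_def if_False)
      moreover have "int I mod int m = k mod int m" unfolding I by simp
      then have "I mod m = nat (k mod int m)" by (metis nat_int zmod_int)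
      ultimately show "block (Suc N) 0 ! nat (int (m * P ^ N) + k) = w k"
        using block_nth[OF lt, of 0] unfolding I_def[symmetric] w_def by simp
    qed
    have "sublist (map w [i..j]) (block (Suc N) 0)"
    proof (cases "i \<le> j")
      case True
      define d where "d = nat (int (m * P ^ N) + i)"
      have il: "\<bar>i\<bar> \<le> int l" "\<bar>j\<bar> \<le> int l" by (simp_all add: l_def)
      have "q ^ N \<le> int (m * P ^ N)" using q_pow_le by simp
      then have dI: "int d = int (m * P ^ N) + i" using PN il by (simp add: d_def)
      show ?thesis
      proof (rule sublist_nthI[where d = d])
        have "int d + (j - i + 1) \<le> int (m * P ^ Suc N)" using ent(2)[OF il(2)] dI by linarith
        then show "d + length (map w [i..j]) \<le> length (block (Suc N) 0)"
          using True by (simp only: length_block length_map length_upto)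
        fix k assume "k < length (map w [i..j])"
        then have k: "int k \<le> j - i" "k < length [i..j]" by simp_all
        have "\<bar>i + int k\<bar> \<le> int l" using k il True by linarith
        then have "block (Suc N) 0 ! (d + k) = w (i + int k)"
        proof -
          have "nat (int (m * P ^ N) + (i + int k)) = d + k" using dI by linarith
          then show ?thesis using ent(1)[OF \<open>\<bar>i + int k\<bar> \<le> int l\<close>] by (simp only:)
        qed
        then show "map w [i..j] ! k = block (Suc N) 0 ! (d + k)" using map_upto_nth[OF k(2)] by simp
      qed
    qed simp
    moreover have "seg \<tau> 0 (Suc N) [0] = block (Suc N) 0" using seg_0[of "Suc N" "[0]"] by simp
    ultimately show ?thesis by (intro exI[of _ "Suc N"] conjI bexI[of _ 0]) (simp_all add: D_def del: block.simps)
  qed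
  then have "w \<in> level_shift D \<tau> 0" using wD by (simp add: level_shift_def D_def)
  then show ?thesis by blast
qed

text \<open>Translate \<open>w\<close> so that its phase becomes that of \<open>v\<close> modulo \<open>m * P ^ n\<close>; a window much shorter than \<open>P ^ n\<close> then has at
  most one hole \<open>i0\<close>. The translation can still be changed by multiples of \<open>m * P ^ n\<close>, which allows to
  prescribe whether the valuation at the hole is \<open>n\<close> or \<open>n + 1\<close>, and hence the symbol there.\<close>

lemma Z_dense:
  assumes w: "w \<in> Z" and v: "v \<in> Z" shows "\<exists>s. agree l v (sh s w)"
proof -
  define n where "n = 2 * l + 1"
  have "n < P ^ n" using q_gt by (intro power_gt_expt) simp
  then have "int n < int (P ^ n)" by (simp only: of_nat_less_iff)
  then have Pn: "2 * int l + 1 < q ^ n" by (simp add: n_def)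
  obtain c where c: "\<And>i. phase (n + 2) c w i" using Z_phase[OF w, of "n + 2"] by blast
  obtain c0 where c0: "\<And>i. phase n c0 v i" using Z_phase[OF v, of n] by blast
  have same: "v i = (sh s w) i" if "v i mod m = w (i + s) mod m" "v i div m = w (i + s) div m" for i s
    using that by (metis sh_apply div_mult_mod_eq)
  \<comment> \<open>A shift that moves the phases by a multiple of \<open>q ^ n\<close> keeps all letters at positions of small valuation.\<close>
  have ok: "v i mod m = w (i + s) mod m" "\<not> q ^ n dvd i + c0 \<longrightarrow> v i div m = w (i + s) div m"
    if s: "s + c = c0 + q ^ n * (int m * u)" for i s u
  proof -
    have e: "i + s + c = i + c0 + int m * (q ^ n * u)" using s by (simp add: algebra_simps)
    have "(i + s + c) mod int m = (i + c0) mod int m" unfolding e by simp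
    then show "v i mod m = w (i + s) mod m" using c[of "i + s"] c0[of i] by (simp add: phase_def)
    show "\<not> q ^ n dvd i + c0 \<longrightarrow> v i div m = w (i + s) div m"
    proof
      assume nd: "\<not> q ^ n dvd i + c0"
      have "i + c0 - (i + s + c) = q ^ n * (- (int m * u))" unfolding e by simp
      then have "q ^ n dvd i + c0 - (i + s + c)" by (metis dvd_triv_left)
      note pc = par_cong[OF nd this]
      have "\<not> q ^ (n + 2) dvd i + s + c" using pc(2) by (meson dvd_trans le_imp_power_dvd le_add1)
      then show "v i div m = w (i + s) div m" using c[of "i + s"] c0[of i] nd pc(1) by (simp add: phase_def)
    qed
  qed
  show ?thesis
  proof (cases "\<exists>i0. \<bar>i0\<bar> \<le> int l \<and> q ^ n dvd i0 + c0")
    case False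
    have "agree l v (sh (c0 - c) w)"
      unfolding agree_def
    proof (intro allI impI)
      fix i assume "\<bar>i\<bar> \<le> int l"
      then have "\<not> q ^ n dvd i + c0" using False by blast
      then show "v i = sh (c0 - c) w i" using ok[of "c0 - c" 0 i] by (intro same) simp_all
    qed
    then show ?thesis ..
  next
    case True
    then obtain i0 where i0: "\<bar>i0\<bar> \<le> int l" "q ^ n dvd i0 + c0" by blast
    then obtain g where g: "i0 + c0 = q ^ n * g" by blast
    define \<beta> where "\<beta> = v i0 div m"
    have \<beta>: "\<beta> < 2" using v m by (simp add: \<beta>_def Z_def div_less_iff_less_mult)
    define t where "t = (if n mod 2 = \<beta> then 0 else 1 :: nat)"
    have nt: "(n + t) mod 2 = \<beta>" using \<beta> unfolding t_def by (cases "n mod 2 = \<beta>") (simp, presburger)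
    obtain z where z: "1 - q ^ 2 = int m * z" using m_dvd[of 2] by (metis dvd_def dvd_diff_commute)
    \<comment> \<open>Chinese remainders: \<open>int m * u\<close> is \<open>0\<close> modulo \<open>m\<close> and \<open>q ^ t - g\<close> modulo \<open>q ^ 2\<close>.\<close>
    define u where "u = (q ^ t - g) * z"
    define s where "s = c0 - c + q ^ n * (int m * u)"
    have sc: "s + c = c0 + q ^ n * (int m * u)" by (simp add: s_def)
    have "int m * u = (q ^ t - g) * (1 - q ^ 2)" unfolding u_def z by simp
    then have "g + int m * u = q ^ t + q ^ 2 * (g - q ^ t)" by (simp add: algebra_simps)
    then have e: "i0 + s + c = q ^ n * (q ^ t + q ^ 2 * (g - q ^ t))"
    proof -
      have "i0 + s + c = (i0 + c0) + q ^ n * (int m * u)" using sc by linarith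
      also have "\<dots> = q ^ n * (g + int m * u)" unfolding g by (rule distrib_left[symmetric])
      finally show ?thesis by (simp only: \<open>g + int m * u = _\<close>)
    qed
    have t1: "t \<le> 1" by (simp add: t_def)
    have qq: "q ^ t + q ^ 2 * (g - q ^ t) = q ^ t * (1 + q * (q ^ (1 - t) * (g - q ^ t)))"
    proof -
      have "t = 0 \<or> t = 1" using t1 by linarith
      then show ?thesis by (elim disjE) (simp_all add: power2_eq_square algebra_simps)
    qed
    define x where "x = 1 + q * (q ^ (1 - t) * (g - q ^ t))"
    have ex: "i0 + s + c = q ^ (n + t) * x" unfolding e qq x_def by (simp add: power_add)
    have "\<not> q dvd x"
    proof
      assume "q dvd x"
      then have "q dvd 1" unfolding x_def using dvd_add_left_iff[of q "q * (q ^ (1 - t) * (g - q ^ t))" 1] by simp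
      then show False using q_gt by simp
    qed
    then have n1: "\<not> q ^ Suc (n + t) dvd i0 + s + c" unfolding ex power_Suc2 using q_gt by simp
    have "par (i0 + s + c) = \<beta>" using par_eqI[OF _ n1] ex nt by simp
    moreover have "\<not> q ^ (n + 2) dvd i0 + s + c"
    proof -
      have "Suc (n + t) \<le> n + 2" using t1 by simp
      then show ?thesis using n1 by (meson dvd_trans le_imp_power_dvd)
    qed
    ultimately have hole: "w (i0 + s) div m = v i0 div m" using c[of "i0 + s"] by (simp add: phase_def \<beta>_def)
    have "agree l v (sh s w)"
      unfolding agree_def
    proof (intro allI impI)
      fix i assume i: "\<bar>i\<bar> \<le> int l"
      show "v i = sh s w i"
      proof (rule same)
        show "v i mod m = w (i + s) mod m" using ok(1)[OF sc] .
        show "v i div m = w (i + s) div m"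
        proof (cases "i = i0")
          case False
          have "\<not> q ^ n dvd i + c0"
          proof
            assume "q ^ n dvd i + c0"
            then have "q ^ n dvd i - i0" using i0(2) dvd_diff[of "q ^ n" "i + c0" "i0 + c0"] by simp
            then have "q ^ n \<le> \<bar>i - i0\<bar>" using False by (intro zdvd_imp_le) simp_all
            then show False using i i0(1) Pn by linarith
          qed
          then show ?thesis using ok(2)[OF sc] by blast
        qed (use hole in simp)
      qed
    qed
    then show ?thesis ..
  qed
qed

lemma Z_eq: "Z = level_shift D \<tau> 0"
proof
  obtain w where w: "w \<in> level_shift D \<tau> 0" using level_shift_nonempty by blast
  show "Z \<subseteq> level_shift D \<tau> 0"
  proof
    fix v assume v: "v \<in> Z"
    show "v \<in> level_shift D \<tau> 0"
    proof (rule level_shift_windows[OF w])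
      show "v i \<in> D 0" for i using v by (simp add: Z_def D_def)
      show "\<exists>t. agree l v (sh t w)" for l using Z_dense w v level_shift_subset by blast
    qed
  qed
qed (rule level_shift_subset)

lemma subshift_Z: "subshift {0..<2 * m} Z"
  using subshift_level_shift[of D 0 \<tau>] by (simp add: Z_eq D_def)

lemma minimal_Z: "minimal_subshift {0..<2 * m} Z"
proof
  show "subshift {0..<2 * m} Z" by (rule subshift_Z)
  show "Z \<noteq> {}" using level_shift_nonempty Z_eq by simp
qed (rule Z_dense)

lemma strong_toeplitz_Z: "strong_toeplitz_of_finite_rank {0..<2 * m} Z"
  unfolding strong_toeplitz_of_finite_rank_def strong_toeplitz_of_rank_def
proof (intro exI[of _ "m + 1"] exI[of _ D] exI[of _ \<tau>] conjI)
  show "2 \<le> m + 1" using m by simp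
  have "D 0 = {0..<2 * m}" by (simp add: D_def)
  then show "conjugate_systems (shift_top {0..<2 * m} Z) shift (shift_top (D 0) (level_shift D \<tau> 0)) shift"
    unfolding conjugate_systems_def Z_eq by (intro exI[of _ id]) (simp add: homeomorphic_map_id)
qed (rule subshift_Z directive constlen is_primitive is_proper is_recognizable rank)+


subsection \<open>The automorphism group\<close>

text \<open>Rotation of the second component of every pair.\<close>

definition rot :: "int \<Rightarrow> (int \<Rightarrow> nat) \<Rightarrow> int \<Rightarrow> nat" where
  "rot c w = (\<lambda>i. w i div m * m + nat ((int (w i mod m) + c) mod int m))"

lemma rot_div: "rot c w i div m = w i div m" and rot_mod: "rot c w i mod m = nat ((int (w i mod m) + c) mod int m)"
proof -
  have "nat ((int (w i mod m) + c) mod int m) < m" using m by (simp add: nat_less_iff)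
  then show "rot c w i div m = w i div m" "rot c w i mod m = nat ((int (w i mod m) + c) mod int m)"
    using m by (simp_all add: rot_def)
qed

lemma letter_eqI: "v mod m = w mod m \<Longrightarrow> v div m = w div m \<Longrightarrow> v = (w :: nat)"
  by (metis div_mult_mod_eq)

lemma rot_rot: "rot a (rot c w) = rot (a + c) w"
proof
  fix i
  have "rot a (rot c w) i mod m = nat (((int (w i mod m) + c) mod int m + a) mod int m)"
    using m by (simp add: rot_mod)
  also have "\<dots> = rot (a + c) w i mod m" by (simp add: rot_mod mod_simps algebra_simps)
  finally show "rot a (rot c w) i = rot (a + c) w i" by (rule letter_eqI) (simp add: rot_div)
qed

lemma rot_multiple: "int m dvd c \<Longrightarrow> rot c w = w"
proof
  fix i assume c: "int m dvd c"
  have "(int (w i mod m) + c) mod int m = int (w i mod m) mod int m" using c by (auto elim!: dvdE)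
  then have "rot c w i mod m = w i mod m" by (simp add: rot_mod zmod_int[symmetric])
  then show "rot c w i = w i" by (rule letter_eqI) (simp add: rot_div)
qed

lemma rot_sh: "rot c (sh t w) = sh t (rot c w)" by (simp add: rot_def sh_def)

lemma rot_agree: "agree l v w \<Longrightarrow> agree l (rot c v) (rot c w)" by (simp add: agree_def rot_def)

text \<open>Adding \<open>q ^ n * a\<close> to a phase adds \<open>a\<close> to the residues modulo \<open>m\<close> and is invisible at level \<open>n\<close>.\<close>

lemma rot_Z:
  assumes w: "w \<in> Z" shows "rot a w \<in> Z"
proof -
  have "rot a w i < 2 * m" for i
  proof -
    have "rot a w i div m < 2" using w m by (simp add: rot_div Z_def div_less_iff_less_mult)
    then show ?thesis using m by (simp add: div_less_iff_less_mult)
  qed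
  moreover have "\<exists>c. \<forall>i. phase n c (rot a w) i" for n
  proof -
    obtain c where c: "\<And>i. phase n c w i" using Z_phase[OF w, of n] by blast
    have "phase n (c + q ^ n * a) (rot a w) i" for i
    proof -
      have "int m dvd (i + c + a) - (i + (c + q ^ n * a))"
      proof -
        have "(i + c + a) - (i + (c + q ^ n * a)) = (q ^ n - 1) * (- a)" by (simp add: algebra_simps)
        then show ?thesis using m_dvd[of n] by simp
      qed
      then have "(i + c + a) mod int m = (i + (c + q ^ n * a)) mod int m" by (simp add: mod_eq_dvd_iff)
      moreover have "int (w i mod m) = (i + c) mod int m" using c[of i] m by (simp add: phase_def)
      ultimately have "rot a w i mod m = nat ((i + (c + q ^ n * a)) mod int m)"
        by (simp add: rot_mod mod_simps)
      moreover have "w i div m = par (i + (c + q ^ n * a))" if n: "\<not> q ^ n dvd i + (c + q ^ n * a)"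
      proof -
        have "i + (c + q ^ n * a) - (i + c) = q ^ n * a" by simp
        then have dd: "q ^ n dvd i + (c + q ^ n * a) - (i + c)" by (metis dvd_triv_left)
        from par_cong[OF n dd] show ?thesis using c[of i] by (simp add: phase_def)
      qed
      ultimately show ?thesis by (simp add: phase_def rot_div)
    qed
    then show ?thesis by blast
  qed
  ultimately show ?thesis by (simp add: Z_def)
qed

text \<open>The points whose hole at \<open>0\<close> persists at all levels, so that the symbol \<open>\<beta>\<close> there is arbitrary.\<close>

definition hole :: "nat \<Rightarrow> int \<Rightarrow> int \<Rightarrow> nat" where
  "hole \<beta> j = (\<lambda>i. (if i = 0 then \<beta> else par i) * m + nat ((i + j) mod int m))"

lemma hole_div: "hole \<beta> j i div m = (if i = 0 then \<beta> else par i)"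
  and hole_mod: "hole \<beta> j i mod m = nat ((i + j) mod int m)"
proof -
  have "nat ((i + j) mod int m) < m" using m by (simp add: nat_less_iff)
  then show "hole \<beta> j i div m = (if i = 0 then \<beta> else par i)" "hole \<beta> j i mod m = nat ((i + j) mod int m)"
    using m by (simp_all add: hole_def)
qed

lemma hole_Z: "\<beta> < 2 \<Longrightarrow> hole \<beta> 0 \<in> Z"
proof -
  assume \<beta>: "\<beta> < 2"
  have "hole \<beta> 0 i < 2 * m" for i
  proof -
    have "hole \<beta> 0 i div m < 2" using \<beta> par_less by (simp add: hole_div)
    then show ?thesis using m by (simp add: div_less_iff_less_mult)
  qed
  moreover have "phase n 0 (hole \<beta> 0) i" for n i by (auto simp: phase_def hole_div hole_mod)
  ultimately show ?thesis unfolding Z_def by blast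
qed

lemma rot_hole: "rot j (hole \<beta> 0) = hole \<beta> j"
proof
  fix i
  have "rot j (hole \<beta> 0) i mod m = hole \<beta> j i mod m" using m by (simp add: rot_mod hole_mod mod_simps)
  then show "rot j (hole \<beta> 0) i = hole \<beta> j i" by (rule letter_eqI) (simp add: rot_div hole_div)
qed

text \<open>Asymptotic points have the same phase, because a phase can be read off from any half-line.\<close>

lemma phases_agree:
  assumes v: "\<And>i. phase (Suc n) c v i" and w: "\<And>i. phase (Suc n) d w i"
    and eq: "\<And>i. a \<le> i \<Longrightarrow> v i = w i"
  shows "q ^ n dvd c - d"
proof -
  have "q ^ k dvd c - d" if "k \<le> n" for k
    using that
  proof (induction k)
    case (Suc k)
    then have IH: "q ^ k dvd c - d" by simp
    \<comment> \<open>A far position at which \<open>v\<close> sees the valuation \<open>Suc k\<close> exactly.\<close>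
    define x where "x = 1 + q * (\<bar>a\<bar> + \<bar>c\<bar>)"
    define i where "i = q ^ Suc k * x - c"
    have ic: "i + c = q ^ Suc k * x" by (simp add: i_def)
    have "\<bar>a\<bar> + \<bar>c\<bar> \<le> x" unfolding x_def using q_gt mult_right_mono[of 1 q "\<bar>a\<bar> + \<bar>c\<bar>"] by simp
    moreover have "0 \<le> x" using calculation by linarith
    then have "1 * x \<le> q ^ Suc k * x" using q_gt by (intro mult_right_mono one_le_power) simp_all
    ultimately have ai: "a \<le> i" unfolding i_def by linarith
    have "\<not> q dvd x" unfolding x_def using q_gt dvd_add_left_iff[of q "q * (\<bar>a\<bar> + \<bar>c\<bar>)" 1] by simp
    then have nx: "\<not> q ^ Suc (Suc k) dvd i + c" unfolding ic power_Suc2[of q "Suc k"] using q_gt by simp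
    have pv: "par (i + c) = Suc k mod 2" by (rule par_eqI[OF _ nx]) (simp only: ic dvd_triv_left)
    have "\<not> q ^ Suc n dvd i + c" using nx Suc.prems by (meson dvd_trans le_imp_power_dvd Suc_le_mono)
    then have vi: "v i div m = Suc k mod 2" using v[of i] pv by (simp add: phase_def)
    have kd: "q ^ k dvd i + d"
    proof -
      have "q ^ k dvd i + c" unfolding ic by simp
      then have "q ^ k dvd (i + c) - (c - d)" using IH by (rule dvd_diff)
      then show ?thesis by (simp add: algebra_simps)
    qed
    have "q ^ Suc k dvd i + d"
    proof (rule ccontr)
      assume nd: "\<not> ?thesis"
      have pw: "par (i + d) = k mod 2" by (rule par_eqI[OF kd nd])
      have "\<not> q ^ Suc n dvd i + d" using nd Suc.prems by (meson dvd_trans le_imp_power_dvd le_SucI)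
      then have "w i div m = k mod 2" using w[of i] pw by (simp add: phase_def)
      then have "Suc k mod 2 = k mod 2" using vi eq[OF ai] by simp
      then show False by presburger
    qed
    moreover have "q ^ Suc k dvd i + c" unfolding ic by (rule dvd_triv_left)
    ultimately have "q ^ Suc k dvd (i + c) - (i + d)" by (intro dvd_diff)
    then show ?case by simp
  qed simp
  then show ?thesis by simp
qed

text \<open>Both points have the same phase at each level, so a position where they differ is a hole at all levels.\<close>

lemma asymptotic_pair:
  assumes v: "v \<in> Z" and w: "w \<in> Z" and eq: "\<And>i. a \<le> i \<Longrightarrow> v i = w i" and ne: "v k \<noteq> w k"
  obtains \<beta> j where "sh k v = hole \<beta> j"
proof -
  have zero: "q ^ n dvd k + c" if c: "\<And>i. phase (Suc n) c v i" for n c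
  proof (rule ccontr)
    assume nd: "\<not> q ^ n dvd k + c"
    obtain d where d: "\<And>i. phase (Suc n) d w i" using Z_phase[OF w, of "Suc n"] by blast
    have cd: "q ^ n dvd c - d" by (rule phases_agree[OF c d eq])
    have dd: "q ^ n dvd (k + c) - (k + d)" using cd by simp
    note pc = par_cong[OF nd dd]
    have n1: "\<not> q ^ Suc n dvd k + c" "\<not> q ^ Suc n dvd k + d"
      using nd pc(2) by (meson dvd_trans le_imp_power_dvd le_SucI order_refl)+
    have "v k div m = w k div m" using c[of k] d[of k] n1 pc(1) by (simp add: phase_def)
    moreover have "v k mod m = w k mod m"
    proof -
      have "nat ((a + c) mod int m) = nat ((a + d) mod int m)"
        using c[of a] d[of a] eq[of a] by (simp add: phase_def)
      then have "(a + c) mod int m = (a + d) mod int m" using m by (simp add: nat_eq_iff2)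
      then have "int m dvd (a + c) - (a + d)" by (simp add: mod_eq_dvd_iff)
      then have "(k + c) mod int m = (k + d) mod int m" by (simp add: mod_eq_dvd_iff)
      then show ?thesis using c[of k] d[of k] by (simp add: phase_def)
    qed
    ultimately show False using ne letter_eqI by blast
  qed
  obtain c0 where c0: "\<And>i. phase (Suc 0) c0 v i" using Z_phase[OF v, of "Suc 0"] by blast
  have "sh k v i = hole (v k div m) (k + c0) i" for i
  proof (rule letter_eqI)
    show "sh k v i mod m = hole (v k div m) (k + c0) i mod m"
      using c0[of "i + k"] by (simp add: phase_def hole_mod sh_apply algebra_simps)
    show "sh k v i div m = hole (v k div m) (k + c0) i div m"
    proof (cases "i = 0")
      case False
      define n where "n = nat \<bar>i\<bar>"
      have "n < P ^ n" using q_gt by (intro power_gt_expt) simp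
      then have "int n < int (P ^ n)" by (simp only: of_nat_less_iff)
      then have "\<bar>i\<bar> < q ^ n" by (simp add: n_def)
      then have nd: "\<not> q ^ n dvd i" using False zdvd_imp_le[of "q ^ n" "\<bar>i\<bar>"] by auto
      obtain c where c: "\<And>i. phase (Suc n) c v i" using Z_phase[OF v, of "Suc n"] by blast
      have kc: "q ^ n dvd k + c" by (rule zero[OF c])
      have dd: "q ^ n dvd i - (i + k + c)"
      proof -
        have "i - (i + k + c) = - (k + c)" by simp
        then show ?thesis using kc by (simp only: dvd_minus_iff)
      qed
      note pc = par_cong[OF nd dd]
      have "\<not> q ^ Suc n dvd i + k + c" using pc(2) by (meson dvd_trans le_imp_power_dvd le_SucI order_refl)
      then have "v (i + k) div m = par i" using c[of "i + k"] pc(1) by (simp add: phase_def)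
      then show ?thesis using False by (simp add: hole_div sh_apply)
    qed (simp add: hole_div sh_apply)
  qed
  then have "sh k v = hole (v k div m) (k + c0)" by blast
  then show ?thesis by (rule that)
qed

sublocale S: minimal_subshift "{0..<2 * m}" Z by (rule minimal_Z)

lemma continuous_rot: "continuous_map S.XT S.XT (rot c)"
  unfolding continuous_map
proof (intro conjI allI impI)
  show "rot c ` topspace S.XT \<subseteq> topspace S.XT" using rot_Z by auto
next
  fix U assume U: "openin S.XT U"
  have "\<exists>w. \<forall>y\<in>Z. agree w x y \<longrightarrow> rot c y \<in> U" if "x \<in> Z" "rot c x \<in> U" for x
  proof -
    obtain w where w: "\<And>y. y \<in> Z \<Longrightarrow> agree w (rot c x) y \<Longrightarrow> y \<in> U"
      using S.openin_XT_D[OF U \<open>rot c x \<in> U\<close>] by blast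
    have "\<forall>y\<in>Z. agree w x y \<longrightarrow> rot c y \<in> U" using w[OF rot_Z] rot_agree[of w x] by simp
    then show ?thesis ..
  qed
  then show "openin S.XT {x \<in> topspace S.XT. rot c x \<in> U}"
    unfolding S.openin_XT_iff by simp
qed

definition \<rho> where "\<rho> = (\<lambda>x\<in>Z. rot 1 x)"

lemma \<rho>_in: "\<rho> \<in> carrier S.\<Gamma>"
  unfolding \<rho>_def
proof (rule S.homeo_in_\<Gamma>)
  have "rot a (rot (- a) x) = x" for a x using rot_multiple[of 0 x] by (simp add: rot_rot)
  from this[of 1] this[of "-1"] have "homeomorphic_maps S.XT S.XT (rot 1) (rot (-1))"
    unfolding homeomorphic_maps_def using continuous_rot by simp
  then show "homeomorphic_map S.XT S.XT (rot 1)" using homeomorphic_maps_map by blast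
qed (rule rot_sh)

lemma \<rho>_pow: "x \<in> Z \<Longrightarrow> (\<rho> [^]\<^bsub>S.\<Gamma>\<^esub> (k::int)) x = rot k x"
  by (rule S.flow_pow[where T = rot, OF \<rho>_in _ rot_Z rot_rot]) (simp_all add: \<rho>_def rot_multiple)

text \<open>The points \<open>hole 0 0\<close> and \<open>hole 1 0\<close> agree except at \<open>0\<close>. Their images under \<open>f\<close> are again distinct and
  asymptotic, so \<open>f (hole 0 0)\<close> is a translate of some \<open>hole \<beta> j\<close>. That point is asymptotic to a translate of
  \<open>rot j (hole 0 0)\<close>, and asymptotic images of one point belong to equal automorphisms.\<close>

lemma aut_form:
  assumes f: "f \<in> carrier S.\<Gamma>"
  shows "\<exists>(k::int) (c::int). f = S.\<sigma> [^]\<^bsub>S.\<Gamma>\<^esub> k \<otimes>\<^bsub>S.\<Gamma>\<^esub> \<rho> [^]\<^bsub>S.\<Gamma>\<^esub> c"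
proof -
  define u v where "u = hole 0 0" and "v = hole 1 0"
  have uZ: "u \<in> Z" "v \<in> Z" by (simp_all add: u_def v_def hole_Z)
  have fZ: "f u \<in> Z" "f v \<in> Z" using S.aut_X[OF f] uZ by blast+
  have "finite {f}" "{f} \<subseteq> carrier S.\<Gamma>" using f by auto
  then obtain R where R': "0 \<le> R" "\<And>g. g \<in> {f} \<Longrightarrow> S.radius R g" by (rule S.common_radius) blast
  have eq: "f u i = f v i" if "R + 1 \<le> i" for i
    by (rule S.radiusD[of R f, OF _ uZ]) (use R' that in \<open>auto simp: u_def v_def hole_def\<close>)
  have "u 0 \<noteq> v 0" using m by (simp add: u_def v_def hole_def)
  have "f u \<noteq> f v"
  proof
    assume "f u = f v"
    then have "u = v" using S.inv_apply[OF f] uZ by metis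
    then show False using \<open>u 0 \<noteq> v 0\<close> by simp
  qed
  then obtain k where k: "f u k \<noteq> f v k" by blast
  obtain \<beta> j where bj: "sh k (f u) = hole \<beta> j" by (rule asymptotic_pair[OF fZ eq k])
  define g where "g = S.\<sigma> [^]\<^bsub>S.\<Gamma>\<^esub> (-k) \<otimes>\<^bsub>S.\<Gamma>\<^esub> \<rho> [^]\<^bsub>S.\<Gamma>\<^esub> j"
  have cl: "S.\<sigma> [^]\<^bsub>S.\<Gamma>\<^esub> (-k) \<in> carrier S.\<Gamma>" "\<rho> [^]\<^bsub>S.\<Gamma>\<^esub> j \<in> carrier S.\<Gamma>" using S.\<sigma>_in \<rho>_in by auto
  have g: "g \<in> carrier S.\<Gamma>" using cl by (simp add: g_def)
  have gu: "g u = sh (-k) (hole 0 j)"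
    using S.mult_apply[OF cl uZ(1)] S.\<sigma>_pow[OF rot_Z[OF uZ(1)], of "-k" j] \<rho>_pow[OF uZ(1)]
    by (simp add: g_def u_def rot_hole)
  have "f = g"
  proof (rule S.aut_eq_if_asymptotic[OF f g uZ(1)])
    fix i assume i: "k + 1 \<le> i"
    have "f u i = sh k (f u) (i - k)" by (simp add: sh_apply)
    also have "\<dots> = hole 0 j (i - k)" using i by (simp add: bj hole_def)
    finally show "f u i = g u i" by (simp add: gu sh_apply)
  qed
  then show ?thesis unfolding g_def by blast
qed

text \<open>The first component of \<open>hole 0 0\<close> has no period \<open>k\<close>: if \<open>a\<close> is the exponent of \<open>P\<close> in \<open>k\<close>, the positions
  \<open>P ^ (a + 1)\<close> and \<open>P ^ (a + 1) + k\<close> carry different symbols.\<close>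

lemma aut_independent:
  assumes one: "S.\<sigma> [^]\<^bsub>S.\<Gamma>\<^esub> (k::int) \<otimes>\<^bsub>S.\<Gamma>\<^esub> \<rho> [^]\<^bsub>S.\<Gamma>\<^esub> (c::int) = \<one>\<^bsub>S.\<Gamma>\<^esub>"
  shows "k = 0 \<and> int m dvd c"
proof -
  define u where "u = hole 0 0"
  have uZ: "u \<in> Z" by (simp add: u_def hole_Z)
  have cl: "S.\<sigma> [^]\<^bsub>S.\<Gamma>\<^esub> k \<in> carrier S.\<Gamma>" "\<rho> [^]\<^bsub>S.\<Gamma>\<^esub> c \<in> carrier S.\<Gamma>" using S.\<sigma>_in \<rho>_in by auto
  have "sh k (hole 0 c) = u"
    using S.mult_apply[OF cl uZ] S.\<sigma>_pow[OF rot_Z[OF uZ], of k c] \<rho>_pow[OF uZ] S.one_apply[OF uZ] one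
    by (simp add: u_def rot_hole)
  then have e: "hole 0 c (i + k) = hole 0 0 i" for i unfolding u_def by (metis sh_apply)
  have "k = 0"
  proof (rule ccontr)
    assume k: "k \<noteq> 0"
    define n where "n = nat \<bar>k\<bar>"
    have "n < P ^ n" using q_gt by (intro power_gt_expt) simp
    then have "int n < int (P ^ n)" by (simp only: of_nat_less_iff)
    then have "\<not> q ^ n dvd k" using k zdvd_imp_le[of "q ^ n" "\<bar>k\<bar>"] by (auto simp: n_def)
    then obtain a where a: "q ^ a dvd k" "\<not> q ^ Suc a dvd k" "par k = a mod 2" by (rule par_level)
    have "par k = 0" using arg_cong[OF e[of 0], of "\<lambda>x. x div m"] k by (simp add: hole_div)
    define i where "i = q ^ Suc a"
    have i: "i \<noteq> 0" "i + k \<noteq> 0"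
    proof -
      show "i \<noteq> 0" using q_gt by (simp add: i_def)
      show "i + k \<noteq> 0" using a(2) unfolding i_def by (metis add.inverse_unique dvd_minus_iff dvd_refl)
    qed
    have "par (i + k) = par k"
    proof (rule par_cong(1)[OF a(2)])
      show "q ^ Suc a dvd k - (i + k)" by (simp add: i_def)
    qed
    moreover have "par i = Suc a mod 2"
    proof (rule par_eqI)
      have "q ^ Suc a < q ^ Suc (Suc a)" using q_gt by simp
      then show "\<not> q ^ Suc (Suc a) dvd i" unfolding i_def using q_gt by (intro zdvd_not_zless) simp_all
    qed (simp add: i_def)
    moreover have "par (i + k) = par i" using arg_cong[OF e[of i], of "\<lambda>x. x div m"] i by (simp add: hole_div)
    ultimately have "a mod 2 = Suc a mod 2" using a(3) by simp
    then show False by presburger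
  qed
  moreover have "int m dvd c"
  proof -
    have "nat (c mod int m) = 0" using arg_cong[OF e[of 0], of "\<lambda>x. x mod m"] \<open>k = 0\<close> by (simp add: hole_mod)
    moreover have "0 \<le> c mod int m" using m by simp
    ultimately show ?thesis by (simp add: dvd_eq_mod_eq_0)
  qed
  ultimately show ?thesis by blast
qed

theorem \<Gamma>_iso_integers_times_cyclic: "S.\<Gamma> \<cong> integer_group \<times>\<times> integer_mod_group m"
proof -
  have comm: "(S.\<sigma> [^]\<^bsub>S.\<Gamma>\<^esub> (k::int) \<otimes>\<^bsub>S.\<Gamma>\<^esub> \<rho> [^]\<^bsub>S.\<Gamma>\<^esub> (c::int)) x = sh k (rot c x)" if x: "x \<in> Z" for k c x
  proof -
    have cl: "S.\<sigma> [^]\<^bsub>S.\<Gamma>\<^esub> k \<in> carrier S.\<Gamma>" "\<rho> [^]\<^bsub>S.\<Gamma>\<^esub> c \<in> carrier S.\<Gamma>" using S.\<sigma>_in \<rho>_in by auto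
    show ?thesis using S.mult_apply[OF cl x] S.\<sigma>_pow[OF rot_Z[OF x], of k c] \<rho>_pow[OF x] by simp
  qed
  interpret C: comm_group S.\<Gamma>
  proof (rule S.\<Gamma>.group_comm_groupI)
    fix f g assume fg: "f \<in> carrier S.\<Gamma>" "g \<in> carrier S.\<Gamma>"
    obtain k c :: int where f: "f = S.\<sigma> [^]\<^bsub>S.\<Gamma>\<^esub> k \<otimes>\<^bsub>S.\<Gamma>\<^esub> \<rho> [^]\<^bsub>S.\<Gamma>\<^esub> c" using aut_form[OF fg(1)] by blast
    obtain l d :: int where g: "g = S.\<sigma> [^]\<^bsub>S.\<Gamma>\<^esub> l \<otimes>\<^bsub>S.\<Gamma>\<^esub> \<rho> [^]\<^bsub>S.\<Gamma>\<^esub> d" using aut_form[OF fg(2)] by blast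
    show "f \<otimes>\<^bsub>S.\<Gamma>\<^esub> g = g \<otimes>\<^bsub>S.\<Gamma>\<^esub> f"
    proof (rule S.aut_eqI)
      show "f \<otimes>\<^bsub>S.\<Gamma>\<^esub> g \<in> carrier S.\<Gamma>" "g \<otimes>\<^bsub>S.\<Gamma>\<^esub> f \<in> carrier S.\<Gamma>" using fg by auto
      fix x assume x: "x \<in> Z"
      have fx: "f y = sh k (rot c y)" and gx: "g y = sh l (rot d y)" if "y \<in> Z" for y
        unfolding f g using comm that by blast+
      have "f (g x) = sh k (rot c (sh l (rot d x)))" using fx[of "g x"] gx[OF x] S.aut_X[OF fg(2) x] by simp
      moreover have "g (f x) = sh l (rot d (sh k (rot c x)))" using gx[of "f x"] fx[OF x] S.aut_X[OF fg(1) x] by simp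
      moreover have "sh k (rot c (sh l (rot d x))) = sh l (rot d (sh k (rot c x)))"
        by (simp add: rot_sh rot_rot add.commute)
      ultimately show "(f \<otimes>\<^bsub>S.\<Gamma>\<^esub> g) x = (g \<otimes>\<^bsub>S.\<Gamma>\<^esub> f) x" using S.mult_apply fg x by simp
    qed
  qed
  have "\<rho> [^]\<^bsub>S.\<Gamma>\<^esub> int m = \<one>\<^bsub>S.\<Gamma>\<^esub>"
    using \<rho>_in \<rho>_pow by (intro S.aut_eqI) (simp_all add: S.one_apply rot_multiple)
  then have one: "\<rho> [^]\<^bsub>S.\<Gamma>\<^esub> m = \<one>\<^bsub>S.\<Gamma>\<^esub>" by (simp only: int_pow_int)
  show ?thesis
    by (rule C.iso_integer_times_cyclic[OF S.\<sigma>_in \<rho>_in _ one]) (use m aut_form aut_independent in auto)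
qed

end

section \<open>Automorphism groups of Toeplitz subshifts\<close>

theorem theorem1p3:
  shows "(\<forall>(A :: 'a set) X.
            toeplitz_subshift A X \<and> finite_topological_rank (shift_top A X) shift \<longrightarrow>
            (\<exists>C :: int monoid. group C \<and> cyclic_group C \<and> finite (carrier C) \<and>
               automorphism_group (shift_top A X) shift \<cong> integer_group \<times>\<times> C)) \<and>
         (\<forall>C :: 'c monoid. group C \<and> cyclic_group C \<and> finite (carrier C) \<longrightarrow>
            (\<exists>(A :: nat set) X. strong_toeplitz_of_finite_rank A X \<and>
               automorphism_group (shift_top A X) shift \<cong> integer_group \<times>\<times> C))"
proof (intro conjI allI impI)
  fix A :: "'a set" and X
  assume "toeplitz_subshift A X \<and> finite_topological_rank (shift_top A X) shift"
  then obtain m where m: "0 < m"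
    "automorphism_group (shift_top A X) shift \<cong> integer_group \<times>\<times> integer_mod_group m"
    using toeplitz_finite_rank_automorphisms by blast
  then show "\<exists>C :: int monoid. group C \<and> cyclic_group C \<and> finite (carrier C) \<and>
      automorphism_group (shift_top A X) shift \<cong> integer_group \<times>\<times> C"
    using cyclic_integer_mod_group group_integer_mod_group by (intro exI[of _ "integer_mod_group m"]) simp
next
  fix C :: "'c monoid"
  assume C: "group C \<and> cyclic_group C \<and> finite (carrier C)"
  obtain m :: nat where m: "1 \<le> m" "integer_mod_group m \<cong> C"
    by (rule group.finite_cyclic_iso[of C]) (use C in auto)
  interpret E: torsion_toeplitz m by unfold_locales (rule m(1))
  have "integer_group \<times>\<times> integer_mod_group m \<cong> integer_group \<times>\<times> C"
    by (rule group.DirProd_iso_trans[OF group_integer_group _ m(2)]) (simp_all add: iso_refl)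
  with E.\<Gamma>_iso_integers_times_cyclic have "automorphism_group (shift_top {0..<2 * m} E.Z) shift \<cong> integer_group \<times>\<times> C"
    by (rule iso_trans)
  then show "\<exists>(A :: nat set) X. strong_toeplitz_of_finite_rank A X \<and>
      automorphism_group (shift_top A X) shift \<cong> integer_group \<times>\<times> C"
    using E.strong_toeplitz_Z by blast
qed

end
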